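(* Let $X,Y$ be Banach spaces and let $A:X\to Y$ be a weakly compact operator. Then exactly one of the following alternatives holds: (i) $T$ factors through $A$. (ii) $A$ admits an equivalent norm with property $(\beta)$ (that is, there exist equivalent norms on $X$ and $Y$ with respect to which $A$ has property $(\beta)$).
   Context: Operators are bounded and linear; $B_X$ is the closed unit ball of $X$. $T=\bigcup_{n=0}^\infty\mathbb N^n$ is the set of all finite sequences of natural numbers (including the empty sequence), equipped with the graph distance $d$ of the graph in which each sequence is adjacent to its extensions by one term; explicitly $d(s,t)=|s|+|t|-2|u|$, where $|\cdot|$ is length and $u$ is the longest common initial segment of $s$ and $t$. $T$ factors through $A:X\to Y$ if there exist a function $\varphi:T\to X$ and $D>0$ such that for every $s,t\in T$, both of the numbers $\|A\varphi(s)-A\varphi(t)\|$ and $\|\varphi(s)-\varphi(t)\|$ lie in the interval $[d(s,t)/D,\ d(s,t)]$. $A:X\to Y$ has property $(\beta)$ if for every $\varepsilon>0$ there exists $\beta=\beta(\varepsilon)>0$ such that for any $x\in B_X$ and any sequence $(x_n)\subset B_X$ with $\inf_{m\neq n}\|Ax_m-Ax_n\|\geqslant\varepsilon$, there exists $n\in\mathbb N$ such that $\|x+x_n\|\leqslant2(1-\beta)$. *)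

theory Defs
  imports "HOL-Analysis.Analysis" "HOL-Library.Sublist"
begin

section \<open>Weakly compact operators\<close>

definition weak_topology :: "'a::real_normed_vector topology" where
  "weak_topology =
     topology_generated_by {f -` U | (f :: 'a \<Rightarrow> real) U. bounded_linear f \<and> open U}"

definition weakly_compact_operator ::
    "('a::real_normed_vector \<Rightarrow> 'b::real_normed_vector) \<Rightarrow> bool" where
  "weakly_compact_operator A \<longleftrightarrow>
     bounded_linear A \<and>
     compactin weak_topology (weak_topology closure_of (A ` cball 0 1))"

section \<open>The countably branching tree of infinite height\<close>

text \<open>The vertices are all finite sequences of naturals, i.e. the whole type \<^typ>\<open>nat list\<close>.\<close>

definition tree_dist :: "nat list \<Rightarrow> nat list \<Rightarrow> real" where
  "tree_dist s t =
     real (length s) + real (length t) - 2 * real (length (longest_common_prefix s t))"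

definition tree_factors_through ::
    "('a::real_normed_vector \<Rightarrow> 'b::real_normed_vector) \<Rightarrow> bool" where
  "tree_factors_through A \<longleftrightarrow>
     (\<exists>(\<phi> :: nat list \<Rightarrow> 'a) (D :: real). D > 0 \<and>
        (\<forall>s t. norm (A (\<phi> s) - A (\<phi> t)) \<in> {tree_dist s t / D .. tree_dist s t} \<and>
               norm (\<phi> s - \<phi> t) \<in> {tree_dist s t / D .. tree_dist s t}))"

section \<open>Equivalent norms and property \<open>(\<beta>)\<close>\<close>

text \<open>Since the norm of a type is fixed by its class instance, renormings are explicit functions.\<close>

definition is_norm :: "('a::real_vector \<Rightarrow> real) \<Rightarrow> bool" where
  "is_norm N \<longleftrightarrow>
     (\<forall>x. 0 \<le> N x) \<and>
     (\<forall>x. N x = 0 \<longleftrightarrow> x = 0) \<and>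
     (\<forall>c x. N (c *\<^sub>R x) = \<bar>c\<bar> * N x) \<and>
     (\<forall>x y. N (x + y) \<le> N x + N y)"

definition equivalent_norm :: "('a::real_normed_vector \<Rightarrow> real) \<Rightarrow> bool" where
  "equivalent_norm N \<longleftrightarrow>
     is_norm N \<and> (\<exists>c C. 0 < c \<and> 0 < C \<and> (\<forall>x. c * norm x \<le> N x \<and> N x \<le> C * norm x))"

text \<open>Property \<open>(\<beta>)\<close> of \<open>A\<close> when its domain carries the norm \<open>N\<close> and its codomain the norm \<open>M\<close>.\<close>

definition property_beta ::
    "('a::real_vector \<Rightarrow> real) \<Rightarrow> ('b::real_vector \<Rightarrow> real) \<Rightarrow> ('a \<Rightarrow> 'b) \<Rightarrow> bool" where
  "property_beta N M A \<longleftrightarrow>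
     (\<forall>\<epsilon>>0. \<exists>\<beta>>0. \<forall>x (u :: nat \<Rightarrow> 'a).
        N x \<le> 1 \<longrightarrow> (\<forall>n. N (u n) \<le> 1) \<longrightarrow>
        (INF (m, n) \<in> {(m, n). m \<noteq> n}. M (A (u m) - A (u n))) \<ge> \<epsilon> \<longrightarrow>
        (\<exists>n. N (x + u n) \<le> 2 * (1 - \<beta>)))"

definition admits_equivalent_norm_beta ::
    "('a::real_normed_vector \<Rightarrow> 'b::real_normed_vector) \<Rightarrow> bool" where
  "admits_equivalent_norm_beta A \<longleftrightarrow>
     (\<exists>N M. equivalent_norm N \<and> equivalent_norm M \<and> property_beta N M A)"

end

theory Submission
  imports Defs "HOL-Library.Discrete_Functions" "HOL-Library.Nat_Bijection"
begin

text \<open>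
  The two alternatives exclude each other by self-improvement. Suppose \<open>A\<close> has property \<open>(\<beta>)\<close> for
  some norms and \<open>\<phi>\<close> embeds the tree, with images \<open>A (\<phi> s)\<close> at distance at least \<open>c * tree_dist s t\<close>.
  Above a given edge the next vertex can be chosen in infinitely many separated ways, so property
  \<open>(\<beta>)\<close> shortens one of the two-edge paths by a factor \<open>1 - \<beta>\<close>. The subtree made of these paths,
  scaled by one half, satisfies the same lower bound with edges shorter by that factor
  (\<open>beta_shrinks_edges\<close>); iteration contradicts the lower bound.

  For the existence of one alternative, let \<open>K\<close> be the closure of the image of the unit ball. It is convex
  and weakly compact. Two instances of one notion, the locale \<open>dual_pairing\<close>, control it: the
  Szlenk-type derivation of \<open>K\<close> in the weak topology with respect to the norm, and the derivation of the
  dual unit ball in the weak* topology with respect to the seminorm \<open>f \<mapsto> sup {f (A x) | norm x \<le> 1}\<close>.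

  If one of these derivations fails to vanish after finitely many steps for some \<open>\<epsilon>\<close>, its points give trees of
  every finite height with separated increments, and a pigeonhole argument makes the increments and
  their norming elements almost biorthogonal (\<open>ex_separated_tree\<close>). Trees of height \<open>2 ^ k\<close>
  are stacked, the \<open>k\<close>-th one occupying the levels from \<open>2 ^ k\<close> to \<open>2 ^ (k + 1) - 1\<close>, which gives a map
  on the whole infinite tree. For the dual ball the sum of the norming elements along
  a branch is the required embedding; for \<open>K\<close> it is, up to approximation, the sum along a branch of the
  tree points themselves, measured from the starting points of their blocks (\<open>tree_factors_through_of_dual_tree\<close>, \<open>tree_factors_through_of_range_tree\<close>).

  If both derivations vanish after finitely many steps for every \<open>\<epsilon>\<close>, the concave upper
  semicontinuous envelope of the rank of a point drops by a definite amount along weakly convergent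
  sequences that stay far from their limit (\<open>envelope_drop\<close>). This holds although derived sets need not
  be convex: points of a small weak neighbourhood that all have the maximal rank there are close to each
  other, so finite averages can be separated only if a definite proportion of the mass has smaller rank.
  On \<open>K\<close> the negative of the envelope is a convex function \<open>-g\<close> which is asymptotically uniformly convex; on the
  dual ball, conjugation turns the envelope \<open>h\<close> into a small perturbation of the norm of \<open>Y\<close> which is asymptotically
  uniformly smooth along \<open>A\<close>. The infimal convolution of the two keeps both properties at a fixed
  scale \<open>\<epsilon>\<close>, and this forces a gain in the midpoint inequality for separated sequences
  (\<open>inf_convolution_midpoint_gain\<close>).

  Such functions for \<open>\<epsilon> = 1, 1/2, 1/3, \<dots>\<close>, composed with \<open>A\<close> and symmetrized, are summed with
  small weights and added to the norm of \<open>X\<close>. The Minkowski functional of a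
  sublevel set of the sum is the norm with property \<open>(\<beta>)\<close> (\<open>beta_norm_of_functions\<close>); the norm of \<open>Y\<close>
  is kept.
\<close>

section \<open>Functionals on normed spaces\<close>

definition sublinear :: "('a::real_vector \<Rightarrow> real) \<Rightarrow> bool" where
  "sublinear p \<longleftrightarrow> (\<forall>x y. p (x + y) \<le> p x + p y) \<and> (\<forall>c>0. \<forall>x. p (c *\<^sub>R x) \<le> c * p x)"

lemma sublinear_scale:
  assumes "sublinear p" "c \<ge> 0"
  shows "p (c *\<^sub>R x) = c * p x"
proof (cases "c = 0")
  case True
  have "p ((1/2) *\<^sub>R 0) \<le> (1/2) * p 0" "p (2 *\<^sub>R 0) \<le> 2 * p 0"
    using assms(1) unfolding sublinear_def by (metis zero_less_divide_1_iff zero_less_numeral)+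
  then show ?thesis using True by simp
next
  case False
  then have c: "c > 0" using assms by simp
  have "p (inverse c *\<^sub>R (c *\<^sub>R x)) \<le> inverse c * p (c *\<^sub>R x)"
    using assms(1) c unfolding sublinear_def by (metis positive_imp_inverse_positive)
  then have "c * p x \<le> p (c *\<^sub>R x)" using c by (simp add: field_simps)
  moreover have "p (c *\<^sub>R x) \<le> c * p x" using assms(1) c unfolding sublinear_def by blast
  ultimately show ?thesis by simp
qed

lemma sublinear_ge_minus:
  assumes "sublinear p" shows "- p (- x) \<le> p x"
proof -
  have "p (x + - x) \<le> p x + p (- x)" using assms unfolding sublinear_def by blast
  moreover have "p 0 = 0" using sublinear_scale[OF assms, of 0 0] by simp
  ultimately show ?thesis by simp
qed

lemma sublinear_INF:
  assumes ne: "C \<noteq> {}" and sub: "\<And>q. q \<in> C \<Longrightarrow> sublinear q"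
    and bdd: "\<And>x. bdd_below ((\<lambda>q. q x) ` C)"
    and dir: "\<And>q r x y. q \<in> C \<Longrightarrow> r \<in> C \<Longrightarrow> \<exists>s\<in>C. s x \<le> q x \<and> s y \<le> r y"
  shows "sublinear (\<lambda>x. INF q\<in>C. q x)"
  unfolding sublinear_def
proof (intro conjI allI impI)
  fix x y
  have "(INF q\<in>C. q (x + y)) \<le> q x + r y" if "q \<in> C" "r \<in> C" for q r
  proof -
    obtain s where s: "s \<in> C" "s x \<le> q x" "s y \<le> r y" using dir[OF \<open>q \<in> C\<close> \<open>r \<in> C\<close>] by blast
    have "(INF q\<in>C. q (x + y)) \<le> s (x + y)" by (rule cINF_lower[OF bdd s(1)])
    also have "\<dots> \<le> s x + s y" using sub[OF s(1)] unfolding sublinear_def by blast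
    finally show ?thesis using s by linarith
  qed
  then have "(INF q\<in>C. q (x + y)) - r y \<le> (INF q\<in>C. q x)" if "r \<in> C" for r
    using that by (intro cINF_greatest[OF ne]) (simp add: algebra_simps)
  then have "(INF q\<in>C. q (x + y)) - (INF q\<in>C. q x) \<le> (INF q\<in>C. q y)"
    by (intro cINF_greatest[OF ne]) (simp add: algebra_simps)
  then show "(INF q\<in>C. q (x + y)) \<le> (INF q\<in>C. q x) + (INF q\<in>C. q y)" by simp
next
  fix c :: real and x assume c: "c > 0"
  have "(INF q\<in>C. q (c *\<^sub>R x)) / c \<le> (INF q\<in>C. q x)"
  proof (rule cINF_greatest[OF ne])
    fix q assume q: "q \<in> C"
    have "(INF q\<in>C. q (c *\<^sub>R x)) \<le> q (c *\<^sub>R x)" by (rule cINF_lower[OF bdd q])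
    also have "\<dots> = c * q x" using sublinear_scale[OF sub[OF q]] c by simp
    finally show "(INF q\<in>C. q (c *\<^sub>R x)) / c \<le> q x" using c by (simp add: field_simps)
  qed
  then show "(INF q\<in>C. q (c *\<^sub>R x)) \<le> c * (INF q\<in>C. q x)" using c by (simp add: field_simps)
qed

text \<open>The function \<open>x \<mapsto> inf {q (x + t y) - t q y | t \<ge> 0}\<close> is the largest sublinear function below \<open>q\<close> that is
linear on the line through \<open>y\<close> with slope \<open>q y\<close>. The choice \<open>t = 1\<close> at \<open>- y\<close> gives the last inequality.
A minimal sublinear function is its own tilt for every \<open>y\<close> and is therefore linear.\<close>

lemma sublinear_tilt:
  fixes y :: "'a::real_vector"
  assumes q: "sublinear q"
  obtains r where "sublinear r" "\<And>x. r x \<le> q x" "r (- y) \<le> - q y"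
proof -
  define r where "r x = (INF t\<in>{0..}. q (x + t *\<^sub>R y) - t * q y)" for x
  have low: "- q (- x) \<le> q (x + t *\<^sub>R y) - t * q y" if "t \<ge> 0" for x t
  proof -
    have "q ((x + t *\<^sub>R y) + - x) \<le> q (x + t *\<^sub>R y) + q (- x)" using q unfolding sublinear_def by blast
    then show ?thesis using sublinear_scale[OF q that, of y] by simp
  qed
  have bdd: "bdd_below ((\<lambda>t. q (x + t *\<^sub>R y) - t * q y) ` {0..})" for x
    unfolding bdd_below_def using low by auto
  have up: "r x \<le> q (x + t *\<^sub>R y) - t * q y" if "t \<ge> 0" for x t
    unfolding r_def using that by (intro cINF_lower[OF bdd]) auto
  have "sublinear r"
    unfolding sublinear_def
  proof (intro conjI allI impI)
    fix x x'
    have *: "r (x + x') \<le> (q (x + t *\<^sub>R y) - t * q y) + (q (x' + s *\<^sub>R y) - s * q y)"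
      if "t \<ge> 0" "s \<ge> 0" for s t
    proof -
      have "r (x + x') \<le> q ((x + x') + (t + s) *\<^sub>R y) - (t + s) * q y" using that by (intro up) simp
      also have "(x + x') + (t + s) *\<^sub>R y = (x + t *\<^sub>R y) + (x' + s *\<^sub>R y)" by (simp add: algebra_simps)
      also have "q ((x + t *\<^sub>R y) + (x' + s *\<^sub>R y)) \<le> q (x + t *\<^sub>R y) + q (x' + s *\<^sub>R y)"
        using q unfolding sublinear_def by blast
      finally show ?thesis by (simp add: algebra_simps)
    qed
    have "r (x + x') - (q (x' + s *\<^sub>R y) - s * q y) \<le> r x" if "s \<ge> 0" for s
      unfolding r_def[of x] by (rule cINF_greatest) (use *[OF _ that] in \<open>auto simp: algebra_simps\<close>)
    then have "r (x + x') - r x \<le> (q (x' + s *\<^sub>R y) - s * q y)" if "s \<ge> 0" for s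
      using that by (simp add: algebra_simps)
    then have "r (x + x') - r x \<le> r x'" unfolding r_def[of x'] by (intro cINF_greatest) auto
    then show "r (x + x') \<le> r x + r x'" by simp
  next
    fix c :: real and x assume c: "c > 0"
    have "r (c *\<^sub>R x) / c \<le> q (x + t *\<^sub>R y) - t * q y" if "t \<ge> 0" for t
    proof -
      have "r (c *\<^sub>R x) \<le> q (c *\<^sub>R x + (c * t) *\<^sub>R y) - (c * t) * q y" using c that by (intro up) simp
      also have "c *\<^sub>R x + (c * t) *\<^sub>R y = c *\<^sub>R (x + t *\<^sub>R y)" by (simp add: algebra_simps)
      also have "q (c *\<^sub>R (x + t *\<^sub>R y)) = c * q (x + t *\<^sub>R y)" using c by (intro sublinear_scale[OF q]) simp
      finally show ?thesis using c by (simp add: field_simps)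
    qed
    then have "r (c *\<^sub>R x) / c \<le> r x" unfolding r_def[of x] by (intro cINF_greatest) auto
    then show "r (c *\<^sub>R x) \<le> c * r x" using c by (simp add: field_simps)
  qed
  moreover have "r x \<le> q x" for x using up[of 0 x] by simp
  moreover have "r (- y) \<le> - q y"
    using up[of 1 "- y"] sublinear_scale[OF q, of 0 y] by simp
  ultimately show thesis by (rule that)
qed

lemma minimal_sublinear_below:
  fixes p :: "'a::real_vector \<Rightarrow> real"
  assumes p: "sublinear p"
  obtains q where "sublinear q" "\<And>x. q x \<le> p x"
    and "\<And>r. sublinear r \<Longrightarrow> (\<And>x. r x \<le> q x) \<Longrightarrow> r = q"
proof -
  define A where "A = {q. sublinear q \<and> (\<forall>x. q x \<le> p x)}"
  define P where "P q r \<longleftrightarrow> (\<forall>x::'a. r x \<le> (q x::real))" for q r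
  \<comment> \<open>The order is reversed, so that Zorn's lemma yields a minimal element.\<close>
  have "\<exists>m\<in>A. \<forall>a\<in>A. P m a \<longrightarrow> a = m"
  proof (rule predicate_Zorn)
    show "partial_order_on A (relation_of P A)"
      by (rule partial_order_on_relation_ofI) (auto simp: P_def fun_eq_iff intro: order.antisym order_trans)
  next
    fix C assume C: "C \<in> Chains (relation_of P A)"
    have CA: "C \<subseteq> A" using C unfolding Chains_def relation_of_def by auto
    show "\<exists>u\<in>A. \<forall>a\<in>C. P a u"
    proof (cases "C = {}")
      case True then show ?thesis using p unfolding A_def by auto
    next
      case False
      have low: "- p (- x) \<le> q x" if "q \<in> C" for q x
        using that CA sublinear_ge_minus[of q x] unfolding A_def
        by (metis (no_types, lifting) in_mono mem_Collect_eq minus_le_iff neg_le_iff_le order_trans)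
      have bdd: "bdd_below ((\<lambda>q. q x) ` C)" for x unfolding bdd_below_def using low by auto
      define u where "u x = (INF q\<in>C. q x)" for x
      have "sublinear u" unfolding u_def
      proof (rule sublinear_INF[OF False _ bdd])
        show "sublinear q" if "q \<in> C" for q using that CA unfolding A_def by auto
        show "\<exists>s\<in>C. s x \<le> q x \<and> s y \<le> r y" if "q \<in> C" "r \<in> C" for q r x y
        proof -
          have "P q r \<or> P r q" using C that unfolding Chains_def relation_of_def by auto
          then show ?thesis using that unfolding P_def by blast
        qed
      qed
      moreover have uq: "u x \<le> q x" if "q \<in> C" for q x
        unfolding u_def by (rule cINF_lower[OF bdd that])
      moreover have "u x \<le> p x" for x
        using False uq CA unfolding A_def by (metis (no_types, lifting) all_not_in_conv in_mono mem_Collect_eq order_trans)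
      ultimately show ?thesis unfolding A_def P_def by (intro bexI[of _ u]) auto
    qed
  qed
  then obtain m where m: "m \<in> A" "\<And>a. a \<in> A \<Longrightarrow> P m a \<Longrightarrow> a = m" by blast
  show thesis
  proof (rule that[of m])
    show "sublinear m" "\<And>x. m x \<le> p x" using m(1) unfolding A_def by auto
    show "r = m" if "sublinear r" "\<And>x. r x \<le> m x" for r
      using that m(1) by (intro m(2)) (auto simp: A_def P_def intro: order_trans)
  qed
qed

text \<open>The Hahn-Banach theorem without an extension step: tilting \<open>p\<close> at \<open>x0\<close> fixes the value there, and a
minimal sublinear function below the tilt is linear.\<close>

theorem hahn_banach_sublinear:
  fixes p :: "'a::real_vector \<Rightarrow> real"
  assumes p: "sublinear p"
  obtains f where "linear f" "\<And>x. f x \<le> p x" "f x0 = p x0"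
proof -
  obtain r where r: "sublinear r" "\<And>x. r x \<le> p x" "r (- x0) \<le> - p x0"
    using sublinear_tilt[OF p] by blast
  obtain q where q: "sublinear q" "\<And>x. q x \<le> r x"
    and min: "\<And>s. sublinear s \<Longrightarrow> (\<And>x. s x \<le> q x) \<Longrightarrow> s = q"
    using minimal_sublinear_below[OF r(1)] by blast
  have neg: "q (- x) = - q x" for x
  proof -
    obtain s where s: "sublinear s" "\<And>z. s z \<le> q z" "s (- x) \<le> - q x"
      using sublinear_tilt[OF q(1)] by blast
    then have "q (- x) \<le> - q x" using min by metis
    then show ?thesis using sublinear_ge_minus[OF q(1), of x] by simp
  qed
  have add: "q (x + y) = q x + q y" for x y
  proof -
    have "q (x + y) \<le> q x + q y" "q (- x + - y) \<le> q (- x) + q (- y)"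
      using q(1) unfolding sublinear_def by blast+
    then show ?thesis using neg[of "x + y"] neg[of x] neg[of y] by simp
  qed
  have scale: "q (c *\<^sub>R x) = c * q x" for c x
  proof (cases "c \<ge> 0")
    case True then show ?thesis by (rule sublinear_scale[OF q(1)])
  next
    case False
    then have "q ((- c) *\<^sub>R x) = (- c) * q x" by (intro sublinear_scale[OF q(1)]) simp
    then show ?thesis using neg[of "c *\<^sub>R x"] by simp
  qed
  have lin: "linear q" by (rule linearI) (simp_all add: add scale)
  have "q x0 = p x0"
  proof (rule antisym)
    show "q x0 \<le> p x0" using q(2) r(2) order_trans by blast
    show "p x0 \<le> q x0" using q(2)[of "- x0"] r(3) neg[of x0] by linarith
  qed
  then show thesis using lin q(2) r(2) that order_trans by metis
qed

lemma norming_functional: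
  fixes y :: "'a::real_normed_vector"
  obtains f :: "'a \<Rightarrow>\<^sub>L real" where "norm f \<le> 1" "blinfun_apply f y = norm y"
proof -
  have "sublinear (norm :: 'a \<Rightarrow> real)" unfolding sublinear_def by (auto simp: norm_triangle_ineq)
  then obtain f where f: "linear f" "\<And>x. f x \<le> norm x" "f y = norm y"
    using hahn_banach_sublinear by blast
  have ab: "\<bar>f x\<bar> \<le> norm x" for x using f(2)[of x] f(2)[of "- x"] linear_neg[OF f(1), of x] by (simp add: abs_le_iff)
  have bl: "bounded_linear f"
    by (rule bounded_linear_intro[where K=1]) (use ab f(1) in \<open>auto simp: linear_add linear_scale\<close>)
  show thesis
  proof (rule that[of "Blinfun f"])
    show "norm (Blinfun f) \<le> 1"
      by (rule norm_blinfun_bound) (use ab in \<open>auto simp: bounded_linear_Blinfun_apply[OF bl]\<close>)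
    show "blinfun_apply (Blinfun f) y = norm y" by (simp add: bounded_linear_Blinfun_apply[OF bl] f(3))
  qed
qed

text \<open>The gauge \<open>p y = inf {(2 / \<tau>) * norm (y - A x) + norm x}\<close> measures \<open>y\<close> against the convex hull of the
image ball and a ball of radius \<open>\<tau> / 2\<close>. It is at most 1 on the image ball and exceeds 1 by a definite amount at a point whose
distance from the image ball is at least \<open>\<tau>\<close>.\<close>

lemma separate_from_image_ball:
  fixes A :: "'a::real_normed_vector \<Rightarrow> 'b::real_normed_vector"
  assumes A: "bounded_linear A" and y0: "y0 \<notin> closure (A ` cball 0 1)"
  obtains f :: "'b \<Rightarrow> real" and s :: real where "bounded_linear f" "\<And>x. norm x \<le> 1 \<Longrightarrow> f (A x) \<le> 1"
    "f y0 \<ge> 1 + s" "s > 0"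
proof -
  interpret A: bounded_linear A by fact
  obtain \<tau> where t: "\<tau> > 0" "\<And>x. norm x \<le> 1 \<Longrightarrow> norm (A x - y0) \<ge> \<tau>"
    using y0 unfolding closure_approachable by (force simp: dist_norm not_less)
  obtain M where M: "M > 0" "\<And>x. norm (A x) \<le> M * norm x" using A.pos_bounded by (metis mult.commute)
  define p where "p y = (INF x. norm (y - A x) * (2/\<tau>) + norm x)" for y
  have bdd: "bdd_below (range (\<lambda>x. norm (y - A x) * (2/\<tau>) + norm x))" for y
    using t(1) by (intro bdd_belowI2[of _ 0]) simp
  have up: "p y \<le> norm (y - A x) * (2/\<tau>) + norm x" for y x
    unfolding p_def by (rule cINF_lower[OF bdd]) simp
  have sub: "sublinear p"
    unfolding sublinear_def
  proof (intro conjI allI impI)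
    fix y z
    have *: "p (y + z) \<le> (norm (y - A u) * (2/\<tau>) + norm u) + (norm (z - A v) * (2/\<tau>) + norm v)" for u v
    proof -
      have "p (y + z) \<le> norm ((y + z) - A (u + v)) * (2/\<tau>) + norm (u + v)" by (rule up)
      also have "norm ((y + z) - A (u + v)) \<le> norm (y - A u) + norm (z - A v)"
        using norm_triangle_ineq[of "y - A u" "z - A v"] by (simp add: A.add algebra_simps)
      also have "norm (u + v) \<le> norm u + norm v" by (rule norm_triangle_ineq)
      finally show ?thesis using t(1) by (simp add: algebra_simps divide_right_mono)
    qed
    have "p (y + z) - (norm (z - A v) * (2/\<tau>) + norm v) \<le> p y" for v
      unfolding p_def[of y] by (rule cINF_greatest) (use *[of _ v] in \<open>auto simp: algebra_simps\<close>)
    then have "p (y + z) - p y \<le> p z"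
      unfolding p_def[of z] by (intro cINF_greatest) (auto simp: algebra_simps)
    then show "p (y + z) \<le> p y + p z" by simp
  next
    fix c :: real and y assume c: "c > 0"
    have "p (c *\<^sub>R y) / c \<le> norm (y - A x) * (2/\<tau>) + norm x" for x
    proof -
      have "p (c *\<^sub>R y) \<le> norm (c *\<^sub>R y - A (c *\<^sub>R x)) * (2/\<tau>) + norm (c *\<^sub>R x)" by (rule up)
      also have "c *\<^sub>R y - A (c *\<^sub>R x) = c *\<^sub>R (y - A x)" by (simp add: A.scaleR algebra_simps)
      finally have "p (c *\<^sub>R y) \<le> c * (norm (y - A x) * (2/\<tau>) + norm x)" using c by (simp only: norm_scaleR) (simp add: algebra_simps)
      then show ?thesis using c by (simp add: pos_divide_le_eq mult.commute)
    qed
    then have "p (c *\<^sub>R y) / c \<le> p y" unfolding p_def[of y] by (intro cINF_greatest) auto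
    then show "p (c *\<^sub>R y) \<le> c * p y" using c by (simp add: field_simps)
  qed
  \<comment> \<open>Scaling \<open>x\<close> of norm at most \<open>1 + s\<close> into the unit ball moves \<open>A x\<close> by at most \<open>s * M\<close>.\<close>
  define s where "s = \<tau> / (4 * (\<tau> + M))"
  have s: "s > 0" unfolding s_def using t(1) M(1) by simp
  have s2: "\<tau> * (1 + s) / 2 + s * M < \<tau>"
  proof -
    have "s * (4 * (\<tau> + M)) = \<tau>"
      using s_def t(1) M(1) by (subst (asm) nonzero_eq_divide_eq) auto
    moreover have "s * \<tau> > 0" using s t(1) by simp
    ultimately show ?thesis using t(1) by (simp add: field_simps)
  qed
  have py0: "p y0 \<ge> 1 + s"
    unfolding p_def
  proof (rule cINF_greatest)
    fix x
    show "1 + s \<le> norm (y0 - A x) * (2/\<tau>) + norm x"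
    proof (rule ccontr)
      assume n: "\<not> ?thesis"
      have "norm (y0 - A x) * (2/\<tau>) < 1 + s" using n norm_ge_zero[of x] by linarith
      then have n1: "norm (y0 - A x) < \<tau> * (1 + s) / 2" using t(1) by (simp add: field_simps)
      have "0 \<le> norm (y0 - A x) * (2/\<tau>)" using t(1) by simp
      then have n2: "norm x \<le> 1 + s" using n by linarith
      define x' where "x' = (1 / (1 + s)) *\<^sub>R x"
      have x': "norm x' \<le> 1" unfolding x'_def using n2 s by (simp add: field_simps)
      have "x - x' = s *\<^sub>R x'" unfolding x'_def using s by (simp add: algebra_simps divide_simps flip: scaleR_add_left)
      then have "A x - A x' = s *\<^sub>R A x'" by (metis A.diff A.scaleR)
      moreover have "norm (A x') \<le> M" using M(2)[of x'] x' M(1) by (smt (verit) mult_left_le)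
      ultimately have "norm (A x - A x') \<le> s * M" using s by (simp add: mult_left_mono)
      then have "norm (A x' - y0) < \<tau>"
        using n1 s2 norm_triangle_ineq[of "A x' - A x" "A x - y0"] by (simp add: norm_minus_commute)
      then show False using t(2)[OF x'] by simp
    qed
  qed simp
  obtain f where f: "linear f" "\<And>y. f y \<le> p y" "f y0 = p y0"
    using hahn_banach_sublinear[OF sub] by blast
  have fu: "f y \<le> norm y * (2/\<tau>)" for y using f(2)[of y] up[of y 0] by (simp add: A.zero)
  have bl: "bounded_linear f"
  proof (rule bounded_linear_intro[where K="2/\<tau>"])
    show "norm (f y) \<le> norm y * (2/\<tau>)" for y
      using fu[of y] fu[of "- y"] linear_neg[OF f(1), of y] by (simp add: abs_le_iff)
  qed (use f(1) in \<open>auto simp: linear_add linear_scale\<close>)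
  show thesis
  proof (rule that[OF bl _ _ s])
    show "f (A x) \<le> 1" if "norm x \<le> 1" for x using f(2)[of "A x"] up[of "A x" x] that by simp
    show "1 + s \<le> f y0" using py0 f(3) by simp
  qed
qed

section \<open>Dual pairings and slice derivations\<close>

lemma finite_pigeonhole:
  fixes w :: "nat \<Rightarrow> 'z \<Rightarrow> real"
  assumes Z: "finite Z" and bd: "\<And>j z. z \<in> Z \<Longrightarrow> \<bar>w j z\<bar> \<le> M" and c: "\<zeta> > 0"
  obtains i j where "i < j" "\<And>z. z \<in> Z \<Longrightarrow> \<bar>w i z - w j z\<bar> < \<zeta>"
proof -
  \<comment> \<open>Rounding to multiples of \<open>\<zeta>\<close> leaves only finitely many possible values.\<close>
  define cell where "cell j = (\<lambda>z\<in>Z. \<lfloor>w j z / \<zeta>\<rfloor>)" for j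
  have "range cell \<subseteq> (\<Pi>\<^sub>E z\<in>Z. {\<lfloor>- M / \<zeta>\<rfloor>..\<lfloor>M / \<zeta>\<rfloor>})"
  proof
    fix x assume "x \<in> range cell"
    then obtain j where x: "x = cell j" by blast
    show "x \<in> (\<Pi>\<^sub>E z\<in>Z. {\<lfloor>- M / \<zeta>\<rfloor>..\<lfloor>M / \<zeta>\<rfloor>})"
      unfolding x cell_def
    proof (rule restrict_PiE_iff[THEN iffD2], intro ballI)
      fix z assume z: "z \<in> Z"
      have "- M / \<zeta> \<le> w j z / \<zeta>" "w j z / \<zeta> \<le> M / \<zeta>"
        using bd[OF z, of j] c by (intro divide_right_mono; simp add: abs_le_iff)+
      then show "\<lfloor>w j z / \<zeta>\<rfloor> \<in> {\<lfloor>- M / \<zeta>\<rfloor>..\<lfloor>M / \<zeta>\<rfloor>}" by (auto intro: floor_mono)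
    qed
  qed
  then have fin: "finite (range cell)" by (rule finite_subset) (intro finite_PiE Z, simp)
  then have "\<not> inj cell" using finite_imageD infinite_UNIV_nat by blast
  then obtain i j where ij: "i \<noteq> j" "cell i = cell j" unfolding inj_def by blast
  have *: "\<bar>w i z - w j z\<bar> < \<zeta>" if "z \<in> Z" for z
  proof -
    have "\<lfloor>w i z / \<zeta>\<rfloor> = \<lfloor>w j z / \<zeta>\<rfloor>" using fun_cong[OF ij(2), of z] that by (simp add: cell_def)
    then have "\<bar>w i z / \<zeta> - w j z / \<zeta>\<bar> < 1" by linarith
    then show ?thesis using c by (simp add: field_simps flip: diff_divide_distrib)
  qed
  show thesis
    using ij(1) * that[of i j] that[of j i] by (metis abs_minus_commute linorder_neqE_nat)
qed

text \<open>Weak topologies enter through basic neighbourhoods given by finitely many functionals, so one argument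
covers the weak topology of \<open>Y\<close> and the weak* topology of its dual.\<close>

definition weak_nbhd :: "('e \<Rightarrow> 'i \<Rightarrow> real) \<Rightarrow> 'i set \<Rightarrow> real \<Rightarrow> 'e \<Rightarrow> 'e set" where
  "weak_nbhd pr G \<tau> z = {y. \<forall>g\<in>G. \<bar>pr y g - pr z g\<bar> < \<tau>}"

lemma weak_nbhd_self [simp]: "\<tau> > 0 \<Longrightarrow> z \<in> weak_nbhd pr G \<tau> z"
  by (simp add: weak_nbhd_def)

lemma weak_nbhd_mono: "y \<in> weak_nbhd pr G \<tau> z \<Longrightarrow> G' \<subseteq> G \<Longrightarrow> \<tau> \<le> \<tau>' \<Longrightarrow> y \<in> weak_nbhd pr G' \<tau>' z"
  unfolding weak_nbhd_def by force

lemma weak_nbhd_trans: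
  "x \<in> weak_nbhd pr G \<tau> y \<Longrightarrow> y \<in> weak_nbhd pr G \<tau>' z \<Longrightarrow> x \<in> weak_nbhd pr G (\<tau> + \<tau>') z"
  unfolding weak_nbhd_def by (smt (verit) mem_Collect_eq)

lemma weak_nbhd_D: "y \<in> weak_nbhd pr G \<tau> z \<Longrightarrow> g \<in> G \<Longrightarrow> \<bar>pr y g - pr z g\<bar> < \<tau>"
  unfolding weak_nbhd_def by blast

text \<open>Compactness in the topology whose basic neighbourhoods are \<open>weak_nbhd\<close>, stated for covers that assign a basic
neighbourhood to each point.\<close>

definition weakly_compact_set :: "('e \<Rightarrow> 'i \<Rightarrow> real) \<Rightarrow> 'e set \<Rightarrow> bool" where
  "weakly_compact_set pr K \<longleftrightarrow>
     (\<forall>G \<tau>. (\<forall>z\<in>K. finite (G z) \<and> \<tau> z > 0) \<longrightarrow>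
        (\<exists>Z. finite Z \<and> Z \<subseteq> K \<and> (\<forall>y\<in>K. \<exists>z\<in>Z. y \<in> weak_nbhd pr (G z) (\<tau> z) z)))"

lemma weakly_compact_setE:
  assumes "weakly_compact_set pr K" "\<And>z. z \<in> K \<Longrightarrow> finite (G z)" "\<And>z. z \<in> K \<Longrightarrow> \<tau> z > 0"
  obtains Z where "finite Z" "Z \<subseteq> K" "\<And>y. y \<in> K \<Longrightarrow> \<exists>z\<in>Z. y \<in> weak_nbhd pr (G z) (\<tau> z) z"
proof -
  have "\<forall>z\<in>K. finite (G z) \<and> \<tau> z > 0" using assms by blast
  from assms(1)[unfolded weakly_compact_set_def, THEN spec, THEN spec, THEN mp, OF this]
  obtain Z where "finite Z" "Z \<subseteq> K" "\<forall>y\<in>K. \<exists>z\<in>Z. y \<in> weak_nbhd pr (G z) (\<tau> z) z" by (elim exE conjE)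
  then show thesis by (intro that[of Z]) auto
qed

lemma weak_cluster_point:
  assumes K: "weakly_compact_set pr K" and y: "\<And>n::nat. y n \<in> K"
  obtains v where "v \<in> K" "\<And>G \<tau>. finite G \<Longrightarrow> \<tau> > 0 \<Longrightarrow> infinite {n. y n \<in> weak_nbhd pr G \<tau> v}"
proof (rule ccontr)
  assume "\<not> thesis"
  then have no: "\<not> (\<exists>v\<in>K. \<forall>G \<tau>. finite G \<longrightarrow> \<tau> > 0 \<longrightarrow> infinite {n. y n \<in> weak_nbhd pr G \<tau> v})"
  proof (intro notI, elim bexE)
    fix v assume v: "v \<in> K" "\<forall>G \<tau>. finite G \<longrightarrow> \<tau> > 0 \<longrightarrow> infinite {n. y n \<in> weak_nbhd pr G \<tau> v}"
    have thesis by (rule that[OF v(1)]) (use v(2) in simp)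
    then show False using \<open>\<not> thesis\<close> by simp
  qed
  define P where "P v G \<tau> \<longleftrightarrow> finite G \<and> \<tau> > 0 \<and> finite {n. y n \<in> weak_nbhd pr G \<tau> v}" for v G \<tau>
  have "\<forall>v\<in>K. \<exists>G \<tau>. P v G \<tau>" using no unfolding P_def by blast
  then obtain G \<tau> where "\<forall>v\<in>K. P v (G v) (\<tau> v)" by metis
  then have G: "finite (G v) \<and> \<tau> v > 0 \<and> finite {n. y n \<in> weak_nbhd pr (G v) (\<tau> v) v}" if "v \<in> K" for v
    using that unfolding P_def by blast
  obtain Z where Z: "finite Z" "Z \<subseteq> K" "\<And>x. x \<in> K \<Longrightarrow> \<exists>z\<in>Z. x \<in> weak_nbhd pr (G z) (\<tau> z) z"
    by (rule weakly_compact_setE[OF K, of G \<tau>]) (use G in auto)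
  have "(UNIV :: nat set) \<subseteq> (\<Union>z\<in>Z. {n. y n \<in> weak_nbhd pr (G z) (\<tau> z) z})" using Z(3)[OF y] by auto
  moreover have "finite (\<Union>z\<in>Z. {n. y n \<in> weak_nbhd pr (G z) (\<tau> z) z})" using Z(1,2) G by auto
  ultimately show False using finite_subset infinite_UNIV_nat by blast
qed

text \<open>The elements of \<open>K\<close> are tested by functionals \<open>pr _ i\<close>. All \<open>i\<close> define the weak topology, while the set \<open>B\<close> defines
the seminorm \<open>e \<mapsto> sup {pr e b | b \<in> B}\<close>, which enters through the statement \<open>far \<epsilon> e\<close> that it exceeds \<open>\<epsilon>\<close>.
The closure properties of \<open>B\<close> allow the replacement of two norming elements by half of their difference.\<close>

locale dual_pairing =
  fixes pr :: "'e::real_vector \<Rightarrow> 'i::real_vector \<Rightarrow> real" and K :: "'e set" and B :: "'i set" and M :: real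
  assumes linear_left: "\<And>i. linear (\<lambda>e. pr e i)"
    and linear_right: "\<And>e. linear (pr e)"
    and convex_K: "convex K" and K_nonempty: "K \<noteq> {}"
    and compact_K: "weakly_compact_set pr K"
    and B_symmetric: "\<And>b. b \<in> B \<Longrightarrow> - b \<in> B"
    and B_halfdiff: "\<And>b c. b \<in> B \<Longrightarrow> c \<in> B \<Longrightarrow> (1/2) *\<^sub>R (b - c) \<in> B"
    and M_pos: "M > 0"
    and pr_bound: "\<And>z b. z \<in> K \<Longrightarrow> b \<in> B \<Longrightarrow> \<bar>pr z b\<bar> \<le> M"
begin

lemmas pr_left_simps = linear_add[OF linear_left] linear_diff[OF linear_left] linear_neg[OF linear_left]
  linear_scale[OF linear_left] linear_sum[OF linear_left] linear_0[OF linear_left]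

abbreviation nbhd :: "'i set \<Rightarrow> real \<Rightarrow> 'e \<Rightarrow> 'e set" where "nbhd \<equiv> weak_nbhd pr"

definition far :: "real \<Rightarrow> 'e \<Rightarrow> bool" where
  "far \<epsilon> e \<longleftrightarrow> (\<exists>b\<in>B. pr e b > \<epsilon>)"

text \<open>A point survives a step if each of its weak neighbourhoods meets the set in seminorm diameter greater than \<open>\<epsilon>\<close>.
The condition on two points, instead of one point far from \<open>z\<close>, makes the removed set relatively open.\<close>

primrec derivation :: "real \<Rightarrow> nat \<Rightarrow> 'e set" where
  "derivation \<epsilon> 0 = K"
| "derivation \<epsilon> (Suc n) = {z \<in> derivation \<epsilon> n. \<forall>G \<tau>. finite G \<longrightarrow> \<tau> > 0 \<longrightarrow>
      (\<exists>z1\<in>derivation \<epsilon> n \<inter> nbhd G \<tau> z. \<exists>z2\<in>derivation \<epsilon> n \<inter> nbhd G \<tau> z. far \<epsilon> (z1 - z2))}"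

lemma derivation_subset: "derivation \<epsilon> n \<subseteq> K"
  by (induction n) auto

text \<open>Weak neighbourhoods only see finitely many functionals, so each new point can be chosen weakly close to \<open>v\<close> with
respect to the norming elements of all its predecessors.\<close>

lemma far_sequence:
  assumes near: "\<And>G \<tau>. finite G \<Longrightarrow> \<tau> > 0 \<Longrightarrow> \<exists>y\<in>S. \<exists>b\<in>B. y \<in> nbhd G \<tau> v \<and> pr (y - v) b > \<epsilon>"
    and G0: "finite G0" and t: "\<tau> > 0"
  obtains y b where "\<And>j::nat. y j \<in> S" "\<And>j. b j \<in> B" "\<And>j. pr (y j - v) (b j) > \<epsilon>"
    "\<And>j. y j \<in> nbhd G0 \<tau> v" "\<And>i j. i < j \<Longrightarrow> \<bar>pr (y j - v) (b i)\<bar> < \<tau>"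
proof -
  define P where "P f j yb \<longleftrightarrow> fst yb \<in> S \<and> snd yb \<in> B \<and> pr (fst yb - v) (snd yb) > \<epsilon> \<and>
     fst yb \<in> nbhd (G0 \<union> (\<lambda>i. snd (f i)) ` {..<j}) \<tau> v" for f :: "nat \<Rightarrow> 'e \<times> 'i" and j yb
  have "\<exists>f. \<forall>j. P f j (f j)"
  proof (rule dependent_wf_choice[of "less_than"])
    fix f g :: "nat \<Rightarrow> 'e \<times> 'i" and j r assume "\<And>z. (z, j) \<in> less_than \<Longrightarrow> f z = g z"
    then have "(\<lambda>i. snd (f i)) ` {..<j} = (\<lambda>i. snd (g i)) ` {..<j}" by (intro image_cong) auto
    then show "P f j r = P g j r" unfolding P_def by simp
  next
    fix j and f :: "nat \<Rightarrow> 'e \<times> 'i"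
    obtain y b where "y \<in> S" "b \<in> B" "y \<in> nbhd (G0 \<union> (\<lambda>i. snd (f i)) ` {..<j}) \<tau> v" "pr (y - v) b > \<epsilon>"
      using near[of "G0 \<union> (\<lambda>i. snd (f i)) ` {..<j}" \<tau>] G0 t by auto
    then show "\<exists>r. P f j r" unfolding P_def by (intro exI[of _ "(y, b)"]) simp
  qed simp
  then obtain f where f: "\<And>j. P f j (f j)" by blast
  show thesis
  proof (rule that[of "\<lambda>j. fst (f j)" "\<lambda>j. snd (f j)"])
    show "fst (f j) \<in> nbhd G0 \<tau> v" for j
      using f[of j] unfolding P_def by (auto intro: weak_nbhd_mono)
    show "\<bar>pr (fst (f j) - v) (snd (f i))\<bar> < \<tau>" if "i < j" for i j
    proof -
      have "fst (f j) \<in> nbhd (G0 \<union> (\<lambda>i. snd (f i)) ` {..<j}) \<tau> v" using f[of j] unfolding P_def by blast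
      then have "\<bar>pr (fst (f j)) (snd (f i)) - pr v (snd (f i))\<bar> < \<tau>"
        by (rule weak_nbhd_D) (use that in auto)
      then show ?thesis by (simp add: pr_left_simps)
    qed
  qed (use f in \<open>auto simp: P_def\<close>)
qed

section \<open>The concave envelope of the derivation rank\<close>

text \<open>If the derivations of \<open>K\<close> vanish eventually, then for a point \<open>z\<close> of \<open>K\<close> this is the largest \<open>k\<close> with \<open>z \<in> derivation \<epsilon> k\<close>.\<close>

definition rank :: "real \<Rightarrow> 'e \<Rightarrow> nat" where
  "rank \<epsilon> z = (LEAST k. z \<notin> derivation \<epsilon> (Suc k))"

text \<open>The pairs of the barycentre of a finitely supported probability measure on \<open>K\<close> and the mean rank under the measure.\<close>

definition hypo :: "real \<Rightarrow> ('e \<times> real) set" where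
  "hypo \<epsilon> = convex hull ((\<lambda>z. (z, real (rank \<epsilon> z))) ` K)"

text \<open>The superlevel set of the envelope: weak limits of barycentres of measures whose mean rank is at least \<open>a\<close>.\<close>

definition level :: "real \<Rightarrow> real \<Rightarrow> 'e set" where
  "level \<epsilon> a = {v\<in>K. \<forall>G \<tau>. finite G \<longrightarrow> \<tau> > 0 \<longrightarrow> (\<exists>(y, c)\<in>hypo \<epsilon>. a \<le> c \<and> y \<in> nbhd G \<tau> v)}"

definition envelope :: "real \<Rightarrow> 'e \<Rightarrow> real" where
  "envelope \<epsilon> v = Sup {a. v \<in> level \<epsilon> a}"

end

locale dual_pairing_finite = dual_pairing +
  fixes \<epsilon> :: real and n :: nat
  assumes eps: "\<epsilon> > 0" and exhausted: "derivation \<epsilon> n = {}"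
begin

abbreviation "rk \<equiv> rank \<epsilon>"

lemma rank_upper: "z \<notin> derivation \<epsilon> (Suc k) \<Longrightarrow> rk z \<le> k"
  unfolding rank_def by (rule Least_le)

lemma rank_le: "rk z \<le> n"
  by (rule rank_upper) (use exhausted in auto)

lemma not_in_Suc_rank: "z \<notin> derivation \<epsilon> (Suc (rk z))"
  unfolding rank_def by (rule LeastI[of _ n]) (use exhausted in auto)

lemma in_rank: assumes "z \<in> K" shows "z \<in> derivation \<epsilon> (rk z)"
proof (cases "rk z")
  case 0 then show ?thesis using assms by simp
next
  case (Suc k)
  then have "\<not> rk z \<le> k" by simp
  then show ?thesis using rank_upper Suc by metis
qed

text \<open>The rank is weakly upper semicontinuous, and the points that share the rank of \<open>z\<close> in a small weak
neighbourhood are within seminorm distance \<open>\<epsilon>\<close> of it; otherwise \<open>z\<close> would survive one more step.\<close>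

lemma rank_locally_maximal:
  assumes z: "z \<in> K"
  obtains G \<tau> where "finite G" "\<tau> > 0"
    "\<And>y. y \<in> K \<Longrightarrow> y \<in> nbhd G \<tau> z \<Longrightarrow> rk y \<le> rk z"
    "\<And>y. y \<in> K \<Longrightarrow> y \<in> nbhd G \<tau> z \<Longrightarrow> rk y = rk z \<Longrightarrow> \<not> far \<epsilon> (y - z) \<and> \<not> far \<epsilon> (z - y)"
proof -
  let ?D = "derivation \<epsilon> (rk z)"
  obtain G \<tau> where G: "finite G" "\<tau> > 0" and
    nofar: "\<And>z1 z2. z1 \<in> ?D \<inter> nbhd G \<tau> z \<Longrightarrow> z2 \<in> ?D \<inter> nbhd G \<tau> z \<Longrightarrow> \<not> far \<epsilon> (z1 - z2)"
    using not_in_Suc_rank[of z] in_rank[OF z] by (simp) blast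
  show thesis
  proof (rule that[of G "\<tau>/2"])
    fix y assume y: "y \<in> K" "y \<in> nbhd G (\<tau>/2) z"
    have sub: "nbhd G (\<tau>/2) y \<subseteq> nbhd G \<tau> z" using weak_nbhd_trans[OF _ y(2)] by fastforce
    show "rk y \<le> rk z"
    proof (rule rank_upper, rule notI)
      assume "y \<in> derivation \<epsilon> (Suc (rk z))"
      then obtain z1 z2 where "z1 \<in> ?D \<inter> nbhd G (\<tau>/2) y" "z2 \<in> ?D \<inter> nbhd G (\<tau>/2) y" "far \<epsilon> (z1 - z2)"
        using G half_gt_zero[OF G(2)] unfolding derivation.simps by blast
      then show False using nofar sub by blast
    qed
    show "\<not> far \<epsilon> (y - z) \<and> \<not> far \<epsilon> (z - y)" if "rk y = rk z"
    proof -
      have "y \<in> ?D \<inter> nbhd G \<tau> z" using in_rank[OF y(1)] that y(2) G(2) by (auto intro: weak_nbhd_mono)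
      moreover have "z \<in> ?D \<inter> nbhd G \<tau> z" using in_rank[OF z] G by simp
      ultimately show ?thesis using nofar by blast
    qed
  qed (use G in auto)
qed

lemma hypo_snd: "(y, c) \<in> hypo \<epsilon> \<Longrightarrow> 0 \<le> c \<and> c \<le> n"
proof -
  have "hypo \<epsilon> \<subseteq> UNIV \<times> {0..real n}"
    unfolding hypo_def by (rule hull_minimal) (auto intro: convex_Times simp: rank_le)
  then show "(y, c) \<in> hypo \<epsilon> \<Longrightarrow> 0 \<le> c \<and> c \<le> n" by auto
qed

text \<open>The measure with barycentre \<open>y\<close> and mean rank \<open>c\<close> has been moved to the finite set \<open>Z\<close> with weights \<open>w\<close>. The number
\<open>bad\<close> is the mass of the points whose rank increased; the barycentre moves little in the seminorm unless
\<open>bad\<close> is large, and the mean rank grows by at least \<open>bad\<close>.\<close>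

definition pushed_to where
  "pushed_to Z G0 \<tau> y c w bad c' \<longleftrightarrow> (\<forall>z\<in>Z. 0 \<le> w z \<and> w z \<le> 1) \<and> bad \<ge> 0 \<and> c + bad \<le> c' \<and>
        ((\<Sum>z\<in>Z. w z *\<^sub>R z), c') \<in> hypo \<epsilon> \<and>
        (\<forall>g\<in>G0. \<bar>pr y g - pr (\<Sum>z\<in>Z. w z *\<^sub>R z) g\<bar> \<le> \<tau>) \<and>
        (\<forall>b\<in>B. \<bar>pr y b - pr (\<Sum>z\<in>Z. w z *\<^sub>R z) b\<bar> \<le> \<epsilon> + 2 * M * bad)"

text \<open>A finite set \<open>Z\<close> of centres of neighbourhoods as in \<open>rank_locally_maximal\<close> serves all measures at once.
Every atom moves to the centre of a neighbourhood that contains it. Its rank does not decrease, and if its rank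
does not change then it moves by at most \<open>\<epsilon>\<close>.\<close>

lemma push_to_finite_set:
  assumes G0: "finite G0" and t: "\<tau> > 0"
  obtains Z where "finite Z" "Z \<subseteq> K"
    "\<And>y c. (y, c) \<in> hypo \<epsilon> \<Longrightarrow> \<exists>w bad c'. pushed_to Z G0 \<tau> y c w bad c'"
proof -
  have "\<exists>G \<tau>'. finite G \<and> \<tau>' > 0 \<and> (\<forall>y\<in>K. y \<in> nbhd G \<tau>' z \<longrightarrow> rk y \<le> rk z \<and>
      (rk y = rk z \<longrightarrow> \<not> far \<epsilon> (y - z) \<and> \<not> far \<epsilon> (z - y)))" if "z \<in> K" for z
    using rank_locally_maximal[OF that] by metis
  then obtain G T where GT: "\<And>z. z \<in> K \<Longrightarrow> finite (G z) \<and> T z > 0 \<and> (\<forall>y\<in>K. y \<in> nbhd (G z) (T z) z \<longrightarrow> rk y \<le> rk z \<and>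
      (rk y = rk z \<longrightarrow> \<not> far \<epsilon> (y - z) \<and> \<not> far \<epsilon> (z - y)))" by metis
  obtain Z where Z: "finite Z" "Z \<subseteq> K" "\<And>y. y \<in> K \<Longrightarrow> \<exists>z\<in>Z. y \<in> nbhd (G z \<union> G0) (min (T z) \<tau>) z"
    using compact_K[unfolded weakly_compact_set_def, rule_format, of "\<lambda>z. G z \<union> G0" "\<lambda>z. min (T z) \<tau>"] GT G0 t
    by auto
  then obtain ctr where ctr: "\<And>y. y \<in> K \<Longrightarrow> ctr y \<in> Z \<and> y \<in> nbhd (G (ctr y) \<union> G0) (min (T (ctr y)) \<tau>) (ctr y)"
    by metis
  have ctrK: "ctr y \<in> K" if "y \<in> K" for y using ctr that Z(2) by blast
  have ctr_nb: "y \<in> nbhd (G (ctr y)) (T (ctr y)) (ctr y)" if "y \<in> K" for y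
    using ctr[OF that] by (auto intro: weak_nbhd_mono)
  have ctr_rk: "rk y \<le> rk (ctr y)" if "y \<in> K" for y
    using GT[OF ctrK[OF that]] ctr_nb[OF that] that by blast
  have ctr_G0: "\<bar>pr y g - pr (ctr y) g\<bar> < \<tau>" if "y \<in> K" "g \<in> G0" for y g
    using ctr[OF that(1)] weak_nbhd_D[of y pr "G (ctr y) \<union> G0" _ "ctr y" g] that(2) by fastforce
  have ctr_B: "\<bar>pr y b - pr (ctr y) b\<bar> \<le> \<epsilon> + 2 * M * of_bool (rk y < rk (ctr y))" if "y \<in> K" "b \<in> B" for y b
  proof (cases "rk y < rk (ctr y)")
    case True
    then show ?thesis using pr_bound[OF that] pr_bound[OF ctrK[OF that(1)] that(2)] eps by simp
  next
    case False
    then have "rk y = rk (ctr y)" using ctr_rk[OF that(1)] by simp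
    then have "\<not> far \<epsilon> (y - ctr y)" "\<not> far \<epsilon> (ctr y - y)"
      using GT[OF ctrK[OF that(1)]] ctr_nb[OF that(1)] that(1) by blast+
    then show ?thesis using that(2) False unfolding far_def by (auto simp: pr_left_simps not_less abs_le_iff)
  qed
  show thesis
  proof (rule that[OF Z(1,2)])
    fix y c assume "(y, c) \<in> hypo \<epsilon>"
    then obtain S u where S: "finite S" "S \<subseteq> (\<lambda>z. (z, real (rk z))) ` K" "\<And>p. p \<in> S \<Longrightarrow> 0 \<le> u p"
      "sum u S = 1" "(\<Sum>p\<in>S. u p *\<^sub>R p) = (y, c)"
      unfolding hypo_def convex_hull_explicit by blast
    have SK: "fst p \<in> K" "snd p = real (rk (fst p))" if "p \<in> S" for p using S(2) that by auto
    have y: "y = (\<Sum>p\<in>S. u p *\<^sub>R fst p)" using arg_cong[OF S(5), of fst] by (simp add: fst_sum)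
    have c: "c = (\<Sum>p\<in>S. u p * snd p)" using arg_cong[OF S(5), of snd] by (simp add: snd_sum)
    define w where "w z = (\<Sum>p | p \<in> S \<and> ctr (fst p) = z. u p)" for z
    define bad where "bad = (\<Sum>p\<in>S. u p * of_bool (rk (fst p) < rk (ctr (fst p))))"
    define c' where "c' = (\<Sum>p\<in>S. u p * real (rk (ctr (fst p))))"
    have nu: "(\<Sum>z\<in>Z. w z *\<^sub>R z) = (\<Sum>p\<in>S. u p *\<^sub>R ctr (fst p))"
    proof -
      have "(\<Sum>z\<in>Z. w z *\<^sub>R z) = (\<Sum>z\<in>Z. \<Sum>p | p \<in> S \<and> ctr (fst p) = z. u p *\<^sub>R ctr (fst p))"
        unfolding w_def scaleR_left.sum by (intro sum.cong refl) simp
      also have "\<dots> = (\<Sum>p\<in>S. u p *\<^sub>R ctr (fst p))"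
        by (rule sum.group) (use S(1) Z(1) ctr SK in auto)
      finally show ?thesis .
    qed
    have avg: "\<bar>pr y i - pr (\<Sum>z\<in>Z. w z *\<^sub>R z) i\<bar> \<le> (\<Sum>p\<in>S. u p * r p)"
      if "\<And>p. p \<in> S \<Longrightarrow> \<bar>pr (fst p) i - pr (ctr (fst p)) i\<bar> \<le> r p" for i r
    proof -
      have "pr y i - pr (\<Sum>z\<in>Z. w z *\<^sub>R z) i = (\<Sum>p\<in>S. u p * (pr (fst p) i - pr (ctr (fst p)) i))"
        unfolding nu y by (simp add: pr_left_simps sum_subtractf right_diff_distrib)
      also have "\<bar>\<dots>\<bar> \<le> (\<Sum>p\<in>S. \<bar>u p * (pr (fst p) i - pr (ctr (fst p)) i)\<bar>)" by (rule sum_abs)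
      also have "\<dots> \<le> (\<Sum>p\<in>S. u p * r p)"
        using S(3) that by (intro sum_mono) (simp add: abs_mult mult_left_mono)
      finally show ?thesis .
    qed
    show "\<exists>w bad c'. pushed_to Z G0 \<tau> y c w bad c'"
      unfolding pushed_to_def
    proof (rule exI[of _ w], rule exI[of _ bad], rule exI[of _ c'], intro conjI ballI)
      fix z assume "z \<in> Z"
      show "0 \<le> w z" unfolding w_def by (rule sum_nonneg) (use S(3) in auto)
      have "w z \<le> sum u S" unfolding w_def by (rule sum_mono2) (use S in auto)
      then show "w z \<le> 1" using S(4) by simp
    next
      show "bad \<ge> 0" unfolding bad_def by (rule sum_nonneg) (use S(3) in auto)
      have "(\<Sum>p\<in>S. u p * snd p + u p * of_bool (rk (fst p) < rk (ctr (fst p)))) \<le> c'"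
        unfolding c'_def
      proof (rule sum_mono)
        fix p assume p: "p \<in> S"
        have "snd p + of_bool (rk (fst p) < rk (ctr (fst p))) \<le> real (rk (ctr (fst p)))"
          using SK[OF p] ctr_rk[of "fst p"] by auto
        from mult_left_mono[OF this S(3)[OF p]]
        show "u p * snd p + u p * of_bool (rk (fst p) < rk (ctr (fst p))) \<le> u p * real (rk (ctr (fst p)))"
          by (simp add: distrib_left)
      qed
      then show "c + bad \<le> c'" by (simp add: c bad_def sum.distrib)
      have "(\<Sum>p\<in>S. u p *\<^sub>R (ctr (fst p), real (rk (ctr (fst p))))) \<in> hypo \<epsilon>"
      proof (rule convex_sum[OF S(1) _ S(4)])
        show "convex (hypo \<epsilon>)" unfolding hypo_def by (rule convex_convex_hull)
        show "(ctr (fst p), real (rk (ctr (fst p)))) \<in> hypo \<epsilon>" if "p \<in> S" for p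
          unfolding hypo_def using ctrK[OF SK(1)[OF that]] by (intro hull_inc) auto
      qed (use S(3) in auto)
      moreover have "(\<Sum>p\<in>S. u p *\<^sub>R (ctr (fst p), real (rk (ctr (fst p))))) = ((\<Sum>z\<in>Z. w z *\<^sub>R z), c')"
        unfolding nu c'_def by (rule prod_eqI) (simp_all add: fst_sum snd_sum)
      ultimately show "((\<Sum>z\<in>Z. w z *\<^sub>R z), c') \<in> hypo \<epsilon>" by simp
    next
      fix g assume g: "g \<in> G0"
      have "\<bar>pr y g - pr (\<Sum>z\<in>Z. w z *\<^sub>R z) g\<bar> \<le> (\<Sum>p\<in>S. u p * \<tau>)"
        by (rule avg) (use ctr_G0[OF SK(1) g] in \<open>auto intro: less_imp_le\<close>)
      then show "\<bar>pr y g - pr (\<Sum>z\<in>Z. w z *\<^sub>R z) g\<bar> \<le> \<tau>" using S(4) by (simp flip: sum_distrib_right)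
    next
      fix b assume b: "b \<in> B"
      have "\<bar>pr y b - pr (\<Sum>z\<in>Z. w z *\<^sub>R z) b\<bar> \<le> (\<Sum>p\<in>S. u p * (\<epsilon> + 2 * M * of_bool (rk (fst p) < rk (ctr (fst p)))))"
        by (rule avg) (use ctr_B[OF SK(1) b] in auto)
      also have "\<dots> = sum u S * \<epsilon> + 2 * M * bad"
        unfolding bad_def by (simp add: distrib_left sum.distrib sum_distrib_left sum_distrib_right algebra_simps)
      finally show "\<bar>pr y b - pr (\<Sum>z\<in>Z. w z *\<^sub>R z) b\<bar> \<le> \<epsilon> + 2 * M * bad" using S(4) by simp
    qed
  qed
qed

text \<open>Infinitely many far apart barycentres are moved to the same finite set \<open>Z\<close>. By the pigeonhole principle two of
the weight vectors almost agree, so the new barycentres almost coincide although the old ones were far apart. Hence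
one of the two measures had a bad part of mass at least \<open>\<epsilon> / (4 * M)\<close>, and moving it gained that much mean rank.\<close>

lemma level_gain:
  assumes v: "v \<in> K"
    and near: "\<And>G \<tau>. finite G \<Longrightarrow> \<tau> > 0 \<Longrightarrow> \<exists>v'\<in>level \<epsilon> a \<inter> nbhd G \<tau> v. far (4 * \<epsilon>) (v' - v)"
  shows "v \<in> level \<epsilon> (a + \<epsilon> / (4 * M))"
  unfolding level_def
proof (intro CollectI conjI v allI impI)
  fix G0 :: "'b set" and \<tau>0 :: real assume G0: "finite G0" and t0: "\<tau>0 > 0"
  define \<tau> where "\<tau> = min (\<tau>0 / 2) (\<epsilon> / 4)"
  have t: "\<tau> > 0" "2 * \<tau> \<le> \<tau>0" "4 * \<tau> \<le> \<epsilon>" unfolding \<tau>_def using t0 eps by auto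
  define S where "S = {y. \<exists>c\<ge>a. (y, c) \<in> hypo \<epsilon>}"
  have S: "\<exists>y\<in>S. \<exists>b\<in>B. y \<in> nbhd G s v \<and> pr (y - v) b > 4 * \<epsilon>" if G: "finite G" "s > 0" for G s
  proof -
    obtain v' b where v': "v' \<in> level \<epsilon> a" "v' \<in> nbhd G (s/2) v" "b \<in> B" "pr (v' - v) b > 4 * \<epsilon>"
      using near[OF G(1), of "s/2"] G(2) unfolding far_def by auto
    \<comment> \<open>Approximating \<open>v'\<close> also on its own norming element keeps the approximant far from \<open>v\<close>.\<close>
    define \<gamma> where "\<gamma> = pr (v' - v) b - 4 * \<epsilon>"
    have "\<exists>(y, c)\<in>hypo \<epsilon>. a \<le> c \<and> y \<in> nbhd (insert b G) (min (s/2) \<gamma>) v'"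
      using v'(1) G v'(4) unfolding level_def \<gamma>_def by simp
    then obtain y c where y: "(y, c) \<in> hypo \<epsilon>" "a \<le> c" "y \<in> nbhd (insert b G) (min (s/2) \<gamma>) v'" by blast
    have "y \<in> nbhd G (s/2) v'" using y(3) by (auto intro: weak_nbhd_mono)
    then have "y \<in> nbhd G s v" using weak_nbhd_trans[OF _ v'(2)] by fastforce
    moreover have "\<bar>pr y b - pr v' b\<bar> < \<gamma>" using weak_nbhd_D[OF y(3), of b] by simp
    then have "pr (y - v) b > 4 * \<epsilon>" unfolding \<gamma>_def by (simp add: pr_left_simps)
    ultimately show ?thesis using y v'(3) unfolding S_def by blast
  qed
  obtain y b where yb: "\<And>j::nat. y j \<in> S" "\<And>j. b j \<in> B" "\<And>j. pr (y j - v) (b j) > 4 * \<epsilon>"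
    "\<And>j. y j \<in> nbhd G0 \<tau> v" "\<And>i j. i < j \<Longrightarrow> \<bar>pr (y j - v) (b i)\<bar> < \<tau>"
  proof (rule far_sequence[of S v "4 * \<epsilon>" G0 \<tau>], goal_cases)
    case (1 G s) from 1(2,3) show ?case by (rule S)
  next
    case 2 show ?case by (rule G0)
  next
    case 3 show ?case by (rule t(1))
  next
    case (4 y b) show ?case by (rule that[of y b, OF 4(2-6)])
  qed
  obtain Z where Z: "finite Z" "Z \<subseteq> K" and disc:
    "\<And>y c. (y, c) \<in> hypo \<epsilon> \<Longrightarrow> \<exists>w bad c'. pushed_to Z G0 \<tau> y c w bad c'"
    by (rule push_to_finite_set[OF G0 t(1)]) blast
  have "\<exists>w bad c'. pushed_to Z G0 \<tau> (y j) a w bad c'" for j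
  proof -
    obtain c where c: "c \<ge> a" "(y j, c) \<in> hypo \<epsilon>" using yb(1)[of j] unfolding S_def by blast
    obtain w bad c' where "pushed_to Z G0 \<tau> (y j) c w bad c'" using disc[OF c(2)] by blast
    then have "pushed_to Z G0 \<tau> (y j) a w bad c'" using c(1) unfolding pushed_to_def by simp
    then show ?thesis by blast
  qed
  then obtain w bad c' where pushed: "\<And>j. pushed_to Z G0 \<tau> (y j) a (w j) (bad j) (c' j)" by metis
  have w: "0 \<le> w j z \<and> w j z \<le> 1" if "z \<in> Z" for j z using pushed[of j] that unfolding pushed_to_def by blast
  have bad: "bad j \<ge> 0 \<and> a + bad j \<le> c' j" for j using pushed[of j] unfolding pushed_to_def by blast
  have hyp: "((\<Sum>z\<in>Z. w j z *\<^sub>R z), c' j) \<in> hypo \<epsilon>" for j using pushed[of j] unfolding pushed_to_def by blast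
  have cl: "\<bar>pr (y j) g - pr (\<Sum>z\<in>Z. w j z *\<^sub>R z) g\<bar> \<le> \<tau>" if "g \<in> G0" for j g
    using pushed[of j] that unfolding pushed_to_def by blast
  have clB: "\<bar>pr (y j) b - pr (\<Sum>z\<in>Z. w j z *\<^sub>R z) b\<bar> \<le> \<epsilon> + 2 * M * bad j" if "b \<in> B" for j b
    using pushed[of j] that unfolding pushed_to_def by blast
  define q where "q = real (card Z) + 1"
  define \<zeta> where "\<zeta> = \<epsilon> / (4 * M * q)"
  have q: "q > 0" "real (card Z) \<le> q" unfolding q_def by auto
  have z: "\<zeta> > 0" unfolding \<zeta>_def using eps M_pos q by simp
  have "\<bar>w j z\<bar> \<le> 1" if "z \<in> Z" for j z using w[OF that, of j] by simp
  then obtain i j where ij: "i < j" "\<And>z. z \<in> Z \<Longrightarrow> \<bar>w i z - w j z\<bar> < \<zeta>"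
    using finite_pigeonhole[OF Z(1) _ z, of w 1] by metis
  have "\<bar>pr (\<Sum>z\<in>Z. w i z *\<^sub>R z) (b i) - pr (\<Sum>z\<in>Z. w j z *\<^sub>R z) (b i)\<bar> = \<bar>\<Sum>z\<in>Z. (w i z - w j z) * pr z (b i)\<bar>"
    by (simp add: pr_left_simps sum_subtractf left_diff_distrib)
  also have "\<dots> \<le> (\<Sum>z\<in>Z. \<bar>(w i z - w j z) * pr z (b i)\<bar>)" by (rule sum_abs)
  also have "\<dots> \<le> (\<Sum>z\<in>Z. \<zeta> * M)"
    unfolding abs_mult by (intro sum_mono mult_mono) (use ij(2) pr_bound[OF _ yb(2)] Z(2) z in \<open>auto intro: less_imp_le\<close>)
  also have "\<dots> \<le> \<epsilon> / 4"
  proof -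
    have "real (card Z) * (\<zeta> * M) \<le> q * (\<zeta> * M)" using z M_pos q by (intro mult_right_mono) auto
    moreover have "q * (\<zeta> * M) = \<epsilon> / 4" unfolding \<zeta>_def using M_pos q(1) by (simp add: field_simps)
    ultimately show ?thesis by simp
  qed
  finally have d: "\<bar>pr (\<Sum>z\<in>Z. w i z *\<^sub>R z) (b i) - pr (\<Sum>z\<in>Z. w j z *\<^sub>R z) (b i)\<bar> \<le> \<epsilon> / 4" .
  have "2 * M * (bad i + bad j) \<ge> \<epsilon>"
    using d clB[OF yb(2)[of i], of i] clB[OF yb(2)[of i], of j] yb(3)[of i] yb(5)[OF ij(1)] t(3) eps
    unfolding linear_diff[OF linear_left] distrib_left by linarith
  then have "bad i + bad j \<ge> \<epsilon> / (2 * M)" using M_pos by (simp add: field_simps)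
  then have "bad i \<ge> \<epsilon> / (4 * M) \<or> bad j \<ge> \<epsilon> / (4 * M)" by (simp add: field_simps) linarith
  then obtain k where k: "bad k \<ge> \<epsilon> / (4 * M)" by blast
  show "\<exists>(y, c)\<in>hypo \<epsilon>. a + \<epsilon> / (4 * M) \<le> c \<and> y \<in> nbhd G0 \<tau>0 v"
  proof (rule bexI[OF _ hyp[of k]], simp, intro conjI)
    show "a + \<epsilon> / (4 * M) \<le> c' k" using bad[of k] k by simp
    show "(\<Sum>z\<in>Z. w k z *\<^sub>R z) \<in> nbhd G0 \<tau>0 v"
      unfolding weak_nbhd_def
    proof (intro CollectI ballI)
      fix g assume g: "g \<in> G0"
      show "\<bar>pr (\<Sum>z\<in>Z. w k z *\<^sub>R z) g - pr v g\<bar> < \<tau>0"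
        using cl[OF g, of k] weak_nbhd_D[OF yb(4)[of k] g] t(2) by linarith
    qed
  qed
qed

lemma level_antimono:
  assumes "v \<in> level \<epsilon> a" "a' \<le> a" shows "v \<in> level \<epsilon> a'"
  unfolding level_def
proof (intro CollectI conjI allI impI)
  show "v \<in> K" using assms unfolding level_def by blast
  fix G :: "'b set" and \<tau> :: real assume "finite G" "\<tau> > 0"
  then obtain y c where "(y, c) \<in> hypo \<epsilon>" "a \<le> c" "y \<in> nbhd G \<tau> v"
    using assms(1) unfolding level_def by blast
  then show "\<exists>(y, c)\<in>hypo \<epsilon>. a' \<le> c \<and> y \<in> nbhd G \<tau> v"
    using assms(2) by (intro bexI[of _ "(y, c)"]) auto
qed

lemma level_le: assumes "v \<in> level \<epsilon> a" shows "a \<le> n"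
proof -
  have "\<exists>(y, c)\<in>hypo \<epsilon>. a \<le> c \<and> y \<in> nbhd {} 1 v"
    using assms unfolding level_def by simp
  then show ?thesis using hypo_snd by fastforce
qed

lemma level_rank: assumes "v \<in> K" shows "v \<in> level \<epsilon> (rk v)"
proof -
  have H: "(v, real (rk v)) \<in> hypo \<epsilon>" unfolding hypo_def using assms by (intro hull_inc) auto
  show ?thesis unfolding level_def using assms bexI[OF _ H] by auto
qed

lemma level_bdd: "bdd_above {a. v \<in> level \<epsilon> a}"
  using level_le by (auto simp: bdd_above_def)

lemma envelope_ge: "v \<in> level \<epsilon> a \<Longrightarrow> a \<le> envelope \<epsilon> v"
  unfolding envelope_def by (rule cSup_upper[OF _ level_bdd]) simp

lemma level_below_envelope:
  assumes "v \<in> K" "a < envelope \<epsilon> v" shows "v \<in> level \<epsilon> a"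
proof -
  have "\<exists>a'\<in>{a. v \<in> level \<epsilon> a}. a < a'"
    using assms level_rank[OF assms(1)] unfolding envelope_def
    by (subst (asm) less_cSup_iff[OF _ level_bdd]) auto
  then show ?thesis using level_antimono by force
qed

lemma envelope_nonneg: "v \<in> K \<Longrightarrow> 0 \<le> envelope \<epsilon> v"
  using envelope_ge[OF level_rank] by fastforce

lemma envelope_le: assumes "v \<in> K" shows "envelope \<epsilon> v \<le> n"
proof (rule field_le_epsilon)
  fix e :: real assume "e > 0"
  then show "envelope \<epsilon> v \<le> real n + e" using level_le[OF level_below_envelope[OF assms, of "envelope \<epsilon> v - e"]] by simp
qed

lemma level_convex:
  assumes "v1 \<in> level \<epsilon> a1" "v2 \<in> level \<epsilon> a2" "u1 \<ge> 0" "u2 \<ge> 0" "u1 + u2 = 1"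
  shows "u1 *\<^sub>R v1 + u2 *\<^sub>R v2 \<in> level \<epsilon> (u1 * a1 + u2 * a2)"
  unfolding level_def
proof (intro CollectI conjI allI impI)
  show "u1 *\<^sub>R v1 + u2 *\<^sub>R v2 \<in> K" using assms convex_K unfolding level_def convex_def by blast
  fix G :: "'b set" and \<tau> :: real assume G: "finite G" "\<tau> > 0"
  obtain y1 c1 where 1: "(y1, c1) \<in> hypo \<epsilon>" "a1 \<le> c1" "y1 \<in> nbhd G \<tau> v1"
    using assms(1) G unfolding level_def by blast
  obtain y2 c2 where 2: "(y2, c2) \<in> hypo \<epsilon>" "a2 \<le> c2" "y2 \<in> nbhd G \<tau> v2"
    using assms(2) G unfolding level_def by blast
  have "u1 *\<^sub>R (y1, c1) + u2 *\<^sub>R (y2, c2) \<in> hypo \<epsilon>"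
    by (rule convexD) (use 1 2 assms in \<open>auto simp: hypo_def\<close>)
  then have H: "(u1 *\<^sub>R y1 + u2 *\<^sub>R y2, u1 * c1 + u2 * c2) \<in> hypo \<epsilon>" by simp
  show "\<exists>(y, c)\<in>hypo \<epsilon>. u1 * a1 + u2 * a2 \<le> c \<and> y \<in> nbhd G \<tau> (u1 *\<^sub>R v1 + u2 *\<^sub>R v2)"
  proof (rule bexI[OF _ H], simp, intro conjI)
    show "u1 * a1 + u2 * a2 \<le> u1 * c1 + u2 * c2" using 1 2 assms by (intro add_mono mult_left_mono) auto
    show "u1 *\<^sub>R y1 + u2 *\<^sub>R y2 \<in> nbhd G \<tau> (u1 *\<^sub>R v1 + u2 *\<^sub>R v2)"
      unfolding weak_nbhd_def
    proof (intro CollectI ballI)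
      fix g assume g: "g \<in> G"
      have "pr (u1 *\<^sub>R y1 + u2 *\<^sub>R y2) g - pr (u1 *\<^sub>R v1 + u2 *\<^sub>R v2) g = u1 * (pr y1 g - pr v1 g) + u2 * (pr y2 g - pr v2 g)"
        by (simp add: pr_left_simps algebra_simps)
      also have "\<bar>\<dots>\<bar> \<le> u1 * \<bar>pr y1 g - pr v1 g\<bar> + u2 * \<bar>pr y2 g - pr v2 g\<bar>"
        using assms(3,4) abs_triangle_ineq[of "u1 * (pr y1 g - pr v1 g)" "u2 * (pr y2 g - pr v2 g)"]
        by (simp add: abs_mult)
      also have "\<dots> < \<tau>"
        by (rule convex_bound_lt) (use weak_nbhd_D[OF 1(3) g] weak_nbhd_D[OF 2(3) g] assms in auto)
      finally show "\<bar>pr (u1 *\<^sub>R y1 + u2 *\<^sub>R y2) g - pr (u1 *\<^sub>R v1 + u2 *\<^sub>R v2) g\<bar> < \<tau>" .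
    qed
  qed
qed

lemma envelope_concave:
  assumes "v1 \<in> K" "v2 \<in> K" "u1 \<ge> 0" "u2 \<ge> 0" "u1 + u2 = 1"
  shows "u1 * envelope \<epsilon> v1 + u2 * envelope \<epsilon> v2 \<le> envelope \<epsilon> (u1 *\<^sub>R v1 + u2 *\<^sub>R v2)"
proof (rule field_le_epsilon)
  fix e :: real assume e: "e > 0"
  have "u1 * (envelope \<epsilon> v1 - e) + u2 * (envelope \<epsilon> v2 - e) \<le> envelope \<epsilon> (u1 *\<^sub>R v1 + u2 *\<^sub>R v2)"
    by (intro envelope_ge level_convex level_below_envelope) (use assms e in auto)
  moreover have "u1 * e + u2 * e = e" using assms(5) by (metis distrib_right mult_1)
  ultimately show "u1 * envelope \<epsilon> v1 + u2 * envelope \<epsilon> v2 \<le> envelope \<epsilon> (u1 *\<^sub>R v1 + u2 *\<^sub>R v2) + e"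
    by (simp add: right_diff_distrib)
qed

text \<open>The first bound is upper semicontinuity of the envelope, the second is the contrapositive of \<open>level_gain\<close>.\<close>

lemma envelope_drop:
  assumes v: "v \<in> K" and k: "\<kappa> > 0"
  obtains G \<tau> where "finite G" "\<tau> > 0"
    "\<And>v'. v' \<in> K \<Longrightarrow> v' \<in> nbhd G \<tau> v \<Longrightarrow> envelope \<epsilon> v' \<le> envelope \<epsilon> v + \<kappa>"
    "\<And>v'. v' \<in> K \<Longrightarrow> v' \<in> nbhd G \<tau> v \<Longrightarrow> far (4 * \<epsilon>) (v' - v) \<Longrightarrow> envelope \<epsilon> v' \<le> envelope \<epsilon> v - \<epsilon> / (4 * M) + \<kappa>"
proof -
  let ?h = "envelope \<epsilon>"
  have "v \<notin> level \<epsilon> (?h v + \<kappa>)" using envelope_ge[of v "?h v + \<kappa>"] k by linarith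
  then obtain G1 \<tau>1 where 1: "finite G1" "\<tau>1 > 0" "\<And>y c. (y, c) \<in> hypo \<epsilon> \<Longrightarrow> ?h v + \<kappa> \<le> c \<Longrightarrow> y \<notin> nbhd G1 \<tau>1 v"
    using v unfolding level_def by blast
  define a where "a = ?h v - \<epsilon> / (4 * M) + \<kappa>"
  have "v \<notin> level \<epsilon> (a + \<epsilon> / (4 * M))" using envelope_ge[of v "a + \<epsilon> / (4 * M)"] k unfolding a_def by linarith
  then obtain G2 \<tau>2 where 2: "finite G2" "\<tau>2 > 0" "\<And>v'. v' \<in> level \<epsilon> a \<Longrightarrow> v' \<in> nbhd G2 \<tau>2 v \<Longrightarrow> \<not> far (4 * \<epsilon>) (v' - v)"
    using level_gain[OF v, of a] by blast
  show thesis
  proof (rule that[of "G1 \<union> G2" "min (\<tau>1/2) \<tau>2"])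
    fix v' assume v': "v' \<in> K" "v' \<in> nbhd (G1 \<union> G2) (min (\<tau>1/2) \<tau>2) v"
    have n1: "v' \<in> nbhd G1 (\<tau>1/2) v" and n2: "v' \<in> nbhd G2 \<tau>2 v" using v'(2) by (auto intro: weak_nbhd_mono)
    show "?h v' \<le> ?h v + \<kappa>"
    proof (rule ccontr)
      assume "\<not> ?thesis"
      then have "v' \<in> level \<epsilon> (?h v + \<kappa>)" using v'(1) by (intro level_below_envelope) auto
      then obtain y c where y: "(y, c) \<in> hypo \<epsilon>" "?h v + \<kappa> \<le> c" "y \<in> nbhd G1 (\<tau>1/2) v'"
        using 1(1,2) half_gt_zero[OF 1(2)] unfolding level_def by blast
      then show False using 1(3) weak_nbhd_trans[OF y(3) n1] by simp
    qed
    show "?h v' \<le> ?h v - \<epsilon> / (4 * M) + \<kappa>" if "far (4 * \<epsilon>) (v' - v)"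
    proof (rule ccontr)
      assume "\<not> ?thesis"
      then have "v' \<in> level \<epsilon> a" using v'(1) unfolding a_def by (intro level_below_envelope) auto
      then show False using 2(3) n2 that by blast
    qed
  qed (use 1 2 in auto)
qed

end

section \<open>Almost biorthogonal trees\<close>

text \<open>The encoding of the reversed list enumerates the vertices of the tree so that each vertex comes after its
parent, which allows choices along the enumeration.\<close>

definition idx :: "nat list \<Rightarrow> nat" where "idx s = list_encode (rev s)"

lemma idx_eq_iff [simp]: "idx s = idx t \<longleftrightarrow> s = t"
  unfolding idx_def by (simp add: list_encode_eq)

lemma idx_butlast: assumes "s \<noteq> []" shows "idx (butlast s) < idx s"
proof -
  have "s = butlast s @ [last s]" using assms by simp
  then have "idx s = idx (butlast s @ [last s])" by simp
  also have "\<dots> = Suc (prod_encode (last s, idx (butlast s)))" unfolding idx_def by simp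
  finally show ?thesis using le_prod_encode_2[of "idx (butlast s)" "last s"] by simp
qed

lemma length_le_idx: "length s \<le> idx s"
proof (induction s rule: rev_induct)
  case (snoc x xs)
  then show ?case using idx_butlast[of "xs @ [x]"] by simp
qed simp

lemma finite_idx_less: "finite {t. idx t < n}"
  by (rule finite_imageD[of idx]) (auto intro: finite_subset[of _ "{..<n}"] simp: inj_on_def)

text \<open>A new derivation tree starts at each level \<open>2 ^ k\<close>, below the common starting point \<open>base k\<close>. It only has to reach
level \<open>2 ^ (k + 1) - 1\<close>, so trees of finite heights suffice for the infinite tree.\<close>

definition tree_parent :: "(nat \<Rightarrow> 'e) \<Rightarrow> (nat list \<Rightarrow> 'e) \<Rightarrow> nat list \<Rightarrow> 'e" where
  "tree_parent base z s = (if length s = 2 ^ floor_log (length s) then base (floor_log (length s)) else z (butlast s))"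

definition increment :: "(nat \<Rightarrow> 'e::real_vector) \<Rightarrow> (nat list \<Rightarrow> 'e) \<Rightarrow> nat list \<Rightarrow> 'e" where
  "increment base z s = z s - tree_parent base z s"

context dual_pairing
begin

text \<open>A long sequence of candidates \<open>y j\<close> with norming elements \<open>b j\<close> is chosen by \<open>far_sequence\<close>. Two of
the elements \<open>b i\<close>, \<open>b j\<close> almost agree on the finite set \<open>H\<close>. Half of their difference almost vanishes on \<open>H\<close> and
still norms \<open>y j - z\<close>, because \<open>b i\<close> is almost zero there.\<close>

lemma derivation_step:
  assumes e: "\<epsilon> > 0" and z: "z \<in> derivation \<epsilon> (Suc r)" and G: "finite G" and H: "finite H"
    and HK: "\<And>h. h \<in> H \<Longrightarrow> \<exists>x\<in>K. \<exists>y\<in>K. h = x - y" and t: "\<tau> > 0"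
  obtains z' b where "z' \<in> derivation \<epsilon> r" "b \<in> B" "z' \<in> nbhd G \<tau> z" "pr (z' - z) b > \<epsilon> / 8"
    "\<And>h. h \<in> H \<Longrightarrow> \<bar>pr h b\<bar> < \<tau>"
proof -
  let ?D = "derivation \<epsilon> r"
  have near: "\<exists>y\<in>?D. \<exists>b\<in>B. y \<in> nbhd G s z \<and> pr (y - z) b > \<epsilon> / 2" if G: "finite G" "s > 0" for G s
  proof -
    obtain z1 z2 where z12: "z1 \<in> ?D \<inter> nbhd G s z" "z2 \<in> ?D \<inter> nbhd G s z" "far \<epsilon> (z1 - z2)"
      using z G unfolding derivation.simps by blast
    then obtain b where b: "b \<in> B" "pr (z1 - z2) b > \<epsilon>" unfolding far_def by blast
    then have "pr (z1 - z) b > \<epsilon> / 2 \<or> pr (z2 - z) (- b) > \<epsilon> / 2"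
      unfolding linear_diff[OF linear_left] linear_neg[OF linear_right] by linarith
    then show ?thesis using z12 b(1) B_symmetric by blast
  qed
  define \<delta> where "\<delta> = min \<tau> (\<epsilon> / 4)"
  have d: "\<delta> > 0" "\<delta> \<le> \<tau>" "\<delta> \<le> \<epsilon> / 4" unfolding \<delta>_def using t e by auto
  obtain y b where yb: "\<And>j::nat. y j \<in> ?D" "\<And>j. b j \<in> B" "\<And>j. pr (y j - z) (b j) > \<epsilon> / 2"
    "\<And>j. y j \<in> nbhd G \<delta> z" "\<And>i j. i < j \<Longrightarrow> \<bar>pr (y j - z) (b i)\<bar> < \<delta>"
  proof (rule far_sequence[of ?D z "\<epsilon> / 2" G \<delta>], goal_cases)
    case (1 G s) from 1(2,3) show ?case by (rule near)
  next
    case 2 show ?case by (rule G)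
  next
    case 3 show ?case by (rule d(1))
  next
    case (4 y b) show ?case by (rule that[of y b, OF 4(2-6)])
  qed
  have bd: "\<bar>pr h (b j)\<bar> \<le> 2 * M" if "h \<in> H" for h j
  proof -
    obtain x x' where "x \<in> K" "x' \<in> K" "h = x - x'" using HK[OF \<open>h \<in> H\<close>] by blast
    then show ?thesis using pr_bound[of x "b j"] pr_bound[of x' "b j"] yb(2)[of j] by (simp add: pr_left_simps)
  qed
  obtain i j where ij: "i < j" "\<And>h. h \<in> H \<Longrightarrow> \<bar>pr h (b i) - pr h (b j)\<bar> < \<tau>"
    using finite_pigeonhole[OF H, of "\<lambda>j h. pr h (b j)" "2 * M" \<tau>] bd t by blast
  show thesis
  proof (rule that[of "y j" "(1/2) *\<^sub>R (b j - b i)"])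
    show "y j \<in> nbhd G \<tau> z" using yb(4)[of j] d by (auto intro: weak_nbhd_mono)
    show "pr (y j - z) ((1/2) *\<^sub>R (b j - b i)) > \<epsilon> / 8"
      using yb(3)[of j] yb(5)[OF ij(1)] d(3)
      unfolding linear_scale[OF linear_right] linear_diff[OF linear_right] by (simp add: field_simps)
    show "\<bar>pr h ((1/2) *\<^sub>R (b j - b i))\<bar> < \<tau>" if "h \<in> H" for h
      using ij(2)[OF that] t
      unfolding linear_scale[OF linear_right] linear_diff[OF linear_right] by (simp add: abs_mult abs_minus_commute)
  qed (use yb B_halfdiff in auto)
qed

definition separated_tree :: "real \<Rightarrow> real \<Rightarrow> (nat \<Rightarrow> 'e) \<Rightarrow> (nat list \<Rightarrow> 'e) \<Rightarrow> (nat list \<Rightarrow> 'i) \<Rightarrow> bool" where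
  "separated_tree c \<kappa> base z b \<longleftrightarrow> (\<forall>k. base k \<in> K) \<and> (\<forall>s. s \<noteq> [] \<longrightarrow> z s \<in> K \<and> b s \<in> B) \<and>
     (\<forall>s. s \<noteq> [] \<longrightarrow> pr (increment base z s) (b s) > c) \<and>
     (\<forall>s t. s \<noteq> [] \<longrightarrow> t \<noteq> [] \<longrightarrow> s \<noteq> t \<longrightarrow>
        \<bar>pr (increment base z s) (b t)\<bar> \<le> \<kappa> * (1/4) ^ idx s * (1/4) ^ idx t)"

lemma separated_treeD:
  assumes "separated_tree c \<kappa> base z b"
  shows "base k \<in> K" "s \<noteq> [] \<Longrightarrow> z s \<in> K" "s \<noteq> [] \<Longrightarrow> b s \<in> B" "s \<noteq> [] \<Longrightarrow> pr (increment base z s) (b s) > c"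
    "s \<noteq> [] \<Longrightarrow> t \<noteq> [] \<Longrightarrow> s \<noteq> t \<Longrightarrow>
      \<bar>pr (increment base z s) (b t)\<bar> \<le> \<kappa> * (1/4) ^ idx s * (1/4) ^ idx t"
  using assms unfolding separated_tree_def by blast+

text \<open>The vertices are treated in the order of \<open>idx\<close>. Every point stays in a derivation of order equal to the number
of levels that remain in its dyadic block, so that it can have children.\<close>

lemma ex_separated_tree:
  assumes e: "\<epsilon> > 0" and k: "\<kappa> > 0" and ne: "\<And>n. derivation \<epsilon> n \<noteq> {}"
  obtains base z b where "separated_tree (\<epsilon> / 8) \<kappa> base z b"
proof -
  have "\<exists>x. x \<in> derivation \<epsilon> (2 ^ k)" for k using ne by blast
  then obtain base where base: "\<And>k. base k \<in> derivation \<epsilon> (2 ^ k)" by metis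
  \<comment> \<open>The number of levels after \<open>s\<close> in its dyadic block.\<close>
  define rem where "rem s = 2 ^ Suc (floor_log (length s)) - 1 - length s" for s :: "nat list"
  define inc where "inc f s = fst (f s) - tree_parent base (\<lambda>u. fst (f u)) s" for f :: "nat list \<Rightarrow> 'e \<times> 'i" and s
  define P where "P f s r \<longleftrightarrow> s = [] \<or> (fst r \<in> derivation \<epsilon> (rem s) \<and> snd r \<in> B \<and>
     pr (fst r - tree_parent base (\<lambda>u. fst (f u)) s) (snd r) > \<epsilon> / 8 \<and>
     (\<forall>t. t \<noteq> [] \<longrightarrow> idx t < idx s \<longrightarrow>
        \<bar>pr (fst r - tree_parent base (\<lambda>u. fst (f u)) s) (snd (f t))\<bar> < \<kappa> * (1/16) ^ idx s \<and>
        \<bar>pr (inc f t) (snd r)\<bar> < \<kappa> * (1/16) ^ idx s))"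
    for f :: "nat list \<Rightarrow> 'e \<times> 'i" and s r
  have "\<exists>f. \<forall>s. P f s (f s)"
  proof (rule dependent_wf_choice[of "inv_image less_than idx"])
    fix f g :: "nat list \<Rightarrow> 'e \<times> 'i" and s r assume fg: "\<And>t. (t, s) \<in> inv_image less_than idx \<Longrightarrow> f t = g t"
    show "P f s r = P g s r"
    proof (cases "s = []")
      case False
      have par: "tree_parent base (\<lambda>u. fst (f u)) t = tree_parent base (\<lambda>u. fst (g u)) t" if "t \<noteq> []" "idx t \<le> idx s" for t
        using fg[of "butlast t"] idx_butlast[OF that(1)] that(2) unfolding tree_parent_def by auto
      have "inc f t = inc g t \<and> snd (f t) = snd (g t)" if "t \<noteq> []" "idx t < idx s" for t
        using par[OF that(1)] fg[of t] that(2) unfolding inc_def by simp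
      then show ?thesis unfolding P_def using par[OF False] by auto
    qed (simp add: P_def)
  next
    fix s and f :: "nat list \<Rightarrow> 'e \<times> 'i" assume IH: "\<And>t. (t, s) \<in> inv_image less_than idx \<Longrightarrow> P f t (f t)"
    show "\<exists>r. P f s r"
    proof (cases "s = []")
      case False
      define p where "p t = tree_parent base (\<lambda>u. fst (f u)) t" for t
      have zK: "fst (f t) \<in> K" "fst (f t) \<in> derivation \<epsilon> (rem t)" if "t \<noteq> []" "idx t < idx s" for t
        using IH[of t] that derivation_subset unfolding P_def by auto
      have pK: "p t \<in> K" if "t \<noteq> []" "idx t < idx s" for t
      proof (cases "length t = 2 ^ floor_log (length t)")
        case True
        then have "p t = base (floor_log (length t))" unfolding p_def tree_parent_def by simp
        then show ?thesis using base derivation_subset by auto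
      next
        case False
        then have "p t = fst (f (butlast t))" unfolding p_def tree_parent_def by simp
        moreover have "butlast t \<noteq> []"
        proof
          assume "butlast t = []"
          then have "length t = 1" using that(1) by (metis One_nat_def append_butlast_last_id append_Nil length_Cons list.size(3))
          then show False using False by simp
        qed
        ultimately show ?thesis using zK(1)[of "butlast t"] idx_butlast[OF that(1)] that(2) by simp
      qed
      have pD: "p s \<in> derivation \<epsilon> (Suc (rem s))"
      proof -
        let ?k = "floor_log (length s)"
        have len: "2 ^ ?k \<le> length s" "length s < 2 * 2 ^ ?k"
          using floor_log_exp2_le[of "length s"] floor_log_exp2_gt[of "length s"] False by auto
        show ?thesis
        proof (cases "length s = 2 ^ ?k")
          case True
          moreover have "length s > 0" using False by simp
          ultimately have "Suc (rem s) = 2 ^ ?k" unfolding rem_def by simp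
          then show ?thesis using base[of ?k] True unfolding p_def tree_parent_def by simp
        next
          case ne: False
          have l: "2 ^ ?k \<le> length s - 1" "length s - 1 < 2 * 2 ^ ?k" using len ne by auto
          have fl: "floor_log (length (butlast s)) = ?k" by (rule floor_log_eqI) (use l in auto)
          have "butlast s \<noteq> []" using l(1) by (metis length_butlast list.size(3) not_one_le_zero one_le_numeral one_le_power order_trans)
          moreover have "rem (butlast s) = Suc (rem s)" unfolding rem_def fl using l len ne by simp
          ultimately show ?thesis
            using zK(2)[of "butlast s"] idx_butlast[OF False] ne unfolding p_def tree_parent_def by simp
        qed
      qed
      define T where "T = {t. idx t < idx s} - {[]}"
      have fT: "finite T" unfolding T_def using finite_idx_less by auto
      have t0: "\<kappa> * (1/16) ^ idx s > 0" using k by simp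
      obtain z' b where zb: "z' \<in> derivation \<epsilon> (rem s)" "b \<in> B"
        "z' \<in> nbhd ((\<lambda>t. snd (f t)) ` T) (\<kappa> * (1/16) ^ idx s) (p s)" "pr (z' - p s) b > \<epsilon> / 8"
        "\<And>h. h \<in> inc f ` T \<Longrightarrow> \<bar>pr h b\<bar> < \<kappa> * (1/16) ^ idx s"
      proof (rule derivation_step[OF e pD, of "(\<lambda>t. snd (f t)) ` T" "inc f ` T" "\<kappa> * (1/16) ^ idx s"], goal_cases)
        case (3 h)
        from 3(2) obtain t where "t \<in> T" "h = fst (f t) - p t" unfolding inc_def p_def by blast
        then show ?case using zK(1)[of t] pK[of t] unfolding T_def by blast
      next
        case (5 z' b) show ?case by (rule that[of z' b, OF 5(2-6)])
      qed (use fT t0 in auto)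
      have "P f s (z', b)"
        unfolding P_def p_def[symmetric]
      proof (intro disjI2 conjI allI impI)
        fix t assume t: "t \<noteq> []" "idx t < idx s"
        then have tT: "t \<in> T" unfolding T_def by auto
        show "\<bar>pr (fst (z', b) - p s) (snd (f t))\<bar> < \<kappa> * (1/16) ^ idx s"
          using weak_nbhd_D[OF zb(3), of "snd (f t)"] tT by (simp add: pr_left_simps)
        show "\<bar>pr (inc f t) (snd (z', b))\<bar> < \<kappa> * (1/16) ^ idx s" using zb(5) tT by simp
      qed (use zb in auto)
      then show ?thesis by blast
    qed (simp add: P_def)
  qed auto
  then obtain f where f: "\<And>s. P f s (f s)" by blast
  define z where "z s = fst (f s)" for s
  define b where "b s = snd (f s)" for s
  have inc: "inc f s = increment base z s" for s unfolding inc_def z_def increment_def ..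
  have F: "z s \<in> derivation \<epsilon> (rem s)" "b s \<in> B" "pr (inc f s) (b s) > \<epsilon> / 8" if "s \<noteq> []" for s
    using f[of s] that unfolding P_def z_def b_def inc_def by auto
  have small: "\<bar>pr (inc f s) (b t)\<bar> \<le> \<kappa> * (1/4) ^ idx s * (1/4) ^ idx t \<and>
      \<bar>pr (inc f t) (b s)\<bar> \<le> \<kappa> * (1/4) ^ idx s * (1/4) ^ idx t"
    if "s \<noteq> []" "t \<noteq> []" "idx t < idx s" for s t
  proof -
    have "(1/16 :: real) ^ idx s = (1/4) ^ idx s * (1/4) ^ idx s" by (simp flip: power_mult_distrib)
    also have "\<dots> \<le> (1/4) ^ idx s * (1/4) ^ idx t" using that(3) by (intro mult_left_mono power_decreasing) auto
    finally have "\<kappa> * (1/16) ^ idx s \<le> \<kappa> * (1/4) ^ idx s * (1/4) ^ idx t" using k by simp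
    moreover have "\<bar>pr (inc f s) (b t)\<bar> < \<kappa> * (1/16) ^ idx s \<and> \<bar>pr (inc f t) (b s)\<bar> < \<kappa> * (1/16) ^ idx s"
      using f[of s] that unfolding P_def b_def inc_def by blast
    ultimately show ?thesis by linarith
  qed
  have "separated_tree (\<epsilon> / 8) \<kappa> base z b"
    unfolding separated_tree_def inc[symmetric]
  proof (intro conjI allI impI)
    show "base k \<in> K" for k using base derivation_subset by blast
    show "z s \<in> K" if "s \<noteq> []" for s using F(1)[OF that] derivation_subset by blast
    fix s t :: "nat list" assume "s \<noteq> []" "t \<noteq> []" "s \<noteq> t"
    then show "\<bar>pr (inc f s) (b t)\<bar> \<le> \<kappa> * (1/4) ^ idx s * (1/4) ^ idx t"
      using small[of s t] small[of t s] by (cases "idx s < idx t") (auto simp: mult_ac not_less le_less)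
  qed (use F in auto)
  then show thesis by (rule that)
qed

end

section \<open>Branches of the tree\<close>

lemma length_lcp:
  "length (longest_common_prefix s t) \<le> length s" "length (longest_common_prefix s t) \<le> length t"
  by (auto intro: prefix_length_le longest_common_prefix_prefix1 longest_common_prefix_prefix2)

lemma lcp_less: assumes "s \<noteq> t" "length t \<le> length s" shows "length (longest_common_prefix s t) < length s"
proof (rule ccontr)
  assume "\<not> ?thesis"
  then have "length (longest_common_prefix s t) = length s" using length_lcp(1)[of s t] by simp
  then have "longest_common_prefix s t = s"
    using longest_common_prefix_prefix1[of s t] by (metis not_equal_is_parallel parallelE prefix_order.refl)
  then have "prefix s t" using longest_common_prefix_prefix2[of s t] by simp
  then show False using assms by (auto simp: prefix_def)
qed

lemma take_neq_beyond_lcp: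
  assumes "length (longest_common_prefix s t) < q" "q \<le> length s"
  shows "take i t \<noteq> take q s"
proof
  assume "take i t = take q s"
  then have "prefix (take q s) t" by (metis take_is_prefix)
  then have "prefix (take q s) (longest_common_prefix s t)"
    by (intro longest_common_prefix_max_prefix take_is_prefix)
  then show False using assms prefix_length_le by fastforce
qed

lemma tree_dist_commute: "tree_dist s t = tree_dist t s"
proof -
  have "longest_common_prefix s t = longest_common_prefix t s"
    by (rule prefix_order.antisym; intro longest_common_prefix_max_prefix longest_common_prefix_prefix1 longest_common_prefix_prefix2)
  then show ?thesis unfolding tree_dist_def by simp
qed

lemma tree_dist_self [simp]: "tree_dist s s = 0"
proof -
  have "longest_common_prefix s s = s"
    by (rule prefix_order.antisym; intro longest_common_prefix_max_prefix longest_common_prefix_prefix1) auto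
  then show ?thesis unfolding tree_dist_def by simp
qed

lemma tree_dist_nonneg: "tree_dist s t \<ge> 0"
  using length_lcp[of s t] unfolding tree_dist_def by simp

lemma edge_bound_prefix:
  fixes \<phi> :: "nat list \<Rightarrow> 'a::real_normed_vector"
  assumes "\<And>s n. norm (\<phi> (s @ [n]) - \<phi> s) \<le> C"
  shows "norm (\<phi> (u @ s) - \<phi> u) \<le> C * real (length s)"
proof (induction s rule: rev_induct)
  case (snoc n s)
  have "norm (\<phi> (u @ s @ [n]) - \<phi> u) \<le> norm (\<phi> ((u @ s) @ [n]) - \<phi> (u @ s)) + norm (\<phi> (u @ s) - \<phi> u)"
    by (rule order_trans[OF _ norm_triangle_ineq]) simp
  also have "\<dots> \<le> C + C * real (length s)" by (intro add_mono assms snoc.IH)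
  finally show ?case by (simp add: algebra_simps)
qed simp

lemma edge_bound_lipschitz:
  fixes \<phi> :: "nat list \<Rightarrow> 'a::real_normed_vector"
  assumes "\<And>s n. norm (\<phi> (s @ [n]) - \<phi> s) \<le> C"
  shows "norm (\<phi> s - \<phi> t) \<le> C * tree_dist s t"
proof -
  define u where "u = longest_common_prefix s t"
  obtain s' t' where st: "s = u @ s'" "t = u @ t'"
    using longest_common_prefix_prefix1[of s t] longest_common_prefix_prefix2[of s t] unfolding u_def prefix_def by blast
  have "norm (\<phi> s - \<phi> t) \<le> norm (\<phi> s - \<phi> u) + norm (\<phi> t - \<phi> u)"
    by (metis norm_minus_commute norm_triangle_sub dist_norm dist_triangle2)
  also have "\<dots> \<le> C * real (length s') + C * real (length t')"
    unfolding st by (intro add_mono edge_bound_prefix assms)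
  also have "\<dots> = C * tree_dist s t"
  proof -
    have "tree_dist s t = real (length s') + real (length t')"
      unfolding tree_dist_def u_def[symmetric] by (simp add: st)
    then show ?thesis by (simp add: distrib_left)
  qed
  finally show ?thesis .
qed

text \<open>It suffices to bound edges from above and to bound the distance of two images from below by the longer of the
two branches that lead from the branching point to the vertices: it is at least half of the tree distance.\<close>

lemma tree_factors_throughI:
  fixes A :: "'a::real_normed_vector \<Rightarrow> 'b::real_normed_vector" and \<phi> :: "nat list \<Rightarrow> 'a"
  assumes A: "bounded_linear A" and c: "c > 0"
    and edge: "\<And>s n. norm (\<phi> (s @ [n]) - \<phi> s) \<le> C"
    and sep: "\<And>s t. s \<noteq> t \<Longrightarrow> length t \<le> length s \<Longrightarrow>
      norm (A (\<phi> s) - A (\<phi> t)) \<ge> c * (real (length s) - real (length (longest_common_prefix s t)))"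
  shows "tree_factors_through A"
proof -
  interpret A: bounded_linear A by fact
  obtain M where M: "M > 0" "\<And>x. norm (A x) \<le> M * norm x" using A.pos_bounded by (metis mult.commute)
  have C: "C \<ge> 0" using order_trans[OF norm_ge_zero edge[of "[]" 0]] .
  define \<mu> where "\<mu> = 1 / ((C + 1) * (M + 1))"
  have l: "\<mu> > 0" "\<mu> * C \<le> 1" "M * (\<mu> * C) \<le> 1"
  proof -
    have p: "(C + 1) * (M + 1) > 0" using C M by simp
    show "\<mu> > 0" unfolding \<mu>_def using p by simp
    have "C \<le> (C + 1) * (M + 1)" "M * C \<le> (C + 1) * (M + 1)" using C M mult_nonneg_nonneg[of C M] by (auto simp: algebra_simps)
    then show "\<mu> * C \<le> 1" "M * (\<mu> * C) \<le> 1" unfolding \<mu>_def using p by (auto simp: divide_le_eq)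
  qed
  define \<psi> where "\<psi> s = \<mu> *\<^sub>R \<phi> s" for s
  have up: "norm (\<psi> s - \<psi> t) \<le> \<mu> * C * tree_dist s t" for s t
  proof -
    have "norm (\<psi> s - \<psi> t) = \<mu> * norm (\<phi> s - \<phi> t)"
      unfolding \<psi>_def using l(1) by (simp flip: scaleR_diff_right)
    also have "\<dots> \<le> \<mu> * (C * tree_dist s t)" using l(1) by (intro mult_left_mono edge_bound_lipschitz edge) auto
    finally show ?thesis by simp
  qed
  have diff: "A (\<psi> s) - A (\<psi> t) = A (\<psi> s - \<psi> t)" for s t by (simp add: A.diff)
  have low: "norm (A (\<psi> s) - A (\<psi> t)) \<ge> \<mu> * c / 2 * tree_dist s t" for s t
  proof -
    have *: "norm (A (\<psi> s) - A (\<psi> t)) \<ge> \<mu> * c / 2 * tree_dist s t" if "length t \<le> length s" for s t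
    proof (cases "s = t")
      case False
      define h where "h = real (length s) - real (length (longest_common_prefix s t))"
      have "tree_dist s t \<le> 2 * h"
        unfolding tree_dist_def h_def using that by simp
      then have "c / 2 * tree_dist s t \<le> c / 2 * (2 * h)"
        using c by (intro mult_left_mono) auto
      then have "c / 2 * tree_dist s t \<le> norm (A (\<phi> s) - A (\<phi> t))"
        using sep[OF False that] unfolding h_def[symmetric] by simp
      from mult_left_mono[OF this, of \<mu>] l(1)
      show ?thesis unfolding \<psi>_def by (simp add: A.scaleR flip: scaleR_diff_right)
    qed simp
    show ?thesis using *[of s t] *[of t s] by (cases "length t \<le> length s") (auto simp: norm_minus_commute tree_dist_commute)
  qed
  define D where "D = 2 * (M + 1) / (\<mu> * c)"
  have D: "D > 0" unfolding D_def using l c M by simp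
  have D1: "d / D \<le> \<mu> * c / 2 * d" "M * (d / D) \<le> \<mu> * c / 2 * d" if "d \<ge> 0" for d
  proof -
    have DM: "D * (\<mu> * c / 2) = M + 1" unfolding D_def using l(1) c by simp
    have "1 / D \<le> \<mu> * c / 2" using DM D M(1) by (subst pos_divide_le_eq[OF D]) (simp add: mult.commute)
    from mult_right_mono[OF this that] show "d / D \<le> \<mu> * c / 2 * d" by simp
    have "M / D \<le> \<mu> * c / 2" using DM D by (subst pos_divide_le_eq[OF D]) (simp add: mult.commute)
    from mult_right_mono[OF this that] show "M * (d / D) \<le> \<mu> * c / 2 * d" by simp
  qed
  show ?thesis
    unfolding tree_factors_through_def
  proof (intro exI[of _ \<psi>] exI[of _ D] conjI allI D)
    fix s t
    note d = tree_dist_nonneg[of s t]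
    have u1: "norm (\<psi> s - \<psi> t) \<le> tree_dist s t" using up[of s t] mult_right_mono[OF l(2) d] by simp
    have "norm (A (\<psi> s) - A (\<psi> t)) \<le> M * (\<mu> * C * tree_dist s t)"
      unfolding diff using M(2)[of "\<psi> s - \<psi> t"] mult_left_mono[OF up[of s t], of M] M(1) by linarith
    also have "\<dots> \<le> tree_dist s t" using mult_right_mono[OF l(3) d] by (simp add: mult.assoc)
    finally have u2: "norm (A (\<psi> s) - A (\<psi> t)) \<le> tree_dist s t" .
    have "M * (tree_dist s t / D) \<le> M * norm (\<psi> s - \<psi> t)"
      using D1(2)[OF d] low[of s t] M(2)[of "\<psi> s - \<psi> t"] unfolding diff by linarith
    then have l2: "tree_dist s t / D \<le> norm (\<psi> s - \<psi> t)" using M(1) by (rule mult_left_le_imp_le)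
    show "norm (A (\<psi> s) - A (\<psi> t)) \<in> {tree_dist s t / D..tree_dist s t}" using u2 order_trans[OF D1(1)[OF d] low[of s t]] by simp
    show "norm (\<psi> s - \<psi> t) \<in> {tree_dist s t / D..tree_dist s t}" using u1 l2 by simp
  qed
qed

text \<open>An interval of levels may meet many dyadic blocks, but the last one or the one before it contains
a quarter of the interval.\<close>

lemma dyadic_block_in_interval:
  assumes "p < n"
  obtains l r k where "p \<le> l" "l < r" "r \<le> n" "\<And>j. l < j \<Longrightarrow> j \<le> r \<Longrightarrow> floor_log j = k" "n - p \<le> 4 * (r - l)"
proof -
  define k where "k = floor_log n"
  define a :: nat where "a = 2 ^ k"
  have a: "a > 0" "a \<le> n" "n < 2 * a"
    unfolding a_def k_def using floor_log_exp2_le[of n] floor_log_exp2_gt[of n] assms by auto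
  have fl: "floor_log j = k" if "a \<le> j" "j < 2 * a" for j
    by (rule floor_log_eqI) (use that a in \<open>auto simp: a_def\<close>)
  consider "a \<le> p" | "p < a" "n - p \<le> 4 * (n - (a - 1))" | "p < a" "4 * (n - (a - 1)) < n - p" by linarith
  then show thesis
  proof cases
    case 1
    show thesis by (rule that[of p n k]) (use 1 a assms fl in auto)
  next
    case 2
    show thesis by (rule that[of "a - 1" n k]) (use 2 a assms in \<open>auto intro!: fl\<close>)
  next
    case 3
    then have "k \<noteq> 0" using a unfolding a_def by (cases k) auto
    then obtain k' where k': "k = Suc k'" by (cases k) auto
    define b :: nat where "b = 2 ^ k'"
    have b: "b > 0" "a = 2 * b" unfolding b_def a_def k' by auto
    have fl': "floor_log j = k'" if "b \<le> j" "j < 2 * b" for j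
      by (rule floor_log_eqI) (use that b in \<open>auto simp: b_def\<close>)
    show thesis
      by (rule that[of "max p (b - 1)" "a - 1" k']) (use 3 a b assms in \<open>auto intro!: fl'\<close>)
  qed
qed

lemma sum_increments:
  assumes "l < r" "r \<le> length s" and fl: "\<And>j. l < j \<Longrightarrow> j \<le> r \<Longrightarrow> floor_log j = k"
  shows "(\<Sum>q\<in>{l<..r}. increment base z (take q s)) = z (take r s) - tree_parent base z (take (Suc l) s)"
proof -
  have "m \<le> length s \<Longrightarrow> (\<And>j. l < j \<Longrightarrow> j \<le> m \<Longrightarrow> floor_log j = k) \<Longrightarrow>
    (\<Sum>q\<in>{l<..m}. increment base z (take q s)) = z (take m s) - tree_parent base z (take (Suc l) s)"
    if "Suc l \<le> m" for m
    using that
  proof (induction m rule: dec_induct)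
    case base
    have "{l<..Suc l} = {Suc l}" by auto
    then show ?case by (simp add: increment_def)
  next
    case (step m)
    have "{l<..Suc m} = insert (Suc m) {l<..m}" using step.hyps by auto
    then have "(\<Sum>q\<in>{l<..Suc m}. increment base z (take q s)) = increment base z (take (Suc m) s) + (\<Sum>q\<in>{l<..m}. increment base z (take q s))"
      by simp
    also have "(\<Sum>q\<in>{l<..m}. increment base z (take q s)) = z (take m s) - tree_parent base z (take (Suc l) s)"
      by (rule step.IH) (use step.prems in auto)
    also have "tree_parent base z (take (Suc m) s) = z (take m s)"
    proof -
      have k: "floor_log (Suc m) = k" "floor_log m = k" using step.prems(2) step.hyps by auto
      have "2 ^ k \<le> m" using floor_log_exp2_le[of m] k step.hyps by auto
      then have "Suc m \<noteq> 2 ^ floor_log (Suc m)" using k by simp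
      then show ?thesis unfolding tree_parent_def using step.prems(1)
        by (simp add: butlast_take min_absorb2)
    qed
    then have "increment base z (take (Suc m) s) = z (take (Suc m) s) - z (take m s)" by (simp add: increment_def)
    finally show ?case by simp
  qed
  then show ?thesis using assms by simp
qed

lemma sum_quarter_powers_le: "(\<Sum>i\<in>{a..n::nat}. (1/4::real) ^ i) \<le> 2 * (1/4) ^ a"
proof -
  have "(\<Sum>i\<in>{a..n}. (1/4::real) ^ i) \<le> 2 * (1/4) ^ a - (1/4) ^ n" if "a \<le> n"
    using that
  proof (induction n rule: dec_induct)
    case (step n)
    have "(\<Sum>i\<in>{a..Suc n}. (1/4::real) ^ i) = (\<Sum>i\<in>{a..n}. (1/4) ^ i) + (1/4) ^ Suc n"
      using step.hyps by simp
    also have "\<dots> \<le> 2 * (1/4) ^ a - (1/4) ^ n + (1/4) ^ Suc n" using step.IH by simp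
    also have "\<dots> \<le> 2 * (1/4) ^ a - (1/4) ^ Suc n" by simp
    finally show ?case .
  qed simp
  then show ?thesis by (cases "a \<le> n") (auto intro: order_trans)
qed

lemma sum_half_powers_le: "(\<Sum>i\<in>{1..n::nat}. (1/2::real) ^ i) \<le> 1"
proof -
  have "(\<Sum>i\<in>{1..n::nat}. (1/2::real) ^ i) = 1 - (1/2) ^ n" by (induction n) auto
  then show ?thesis by simp
qed

lemma quarter_power_idx: "length s \<ge> i \<Longrightarrow> (1/4::real) ^ idx (take i s) \<le> (1/4) ^ i"
  using length_le_idx[of "take i s"] by (intro power_decreasing) auto

context dual_pairing
begin

text \<open>The increment at a vertex beyond the branching point of \<open>s\<close> and \<open>t\<close> sees, up to a small error, only the norming element of its
own vertex, which occurs on the branch to \<open>s\<close> but not on the branch to \<open>t\<close>.\<close>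

lemma tree_increment_sum:
  assumes tree: "separated_tree c \<kappa> base z b" and k: "\<kappa> \<ge> 0" and q: "length (longest_common_prefix s t) < q" "q \<le> length s"
  shows "(\<Sum>i\<in>{1..length s}. pr (increment base z (take q s)) (b (take i s))) -
     (\<Sum>i\<in>{1..length t}. pr (increment base z (take q s)) (b (take i t))) \<ge> c - 2 * \<kappa>"
proof -
  let ?x = "increment base z (take q s)"
  have ne: "take i u \<noteq> []" if "i \<in> {1..length u}" for i and u :: "nat list" using that by (cases u) auto
  have qs: "q \<in> {1..length s}" using q by auto
  have cross: "\<bar>pr ?x (b (take i u))\<bar> \<le> \<kappa> * (1/4) ^ i" if "take i u \<noteq> take q s" "i \<in> {1..length u}" for i u
  proof -
    have "\<bar>pr ?x (b (take i u))\<bar> \<le> \<kappa> * (1/4) ^ idx (take q s) * (1/4) ^ idx (take i u)"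
      using separated_treeD(5)[OF tree ne[OF qs] ne[OF that(2)]] that(1) by metis
    also have "\<dots> \<le> \<kappa> * 1 * (1/4) ^ i"
      using k quarter_power_idx[of i u] that(2) by (intro mult_mono) (auto intro: power_le_one)
    finally show ?thesis by simp
  qed
  have geo: "(\<Sum>i\<in>{1..m}. \<kappa> * (1/4) ^ i) \<le> \<kappa>" for m :: nat
    using mult_left_mono[OF sum_quarter_powers_le[of 1 m] k] k by (simp flip: sum_distrib_left)
  have "\<bar>\<Sum>i\<in>{1..length t}. pr ?x (b (take i t))\<bar> \<le> (\<Sum>i\<in>{1..length t}. \<kappa> * (1/4) ^ i)"
    by (rule sum_abs[THEN order_trans], rule sum_mono, rule cross) (use take_neq_beyond_lcp[OF q] in auto)
  then have T: "(\<Sum>i\<in>{1..length t}. pr ?x (b (take i t))) \<le> \<kappa>" using geo[of "length t"] by linarith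
  have neq: "take i s \<noteq> take q s" if "i \<in> {1..length s} - {q}" for i
    using that qs by (metis DiffE atLeastAtMost_iff insertCI length_take min_absorb2)
  have "\<bar>\<Sum>i\<in>{1..length s} - {q}. pr ?x (b (take i s))\<bar> \<le> (\<Sum>i\<in>{1..length s} - {q}. \<kappa> * (1/4) ^ i)"
    by (rule sum_abs[THEN order_trans], rule sum_mono, rule cross) (use neq in auto)
  also have "\<dots> \<le> (\<Sum>i\<in>{1..length s}. \<kappa> * (1/4) ^ i)" using k by (intro sum_mono2) auto
  finally have "(\<Sum>i\<in>{1..length s} - {q}. pr ?x (b (take i s))) \<ge> - \<kappa>" using geo[of "length s"] by linarith
  moreover have "pr ?x (b (take q s)) > c" by (rule separated_treeD(4)[OF tree ne[OF qs]])
  ultimately have "(\<Sum>i\<in>{1..length s}. pr ?x (b (take i s))) \<ge> c - \<kappa>"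
    by (subst sum.remove[OF _ qs]) auto
  then show ?thesis using T by linarith
qed

text \<open>The difference \<open>z - base\<close> is the sum of the increments since the beginning of the block, so up to a
small error the norming element at \<open>v\<close> detects whether \<open>v\<close> is one of the vertices passed there. The errors
decrease geometrically because \<open>idx\<close> is at least the length and a block starts beyond half of the level \<open>i\<close>.\<close>

lemma tree_block_sum:
  assumes tree: "separated_tree c \<kappa> base z b" and k: "\<kappa> \<ge> 0" and i: "i \<in> {1..length u}" and v: "v \<noteq> []"
  shows "\<bar>pr (z (take i u) - base (floor_log i)) (b v) - (if \<exists>q\<in>{2 ^ floor_log i..i}. take q u = v
       then pr (increment base z v) (b v) else 0)\<bar> \<le> 2 * \<kappa> * (1/2) ^ i"
proof -
  define a :: nat where "a = 2 ^ floor_log i"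
  have a: "a > 0" "a \<le> i" "i < 2 * a"
    unfolding a_def using floor_log_exp2_le[of i] floor_log_exp2_gt[of i] i by auto
  have fl: "floor_log j = floor_log i" if "a - 1 < j" "j \<le> i" for j
  proof (rule floor_log_eqI)
    show "j > 0" "2 ^ floor_log i \<le> j" "j < 2 * 2 ^ floor_log i"
      unfolding a_def[symmetric] using that a by linarith+
  qed
  have "(\<Sum>q\<in>{a - 1<..i}. increment base z (take q u)) = z (take i u) - tree_parent base z (take (Suc (a - 1)) u)"
  proof (rule sum_increments)
    show "a - 1 < i" using a by linarith
    show "i \<le> length u" using i by simp
    show "\<And>j. a - 1 < j \<Longrightarrow> j \<le> i \<Longrightarrow> floor_log j = floor_log i" by (rule fl)
  qed
  moreover have "tree_parent base z (take (Suc (a - 1)) u) = base (floor_log i)"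
  proof -
    have "length (take (Suc (a - 1)) u) = a" using a i by auto
    then show ?thesis unfolding tree_parent_def a_def by simp
  qed
  moreover have "{a - 1<..i} = {a..i}" using a by auto
  ultimately have tel: "z (take i u) - base (floor_log i) = (\<Sum>q\<in>{a..i}. increment base z (take q u))" by simp
  define g where "g q = pr (increment base z (take q u)) (b v)" for q
  define h where "h q = (if take q u = v then g q else 0)" for q
  have len: "length (take q u) = q" if "q \<in> {a..i}" for q using that i by auto
  have cross: "\<bar>g q - h q\<bar> \<le> \<kappa> * (1/4) ^ q" if q: "q \<in> {a..i}" for q
  proof (cases "take q u = v")
    case False
    have ne: "take q u \<noteq> []" using len[OF q] q a by auto
    have "\<bar>g q\<bar> \<le> \<kappa> * (1/4) ^ idx (take q u) * (1/4) ^ idx v"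
      unfolding g_def by (rule separated_treeD(5)[OF tree ne v False])
    also have "\<dots> \<le> \<kappa> * (1/4) ^ q * 1"
      using k quarter_power_idx[of q u] q i by (intro mult_mono) (auto intro: power_le_one)
    finally show ?thesis using False unfolding h_def by simp
  qed (use k in \<open>simp add: h_def\<close>)
  have "(\<Sum>q\<in>{a..i}. h q) = (if \<exists>q\<in>{a..i}. take q u = v then pr (increment base z v) (b v) else 0)"
  proof (cases "\<exists>q\<in>{a..i}. take q u = v")
    case True
    then obtain q where q: "q \<in> {a..i}" "take q u = v" by blast
    have "h j = (if j = q then g q else 0)" if "j \<in> {a..i}" for j
      using len[OF that] len[OF q(1)] q(2) unfolding h_def by auto
    then have "(\<Sum>q\<in>{a..i}. h q) = g q" using q(1) by (simp add: sum.delta)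
    then show ?thesis using True q(2) unfolding g_def by auto
  next
    case False
    then have "(\<Sum>q\<in>{a..i}. h q) = 0" unfolding h_def by (intro sum.neutral) auto
    then show ?thesis using False by simp
  qed
  moreover have "pr (z (take i u) - base (floor_log i)) (b v) = (\<Sum>q\<in>{a..i}. g q)"
    unfolding tel g_def by (rule linear_sum[OF linear_left])
  moreover have "\<bar>(\<Sum>q\<in>{a..i}. g q) - (\<Sum>q\<in>{a..i}. h q)\<bar> \<le> (\<Sum>q\<in>{a..i}. \<kappa> * (1/4) ^ q)"
    unfolding sum_subtractf[symmetric] by (rule sum_abs[THEN order_trans], rule sum_mono, rule cross)
  moreover have "(\<Sum>q\<in>{a..i}. \<kappa> * (1/4) ^ q) \<le> 2 * \<kappa> * (1/2) ^ i"
  proof -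
    have "(\<Sum>q\<in>{a..i}. \<kappa> * (1/4) ^ q) \<le> \<kappa> * (2 * (1/4) ^ a)"
      using mult_left_mono[OF sum_quarter_powers_le[of a i] k] by (simp add: sum_distrib_left)
    moreover have "(1/4::real) ^ a \<le> (1/2) ^ i"
    proof -
      have "(1/4::real) ^ a = (1/2) ^ (2 * a)" by (simp add: power_mult power2_eq_square)
      also have "\<dots> \<le> (1/2) ^ i" using a by (intro power_decreasing) auto
      finally show ?thesis .
    qed
    then have "\<kappa> * (2 * (1/4) ^ a) \<le> \<kappa> * (2 * (1/2) ^ i)" using k by (intro mult_left_mono) auto
    ultimately show ?thesis by simp
  qed
  ultimately show ?thesis unfolding a_def[symmetric] by linarith
qed

text \<open>The increment at the first vertex after the branching point is contained in the point at each later level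
of the block. Summing the points therefore counts it \<open>r - l\<close> times, whereas it never occurs on the branch
to \<open>t\<close>.\<close>

lemma tree_summed_partial_sums:
  assumes tree: "separated_tree c \<kappa> base z b" and k: "\<kappa> \<ge> 0" and c: "c \<ge> 0"
    and lr: "length (longest_common_prefix s t) \<le> l" "l < r" "r \<le> length s"
    and fl: "\<And>j. l < j \<Longrightarrow> j \<le> r \<Longrightarrow> floor_log j = m"
  shows "(\<Sum>i\<in>{1..length s}. pr (z (take i s) - base (floor_log i)) (b (take (Suc l) s))) -
     (\<Sum>i\<in>{1..length t}. pr (z (take i t) - base (floor_log i)) (b (take (Suc l) s))) \<ge> c * real (r - l) - 4 * \<kappa>"
proof -
  let ?v = "take (Suc l) s"
  have v: "?v \<noteq> []" using lr by (cases s) auto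
  define w where "w u i = pr (z (take i u) - base (floor_log i)) (b ?v)" for u i
  define e where "e u i = (if \<exists>q\<in>{2 ^ floor_log i..i}. take q u = ?v then pr (increment base z ?v) (b ?v) else 0)" for u i
  have we: "\<bar>w u i - e u i\<bar> \<le> 2 * \<kappa> * (1/2) ^ i" if "i \<in> {1..length u}" for u i
    unfolding w_def e_def by (rule tree_block_sum[OF tree k that v])
  have W: "\<bar>(\<Sum>i\<in>{1..length u}. w u i) - (\<Sum>i\<in>{1..length u}. e u i)\<bar> \<le> 2 * \<kappa>" for u
  proof -
    have "\<bar>(\<Sum>i\<in>{1..length u}. w u i) - (\<Sum>i\<in>{1..length u}. e u i)\<bar> \<le> (\<Sum>i\<in>{1..length u}. 2 * \<kappa> * (1/2) ^ i)"
      unfolding sum_subtractf[symmetric] by (rule sum_abs[THEN order_trans], rule sum_mono, rule we)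
    also have "\<dots> = 2 * \<kappa> * (\<Sum>i\<in>{1..length u}. (1/2) ^ i)" by (simp add: sum_distrib_left)
    also have "\<dots> \<le> 2 * \<kappa> * 1" using k sum_half_powers_le[of "length u"] by (intro mult_left_mono) auto
    finally show ?thesis by simp
  qed
  have pos: "pr (increment base z ?v) (b ?v) > c" by (rule separated_treeD(4)[OF tree v])
  have "(\<Sum>i\<in>{1..length t}. e t i) = 0"
    unfolding e_def by (rule sum.neutral) (use take_neq_beyond_lcp[of s t "Suc l"] lr in auto)
  moreover have "(\<Sum>i\<in>{1..length s}. e s i) \<ge> (\<Sum>i\<in>{l<..r}. c)"
  proof -
    have "(\<Sum>i\<in>{l<..r}. c) \<le> (\<Sum>i\<in>{l<..r}. e s i)"
    proof (rule sum_mono)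
      fix i assume i: "i \<in> {l<..r}"
      have "2 ^ floor_log (Suc l) \<le> Suc l" using floor_log_exp2_le[of "Suc l"] by simp
      moreover have "floor_log (Suc l) = floor_log i" using fl i lr by auto
      ultimately have "\<exists>q\<in>{2 ^ floor_log i..i}. take q s = ?v" using i by (intro bexI[of _ "Suc l"]) auto
      then show "c \<le> e s i" unfolding e_def using pos by simp
    qed
    also have "\<dots> \<le> (\<Sum>i\<in>{1..length s}. e s i)"
      by (rule sum_mono2) (use lr pos c in \<open>auto simp: e_def\<close>)
    finally show ?thesis .
  qed
  ultimately show ?thesis using W[of s] W[of t] unfolding w_def by (simp add: mult.commute)
qed

end

section \<open>Weak compactness of the image ball and of the dual ball\<close>

lemma blinfun_linear_left: "linear (\<lambda>f. blinfun_apply f y)"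
  by (rule linearI) (simp_all add: blinfun.bilinear_simps)

lemma blinfun_linear_right: "linear (blinfun_apply f)"
  by (rule linearI) (simp_all add: blinfun.bilinear_simps)

lemma blinfun_abs_le: assumes "norm f \<le> 1" shows "\<bar>blinfun_apply f y\<bar> \<le> norm y"
  using norm_blinfun[of f y] mult_right_mono[OF assms norm_ge_zero[of y]] by simp

text \<open>The Banach-Alaoglu theorem. The product of the intervals \<open>[- norm y, norm y]\<close> is compact, and the functions in it
that are not linear are covered by the open sets on which one instance of linearity fails.\<close>

lemma weakly_compact_dual_ball:
  "weakly_compact_set blinfun_apply (cball 0 1 :: ('b::real_normed_vector \<Rightarrow>\<^sub>L real) set)"
  unfolding weakly_compact_set_def
proof (intro allI impI)
  fix G :: "('b \<Rightarrow>\<^sub>L real) \<Rightarrow> 'b set" and \<tau> :: "('b \<Rightarrow>\<^sub>L real) \<Rightarrow> real"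
  let ?K = "cball 0 1 :: ('b \<Rightarrow>\<^sub>L real) set"
  assume GT: "\<forall>f\<in>?K. finite (G f) \<and> \<tau> f > 0"
  define box :: "('b \<Rightarrow> real) set" where "box = PiE UNIV (\<lambda>y. {- norm y..norm y})"
  have "compactin (product_topology (\<lambda>_. euclidean) UNIV) box"
    unfolding box_def compactin_PiE by auto
  then have cbox: "compact box" by (simp add: euclidean_product_topology)
  \<comment> \<open>Open sets of two kinds: given neighbourhoods of points of the dual ball, and failures of linearity.\<close>
  define U where "U c = (case c of Inl f \<Rightarrow> {g :: 'b \<Rightarrow> real. \<forall>y\<in>G f. \<bar>g y - blinfun_apply f y\<bar> < \<tau> f}
     | Inr (x, y, a) \<Rightarrow> {g. g (x + a *\<^sub>R y) \<noteq> g x + a * g y})" for c :: "('b \<Rightarrow>\<^sub>L real) + 'b \<times> 'b \<times> real"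
  have cont: "continuous_on UNIV (\<lambda>g :: 'b \<Rightarrow> real. g y)" for y by (rule continuous_on_product_coordinates)
  obtain C' where C': "C' \<subseteq> ?K <+> UNIV" "finite C'" "box \<subseteq> (\<Union>c\<in>C'. U c)"
  proof (rule compactE_image[OF cbox, of "?K <+> UNIV" U])
    fix c assume c: "c \<in> ?K <+> (UNIV :: ('b \<times> 'b \<times> real) set)"
    show "open (U c)"
    proof (cases c)
      case (Inl f)
      then have "finite (G f)" using c GT by auto
      moreover have "open {g :: 'b \<Rightarrow> real. \<bar>g y - blinfun_apply f y\<bar> < \<tau> f}" for y
        by (rule open_Collect_less) (intro continuous_intros cont)+
      ultimately have "open (\<Inter>y\<in>G f. {g :: 'b \<Rightarrow> real. \<bar>g y - blinfun_apply f y\<bar> < \<tau> f})" by (intro open_INT) auto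
      moreover have "U c = (\<Inter>y\<in>G f. {g. \<bar>g y - blinfun_apply f y\<bar> < \<tau> f})" unfolding U_def Inl by auto
      ultimately show ?thesis by simp
    next
      case (Inr p)
      obtain x y a where p: "p = (x, y, a)" by (cases p)
      have "open {g :: 'b \<Rightarrow> real. g (x + a *\<^sub>R y) \<noteq> g x + a * g y}"
        by (rule open_Collect_neq) (intro continuous_intros cont)+
      then show ?thesis unfolding U_def Inr p by simp
    qed
  next
    show "box \<subseteq> (\<Union>c\<in>?K <+> UNIV. U c)"
    proof
      fix g assume g: "g \<in> box"
      have bd: "\<bar>g y\<bar> \<le> norm y" for y using PiE_mem[OF g[unfolded box_def], of y] by auto
      show "g \<in> (\<Union>c\<in>?K <+> UNIV. U c)"
      proof (cases "\<forall>x y a. g (x + a *\<^sub>R y) = g x + a * g y")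
        case True
        have "g 0 = 0" using bd[of 0] by simp
        then have "g (x + y) = g x + g y" "g (a *\<^sub>R y) = a *\<^sub>R g y" for x y a
          using True[rule_format, of x 1 y] True[rule_format, of 0 a y] by simp_all
        then have bl: "bounded_linear g"
          by (intro bounded_linear_intro[where K=1]) (use bd in auto)
        have ap: "blinfun_apply (Blinfun g) = g" by (rule bounded_linear_Blinfun_apply[OF bl])
        have "norm (Blinfun g) \<le> 1" by (rule norm_blinfun_bound) (use bd in \<open>auto simp: ap\<close>)
        then have K: "Blinfun g \<in> ?K" by simp
        have "g \<in> U (Inl (Blinfun g))" unfolding U_def using GT K by (simp add: ap)
        then show ?thesis using K by blast
      next
        case False
        then obtain x y a where "g \<in> U (Inr (x, y, a))" unfolding U_def by auto
        then show ?thesis by blast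
      qed
    qed
  next
    fix C' assume "C' \<subseteq> ?K <+> UNIV" "finite C'" "box \<subseteq> (\<Union>c\<in>C'. U c)"
    then show thesis by (rule that)
  qed
  define Z where "Z = {f. Inl f \<in> C'}"
  have "finite Z" using finite_vimageI[OF C'(2), of Inl] unfolding Z_def vimage_def by simp
  moreover have "Z \<subseteq> ?K" using C'(1) unfolding Z_def by auto
  moreover have "\<exists>z\<in>Z. f \<in> weak_nbhd blinfun_apply (G z) (\<tau> z) z" if f: "f \<in> ?K" for f
  proof -
    have "\<bar>blinfun_apply f y\<bar> \<le> norm y" for y using f by (intro blinfun_abs_le) simp
    then have "blinfun_apply f \<in> box" unfolding box_def by (auto simp: abs_le_iff minus_le_iff)
    then obtain c where c: "c \<in> C'" "blinfun_apply f \<in> U c" using C'(3) by blast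
    show ?thesis
    proof (cases c)
      case (Inl z)
      then show ?thesis using c unfolding Z_def U_def weak_nbhd_def by auto
    next
      case (Inr p)
      then show ?thesis using c unfolding U_def by (cases p) (simp add: blinfun.bilinear_simps)
    qed
  qed
  ultimately show "\<exists>Z. finite Z \<and> Z \<subseteq> ?K \<and> (\<forall>f\<in>?K. \<exists>z\<in>Z. f \<in> weak_nbhd blinfun_apply (G z) (\<tau> z) z)"
    by blast
qed

lemma topspace_weak_topology: "topspace (weak_topology :: 'b::real_normed_vector topology) = UNIV"
proof -
  have "UNIV \<in> {f -` U | (f :: 'b \<Rightarrow> real) U. bounded_linear f \<and> open U}"
    using bounded_linear_zero by (intro CollectI exI[of _ "\<lambda>_. 0"] exI[of _ UNIV]) auto
  then show ?thesis unfolding weak_topology_def by auto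
qed

lemma openin_weak_preimage:
  fixes f :: "'b::real_normed_vector \<Rightarrow> real"
  assumes "bounded_linear f" "open U" shows "openin weak_topology (f -` U)"
  unfolding weak_topology_def
  by (rule topology_generated_by_Basis) (intro CollectI exI[of _ f] exI[of _ U] conjI refl assms)

lemma openin_weak_imp_open:
  assumes "openin weak_topology T" shows "open T"
proof -
  have "generate_topology_on {f -` U | (f :: 'a \<Rightarrow> real) U. bounded_linear f \<and> open U} T"
    using assms unfolding weak_topology_def by (rule openin_topology_generated_by)
  then show ?thesis
  proof induction
    case (Basis s)
    then obtain f :: "'a \<Rightarrow> real" and U where "s = f -` U" "bounded_linear f" "open U" by blast
    then show ?case by (metis linear_continuous_on open_vimage)
  qed auto
qed

text \<open>Mazur's theorem for the image of the unit ball: a norm separation is a weak separation.\<close>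

lemma weak_closure_image_ball:
  assumes A: "bounded_linear A"
  shows "weak_topology closure_of (A ` cball 0 1) = closure (A ` cball 0 1)"
proof (rule set_eqI, rule iffI)
  fix y assume y: "y \<in> closure (A ` cball 0 1)"
  show "y \<in> weak_topology closure_of (A ` cball 0 1)"
    unfolding in_closure_of topspace_weak_topology
  proof (intro conjI UNIV_I allI impI)
    fix T assume T: "y \<in> T \<and> openin weak_topology T"
    then have "T \<inter> A ` cball 0 1 \<noteq> {}"
      using y openin_weak_imp_open open_Int_closure_eq_empty by (metis IntI empty_iff)
    then show "\<exists>x. x \<in> A ` cball 0 1 \<and> x \<in> T" by blast
  qed
next
  fix y assume y: "y \<in> weak_topology closure_of (A ` cball 0 1)"
  show "y \<in> closure (A ` cball 0 1)"
  proof (rule ccontr)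
    assume "y \<notin> closure (A ` cball 0 1)"
    then obtain f s where f: "bounded_linear f" "\<And>x. norm x \<le> 1 \<Longrightarrow> f (A x) \<le> 1" "f y \<ge> 1 + s" "s > (0::real)"
      using separate_from_image_ball[OF A] by metis
    have "openin weak_topology (f -` {1<..})" by (rule openin_weak_preimage[OF f(1)]) simp
    moreover have "y \<in> f -` {1<..}" using f(3,4) by simp
    ultimately obtain v where "v \<in> A ` cball 0 1" "v \<in> f -` {1<..}"
      using y[unfolded in_closure_of, THEN conjunct2, rule_format, of "f -` {1<..}"] by blast
    then obtain x where "norm x \<le> 1" "f (A x) > 1" by auto
    then show False using f(2)[of x] by simp
  qed
qed

lemma weakly_compact_closure_image_ball:
  assumes "weakly_compact_operator A"
  shows "weakly_compact_set (\<lambda>y f. blinfun_apply f y) (closure (A ` cball 0 1))"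
  unfolding weakly_compact_set_def
proof (intro allI impI)
  let ?K = "closure (A ` cball 0 1)"
  fix G :: "'b \<Rightarrow> ('b \<Rightarrow>\<^sub>L real) set" and \<tau> :: "'b \<Rightarrow> real"
  assume GT: "\<forall>y\<in>?K. finite (G y) \<and> \<tau> y > 0"
  have cK: "compactin weak_topology ?K"
    using assms weak_closure_image_ball unfolding weakly_compact_operator_def by metis
  define U where "U z = (\<Inter>f\<in>G z. blinfun_apply f -` {blinfun_apply f z - \<tau> z<..<blinfun_apply f z + \<tau> z}) \<inter> topspace weak_topology" for z
  have op: "openin weak_topology (U z)" if "z \<in> ?K" for z
    unfolding U_def
  proof (rule openin_INT)
    show "finite (G z)" using GT that by blast
    show "openin weak_topology (blinfun_apply f -` {blinfun_apply f z - \<tau> z<..<blinfun_apply f z + \<tau> z})" for f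
      by (rule openin_weak_preimage[OF blinfun.bounded_linear_right open_greaterThanLessThan])
  qed
  have U: "y \<in> U z \<longleftrightarrow> y \<in> weak_nbhd (\<lambda>y f. blinfun_apply f y) (G z) (\<tau> z) z" for y z
    unfolding U_def topspace_weak_topology weak_nbhd_def by (auto simp: abs_less_iff algebra_simps)
  have "\<exists>F. finite F \<and> F \<subseteq> U ` ?K \<and> ?K \<subseteq> \<Union>F"
  proof (rule compactinD[OF cK])
    show "openin weak_topology V" if "V \<in> U ` ?K" for V using that op by blast
    show "?K \<subseteq> \<Union>(U ` ?K)" using GT U by auto
  qed
  then obtain F where F: "finite F" "F \<subseteq> U ` ?K" "?K \<subseteq> \<Union>F" by blast
  then obtain Z where Z: "Z \<subseteq> ?K" "finite Z" "F = U ` Z" by (meson finite_subset_image)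
  show "\<exists>Z. finite Z \<and> Z \<subseteq> ?K \<and> (\<forall>y\<in>?K. \<exists>z\<in>Z. y \<in> weak_nbhd (\<lambda>y f. blinfun_apply f y) (G z) (\<tau> z) z)"
  proof (intro exI[of _ Z] conjI ballI)
    fix y assume "y \<in> ?K"
    then obtain z where "z \<in> Z" "y \<in> U z" using F(3) Z(3) by blast
    then show "\<exists>z\<in>Z. y \<in> weak_nbhd (\<lambda>y f. blinfun_apply f y) (G z) (\<tau> z) z" using U by blast
  qed (use Z in auto)
qed

lemma convex_image_ball: "bounded_linear A \<Longrightarrow> convex (A ` cball 0 1)"
  by (intro convex_linear_image bounded_linear.linear) auto

lemma dual_pairing_dual_ball:
  fixes A :: "'a::real_normed_vector \<Rightarrow> 'b::real_normed_vector"
  assumes A: "bounded_linear A" and M: "M > 0" "\<And>x. norm (A x) \<le> M * norm x"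
  shows "dual_pairing blinfun_apply (cball 0 1 :: ('b \<Rightarrow>\<^sub>L real) set) (A ` cball 0 1) M"
proof (rule dual_pairing.intro)
  interpret A: bounded_linear A by fact
  show "- b \<in> A ` cball 0 1" if "b \<in> A ` cball 0 1" for b
    using that by (auto simp: A.neg[symmetric] simp del: A.neg intro!: imageI)
  show "(1/2) *\<^sub>R (b - c) \<in> A ` cball 0 1" if bc: "b \<in> A ` cball 0 1" "c \<in> A ` cball 0 1" for b c
  proof -
    obtain x y where xy: "b = A x" "c = A y" "norm x \<le> 1" "norm y \<le> 1" using bc by auto
    have "(1/2) *\<^sub>R (b - c) = A ((1/2) *\<^sub>R (x - y))" unfolding xy by (simp add: A.scaleR A.diff)
    moreover have "norm ((1/2) *\<^sub>R (x - y)) \<le> 1" using norm_triangle_ineq4[of x y] xy by simp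
    ultimately show ?thesis by (intro image_eqI) auto
  qed
  show "\<bar>blinfun_apply f b\<bar> \<le> M" if fb: "f \<in> cball 0 1" "b \<in> A ` cball 0 1" for f b
  proof -
    obtain x where x: "b = A x" "norm x \<le> 1" using fb(2) by auto
    have "\<bar>blinfun_apply f b\<bar> \<le> norm b" using fb(1) by (intro blinfun_abs_le) simp
    also have "\<dots> \<le> M * norm x" unfolding x by (rule M(2))
    also have "\<dots> \<le> M" using x(2) M(1) by simp
    finally show ?thesis .
  qed
  show "linear (\<lambda>f. blinfun_apply f y)" "linear (blinfun_apply f)" for f :: "'b \<Rightarrow>\<^sub>L real" and y
    by (rule blinfun_linear_left, rule blinfun_linear_right)
qed (use M weakly_compact_dual_ball in auto)

lemma norm_closure_image_ball:
  assumes M: "M > 0" "\<And>x. norm (A x) \<le> M * norm x" and y: "y \<in> closure (A ` cball 0 1)"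
  shows "norm y \<le> M"
proof -
  have "closure (A ` cball 0 1) \<subseteq> cball 0 M"
  proof (rule closure_minimal)
    have "norm (A x) \<le> M" if "norm x \<le> 1" for x
      using M(2)[of x] mult_left_mono[OF that, of M] M(1) by linarith
    then show "A ` cball 0 1 \<subseteq> cball 0 M" by auto
  qed simp
  then show ?thesis using y by auto
qed

lemma dual_pairing_closure_image_ball:
  fixes A :: "'a::real_normed_vector \<Rightarrow> 'b::real_normed_vector"
  assumes A: "weakly_compact_operator A" and M: "M > 0" "\<And>x. norm (A x) \<le> M * norm x"
  shows "dual_pairing (\<lambda>y f. blinfun_apply f y) (closure (A ` cball 0 1)) (cball 0 1 :: ('b \<Rightarrow>\<^sub>L real) set) M"
proof (rule dual_pairing.intro)
  have bl: "bounded_linear A" using A unfolding weakly_compact_operator_def by blast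
  show "convex (closure (A ` cball 0 1))" by (intro convex_closure convex_image_ball bl)
  show "(1/2) *\<^sub>R (f - g) \<in> cball 0 1" if "f \<in> cball 0 1" "g \<in> cball 0 1" for f g :: "'b \<Rightarrow>\<^sub>L real"
    using that norm_triangle_ineq4[of f g] by simp
  show "\<bar>blinfun_apply f y\<bar> \<le> M" if "y \<in> closure (A ` cball 0 1)" "f \<in> cball 0 1" for f y
    using that(2) blinfun_abs_le[of f y] norm_closure_image_ball[OF M that(1)] by simp
  show "linear (\<lambda>y. blinfun_apply f y)" "linear (\<lambda>f. blinfun_apply f y)" for f :: "'b \<Rightarrow>\<^sub>L real" and y
    by (rule blinfun_linear_right, rule blinfun_linear_left)
qed (use M weakly_compact_closure_image_ball[OF A] in auto)

section \<open>Derivations that never vanish give the tree\<close>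

lemma (in dual_pairing) tree_parent_in_K:
  assumes tree: "separated_tree c \<kappa> base z b" and s: "s \<noteq> []"
  shows "tree_parent base z s \<in> K"
proof (cases "length s = 2 ^ floor_log (length s)")
  case True
  then show ?thesis using separated_treeD(1)[OF tree] unfolding tree_parent_def by simp
next
  case False
  have "butlast s \<noteq> []"
  proof
    assume "butlast s = []"
    then have "length s = 1" using s by (metis One_nat_def append_butlast_last_id append_Nil length_Cons list.size(3))
    then show False using False by simp
  qed
  then show ?thesis using False separated_treeD(2)[OF tree] unfolding tree_parent_def by simp
qed

lemma sum_prefixes_edge:
  fixes a :: "nat list \<Rightarrow> 'a::real_normed_vector"
  shows "(\<Sum>i\<in>{1..length (s @ [n])}. a (take i (s @ [n]))) - (\<Sum>i\<in>{1..length s}. a (take i s)) = a (s @ [n])"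
proof -
  have "(\<Sum>i\<in>{1..length (s @ [n])}. a (take i (s @ [n]))) = (\<Sum>i\<in>{1..length s}. a (take i (s @ [n]))) + a (s @ [n])"
    by simp
  also have "(\<Sum>i\<in>{1..length s}. a (take i (s @ [n]))) = (\<Sum>i\<in>{1..length s}. a (take i s))"
    by (intro sum.cong) auto
  finally show ?thesis by simp
qed

text \<open>Here increments are functionals and norming elements are images \<open>A (a s)\<close> of the unit ball. The embedding
sums the elements \<open>a\<close> along branches. It is tested against the sum of all increments in one dyadic block, which
telescopes to a difference of two elements of the dual unit ball and so has norm at most 2.\<close>

theorem tree_factors_through_of_dual_tree:
  fixes A :: "'a::real_normed_vector \<Rightarrow> 'b::real_normed_vector"
  assumes A: "bounded_linear A" and M: "M > 0" "\<And>x. norm (A x) \<le> M * norm x" and c: "c > 0"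
    and tree: "dual_pairing.separated_tree blinfun_apply (cball 0 1 :: ('b \<Rightarrow>\<^sub>L real) set) (A ` cball 0 1) c (c/4) base z b"
  shows "tree_factors_through A"
proof -
  interpret A: bounded_linear A by fact
  interpret D: dual_pairing blinfun_apply "cball 0 1 :: ('b \<Rightarrow>\<^sub>L real) set" "A ` cball 0 1" M
    by (rule dual_pairing_dual_ball[OF A M])
  have "\<exists>x. s \<noteq> [] \<longrightarrow> b s = A x \<and> norm x \<le> 1" for s
  proof (cases "s = []")
    case False
    then obtain x where "x \<in> cball 0 1" "b s = A x" using D.separated_treeD(3)[OF tree, of s] by blast
    then show ?thesis by (intro exI[of _ x]) simp
  qed simp
  then obtain a where a: "\<And>s. s \<noteq> [] \<Longrightarrow> b s = A (a s) \<and> norm (a s) \<le> 1" by metis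
  define \<phi> where "\<phi> s = (\<Sum>i\<in>{1..length s}. a (take i s))" for s
  have A\<phi>: "A (\<phi> s) = (\<Sum>i\<in>{1..length s}. b (take i s))" for s
    unfolding \<phi>_def A.sum
  proof (rule sum.cong)
    fix i assume "i \<in> {1..length s}"
    then have "take i s \<noteq> []" by (cases s) auto
    then show "A (a (take i s)) = b (take i s)" using a by simp
  qed simp
  show ?thesis
  proof (rule tree_factors_throughI[OF A])
    show "c / 16 > 0" using c by simp
    show "norm (\<phi> (s @ [n]) - \<phi> s) \<le> 1" for s n
      unfolding \<phi>_def sum_prefixes_edge using a by simp
    fix s t :: "nat list" assume st: "s \<noteq> t" "length t \<le> length s"
    define p where "p = length (longest_common_prefix s t)"
    have p: "p < length s" unfolding p_def by (rule lcp_less[OF st])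
    obtain l r k where lr: "p \<le> l" "l < r" "r \<le> length s" "\<And>j. l < j \<Longrightarrow> j \<le> r \<Longrightarrow> floor_log j = k"
      "length s - p \<le> 4 * (r - l)" using dyadic_block_in_interval[OF p] by blast
    define f where "f = (\<Sum>q\<in>{l<..r}. increment base z (take q s))"
    have f: "f = z (take r s) - tree_parent base z (take (Suc l) s)"
      unfolding f_def by (rule sum_increments[OF lr(2-4)])
    have ne: "take r s \<noteq> []" "take (Suc l) s \<noteq> []" using lr by (cases s; auto)+
    have "norm f \<le> norm (z (take r s)) + norm (tree_parent base z (take (Suc l) s))"
      unfolding f by (rule norm_triangle_ineq4)
    also have "\<dots> \<le> 2"
      using D.separated_treeD(2)[OF tree ne(1)] D.tree_parent_in_K[OF tree ne(2)] by simp
    finally have nf: "norm f \<le> 2" .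
    have "(\<Sum>q\<in>{l<..r}. c / 2) \<le> (\<Sum>q\<in>{l<..r}. blinfun_apply (increment base z (take q s)) (A (\<phi> s)) -
        blinfun_apply (increment base z (take q s)) (A (\<phi> t)))"
    proof (rule sum_mono)
      fix q assume q: "q \<in> {l<..r}"
      have "c - 2 * (c / 4) \<le> (\<Sum>i\<in>{1..length s}. blinfun_apply (increment base z (take q s)) (b (take i s))) -
         (\<Sum>i\<in>{1..length t}. blinfun_apply (increment base z (take q s)) (b (take i t)))"
        by (rule D.tree_increment_sum[OF tree]) (use c q lr in \<open>auto simp: p_def\<close>)
      then show "c / 2 \<le> blinfun_apply (increment base z (take q s)) (A (\<phi> s)) -
          blinfun_apply (increment base z (take q s)) (A (\<phi> t))"
        unfolding A\<phi> blinfun.sum_right by simp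
    qed
    also have "\<dots> = blinfun_apply f (A (\<phi> s) - A (\<phi> t))"
      unfolding f_def blinfun.sum_left blinfun.diff_right sum_subtractf ..
    also have "\<dots> \<le> norm f * norm (A (\<phi> s) - A (\<phi> t))" using norm_blinfun[of f "A (\<phi> s) - A (\<phi> t)"] by simp
    also have "\<dots> \<le> 2 * norm (A (\<phi> s) - A (\<phi> t))" using nf by (intro mult_right_mono) auto
    finally have "real (r - l) * (c / 2) \<le> 2 * norm (A (\<phi> s) - A (\<phi> t))" by simp
    moreover have "(real (length s) - real p) * (c / 8) \<le> real (r - l) * (c / 2)"
    proof -
      have "real (length s) - real p \<le> 4 * real (r - l)" using lr(5) p by linarith
      from mult_right_mono[OF this, of "c / 8"] show ?thesis using c by simp
    qed
    ultimately show "c / 16 * (real (length s) - real (length (longest_common_prefix s t))) \<le> norm (A (\<phi> s) - A (\<phi> t))"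
      unfolding p_def by (simp add: mult.commute)
  qed
qed

text \<open>Here the increments are points of \<open>Y\<close> and the norming elements are functionals. The map \<open>\<Phi>\<close> sums along branches the
points of the tree, measured from the starting points of their blocks, so that its edges stay in \<open>K - K\<close>. Each edge is approximated by the image of an
element of \<open>X\<close> of norm at most 2 with geometrically decreasing errors; this lifts \<open>\<Phi>\<close> to \<open>X\<close>.\<close>

theorem tree_factors_through_of_range_tree:
  fixes A :: "'a::real_normed_vector \<Rightarrow> 'b::real_normed_vector"
  assumes A: "weakly_compact_operator A" and M: "M > 0" "\<And>x. norm (A x) \<le> M * norm x" and c: "c > 0"
    and tree: "dual_pairing.separated_tree (\<lambda>y f. blinfun_apply f y) (closure (A ` cball 0 1)) (cball 0 1 :: ('b \<Rightarrow>\<^sub>L real) set) c (c/8) base z b"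
  shows "tree_factors_through A"
proof -
  have bl: "bounded_linear A" using A unfolding weakly_compact_operator_def by blast
  interpret A: bounded_linear A by fact
  let ?K = "closure (A ` cball 0 1)"
  interpret D: dual_pairing "\<lambda>y f. blinfun_apply f y" ?K "cball 0 1 :: ('b \<Rightarrow>\<^sub>L real) set" M
    by (rule dual_pairing_closure_image_ball[OF A M])
  have approx: "\<exists>x. norm x \<le> 2 \<and> norm (A x - (y1 - y2)) \<le> \<tau>" if yt: "y1 \<in> ?K" "y2 \<in> ?K" "\<tau> > 0" for y1 y2 \<tau>
  proof -
    have near: "\<exists>x. norm x \<le> 1 \<and> dist (A x) y < \<tau> / 2" if "y \<in> ?K" for y
      using that[unfolded closure_approachable, rule_format, OF half_gt_zero[OF yt(3)]] by auto
    obtain x1 x2 where x: "norm x1 \<le> 1" "dist (A x1) y1 < \<tau> / 2" "norm x2 \<le> 1" "dist (A x2) y2 < \<tau> / 2"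
      using near[OF yt(1)] near[OF yt(2)] by blast
    have "norm (A (x1 - x2) - (y1 - y2)) \<le> norm (A x1 - y1) + norm (A x2 - y2)"
      using norm_triangle_ineq4[of "A x1 - y1" "A x2 - y2"] by (simp add: A.diff algebra_simps)
    then have "norm (A (x1 - x2) - (y1 - y2)) \<le> \<tau>" using x by (simp add: dist_norm)
    moreover have "norm (x1 - x2) \<le> 2" using norm_triangle_ineq4[of x1 x2] x by simp
    ultimately show ?thesis by blast
  qed
  define E where "E s = z s - base (floor_log (length s))" for s
  have "\<exists>x. s \<noteq> [] \<longrightarrow> norm x \<le> 2 \<and> norm (A x - E s) \<le> c / 32 * (1/2) ^ length s" for s
    using approx[of "z s" "base (floor_log (length s))" "c / 32 * (1/2) ^ length s"] c
      D.separated_treeD(1,2)[OF tree] unfolding E_def by auto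
  then obtain e where e: "\<And>s. s \<noteq> [] \<Longrightarrow> norm (e s) \<le> 2 \<and> norm (A (e s) - E s) \<le> c / 32 * (1/2) ^ length s" by metis
  define \<phi> where "\<phi> s = (\<Sum>i\<in>{1..length s}. e (take i s))" for s
  define \<Phi> where "\<Phi> s = (\<Sum>i\<in>{1..length s}. E (take i s))" for s
  have close: "norm (A (\<phi> s) - \<Phi> s) \<le> c / 32" for s
  proof -
    have "norm (A (\<phi> s) - \<Phi> s) = norm (\<Sum>i\<in>{1..length s}. A (e (take i s)) - E (take i s))"
      unfolding \<phi>_def \<Phi>_def by (simp add: A.sum sum_subtractf)
    also have "\<dots> \<le> (\<Sum>i\<in>{1..length s}. norm (A (e (take i s)) - E (take i s)))" by (rule norm_sum)
    also have "\<dots> \<le> (\<Sum>i\<in>{1..length s}. c / 32 * (1/2) ^ i)"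
    proof (rule sum_mono)
      fix i assume i: "i \<in> {1..length s}"
      then have "take i s \<noteq> []" "length (take i s) = i" by auto
      then show "norm (A (e (take i s)) - E (take i s)) \<le> c / 32 * (1/2) ^ i" using e[of "take i s"] by simp
    qed
    also have "\<dots> = c / 32 * (\<Sum>i\<in>{1..length s}. (1/2) ^ i)" by (simp add: sum_distrib_left)
    also have "\<dots> \<le> c / 32 * 1" using c by (intro mult_left_mono sum_half_powers_le) auto
    finally show ?thesis by simp
  qed
  show ?thesis
  proof (rule tree_factors_throughI[OF bl])
    show "c / 16 > 0" using c by simp
    show "norm (\<phi> (s @ [n]) - \<phi> s) \<le> 2" for s n
      unfolding \<phi>_def sum_prefixes_edge using e by simp
    fix s t :: "nat list" assume st: "s \<noteq> t" "length t \<le> length s"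
    define p where "p = length (longest_common_prefix s t)"
    have p: "p < length s" unfolding p_def by (rule lcp_less[OF st])
    obtain l r k where lr: "p \<le> l" "l < r" "r \<le> length s" "\<And>j. l < j \<Longrightarrow> j \<le> r \<Longrightarrow> floor_log j = k"
      "length s - p \<le> 4 * (r - l)" using dyadic_block_in_interval[OF p] by blast
    define f where "f = b (take (Suc l) s)"
    have "take (Suc l) s \<noteq> []" using lr by (cases s; auto)
    then have nf: "norm f \<le> 1" using D.separated_treeD(3)[OF tree] unfolding f_def by simp
    have \<Phi>: "blinfun_apply f (\<Phi> u) = (\<Sum>i\<in>{1..length u}. blinfun_apply f (z (take i u) - base (floor_log i)))" for u
      unfolding \<Phi>_def E_def blinfun.sum_right by (rule sum.cong) (auto simp: min_absorb2)
    have "c * real (r - l) - 4 * (c / 8) \<le> blinfun_apply f (\<Phi> s) - blinfun_apply f (\<Phi> t)"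
      unfolding \<Phi> unfolding f_def by (rule D.tree_summed_partial_sums[OF tree]) (use c lr in \<open>auto simp: p_def\<close>)
    also have "\<dots> = blinfun_apply f (\<Phi> s - \<Phi> t)" by (simp add: blinfun.diff_right)
    also have "\<dots> \<le> norm (\<Phi> s - \<Phi> t)" using blinfun_abs_le[OF nf, of "\<Phi> s - \<Phi> t"] by simp
    also have "\<dots> \<le> norm (A (\<phi> s) - A (\<phi> t)) + c / 16"
    proof -
      have "\<Phi> s - \<Phi> t = (A (\<phi> s) - A (\<phi> t)) - (A (\<phi> s) - \<Phi> s) + (A (\<phi> t) - \<Phi> t)" by simp
      then have "norm (\<Phi> s - \<Phi> t) \<le> norm ((A (\<phi> s) - A (\<phi> t)) - (A (\<phi> s) - \<Phi> s)) + norm (A (\<phi> t) - \<Phi> t)"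
        by (metis norm_triangle_ineq)
      then show ?thesis using close[of s] close[of t] norm_triangle_ineq4[of "A (\<phi> s) - A (\<phi> t)" "A (\<phi> s) - \<Phi> s"] by simp
    qed
    finally have 1: "c * real (r - l) - c / 2 - c / 16 \<le> norm (A (\<phi> s) - A (\<phi> t))" by simp
    have "c * 1 \<le> c * real (r - l)" using c lr(2) by (intro mult_left_mono) auto
    moreover have "(real (length s) - real p) * (c / 16) \<le> c * real (r - l) / 4"
    proof -
      have "real (length s) - real p \<le> 4 * real (r - l)" using lr(5) p by linarith
      from mult_right_mono[OF this, of "c / 16"] show ?thesis using c by (simp add: mult.commute)
    qed
    ultimately have "(real (length s) - real p) * (c / 16) \<le> c * real (r - l) - c / 2 - c / 16" using c by linarith
    then show "c / 16 * (real (length s) - real (length (longest_common_prefix s t))) \<le> norm (A (\<phi> s) - A (\<phi> t))"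
      using 1 unfolding p_def by (simp add: mult.commute)
  qed
qed

section \<open>A convex function with both asymptotic properties\<close>

text \<open>The functions \<open>g\<close> and \<open>h\<close> stand for the envelopes on \<open>K\<close> and on the dual unit ball. The constants are chosen in
the order \<open>\<epsilon>\<close>, \<open>\<delta>\<close>, \<open>t\<close>, \<open>\<eta>\<close>, \<open>\<gamma>\<close>, \<open>\<theta>\<close>: the weight \<open>t\<close> makes near-optimal decompositions in the infimal convolution
\<open>\<epsilon>\<close>-close, \<open>\<eta>\<close> is so small that the smoothness error \<open>6 * t * \<eta>\<close> stays below the gain \<open>\<delta>\<close>, and \<open>\<theta>\<close> keeps the
perturbation of the norm within \<open>\<epsilon> / 4\<close>.\<close>

locale renorming_data =
  fixes A :: "'a::real_normed_vector \<Rightarrow> 'b::real_normed_vector" and K :: "'b set" and M :: real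
    and g :: "'b \<Rightarrow> real" and R \<epsilon> \<delta> t :: real
    and h :: "('b \<Rightarrow>\<^sub>L real) \<Rightarrow> real" and S \<eta> \<gamma> \<theta> :: real
  assumes A: "bounded_linear A" and M_pos: "M > 0" and M: "\<And>x. norm (A x) \<le> M * norm x"
    and K_convex: "convex K" and K_compact: "weakly_compact_set (\<lambda>y f. blinfun_apply f y) K"
    and AK: "\<And>x. norm x \<le> 1 \<Longrightarrow> A x \<in> K"
    and g_range: "\<And>v. v \<in> K \<Longrightarrow> 0 \<le> g v \<and> g v \<le> R"
    and g_concave: "\<And>v w a b. v \<in> K \<Longrightarrow> w \<in> K \<Longrightarrow> a \<ge> 0 \<Longrightarrow> b \<ge> 0 \<Longrightarrow> a + b = 1 \<Longrightarrow>
        a * g v + b * g w \<le> g (a *\<^sub>R v + b *\<^sub>R w)"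
    and g_drop: "\<And>v \<kappa>. v \<in> K \<Longrightarrow> \<kappa> > 0 \<Longrightarrow> \<exists>G \<tau>. finite G \<and> \<tau> > 0 \<and>
        (\<forall>v'\<in>K. v' \<in> weak_nbhd (\<lambda>y f. blinfun_apply f y) G \<tau> v \<longrightarrow>
           g v' \<le> g v + \<kappa> \<and> (norm (v' - v) > 4 * \<epsilon> \<longrightarrow> g v' \<le> g v - \<delta> + \<kappa>))"
    and h_range: "\<And>f. f \<in> cball 0 1 \<Longrightarrow> 0 \<le> h f \<and> h f \<le> S"
    and h_drop: "\<And>f \<kappa>. f \<in> cball 0 1 \<Longrightarrow> \<kappa> > 0 \<Longrightarrow> \<exists>G \<tau>. finite G \<and> \<tau> > 0 \<and>
        (\<forall>f'\<in>cball 0 1. f' \<in> weak_nbhd blinfun_apply G \<tau> f \<longrightarrow>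
           h f' \<le> h f + \<kappa> \<and> ((\<exists>x. norm x \<le> 1 \<and> blinfun_apply (f' - f) (A x) > 4 * \<eta>) \<longrightarrow> h f' \<le> h f - \<gamma> + \<kappa>))"
    and eps: "\<epsilon> > 0" and delta: "\<delta> > 0" and eta: "\<eta> > 0" and gamma: "\<gamma> > 0" and theta: "\<theta> > 0" and t_pos: "t > 0"
    and theta_S: "\<theta> * S \<le> \<epsilon> / 4" and t_R: "R + 1 \<le> t * \<epsilon> / 4" and t_eta: "48 * t * \<eta> \<le> \<delta>"
begin

abbreviation "ball_dual \<equiv> (cball 0 1 :: ('b \<Rightarrow>\<^sub>L real) set)"

text \<open>The conjugate of \<open>- \<theta> * h\<close>, where \<open>h\<close> lives on the dual unit ball. It differs from the norm by at most \<open>\<theta> * S\<close>, and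
need not be homogeneous.\<close>

definition smooth_norm :: "'b \<Rightarrow> real" where
  "smooth_norm y = (SUP f\<in>ball_dual. blinfun_apply f y + \<theta> * h f)"

definition inf_convolution :: "'b \<Rightarrow> real" where
  "inf_convolution y = (INF v\<in>K. t * smooth_norm (y - v) - g v)"

lemma dual_ball_le: "f \<in> ball_dual \<Longrightarrow> blinfun_apply f y \<le> norm y"
  using blinfun_abs_le[of f y] by simp

lemma smooth_term_le: "f \<in> ball_dual \<Longrightarrow> blinfun_apply f y + \<theta> * h f \<le> norm y + \<theta> * S"
  using h_range[of f] theta by (intro add_mono dual_ball_le mult_left_mono) auto

lemma bdd_smooth: "bdd_above ((\<lambda>f. blinfun_apply f y + \<theta> * h f) ` ball_dual)"
  using smooth_term_le by (intro bdd_aboveI2) blast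

lemma smooth_ge: "f \<in> ball_dual \<Longrightarrow> blinfun_apply f y + \<theta> * h f \<le> smooth_norm y"
  unfolding smooth_norm_def by (rule cSUP_upper[OF _ bdd_smooth])

lemma smooth_leI: "(\<And>f. f \<in> ball_dual \<Longrightarrow> blinfun_apply f y + \<theta> * h f \<le> c) \<Longrightarrow> smooth_norm y \<le> c"
  unfolding smooth_norm_def by (rule cSUP_least) auto

lemma smooth_near:
  assumes "e > 0" obtains f where "f \<in> ball_dual" "smooth_norm y - e < blinfun_apply f y + \<theta> * h f"
proof -
  have "\<exists>f\<in>ball_dual. smooth_norm y - e < blinfun_apply f y + \<theta> * h f"
    using assms less_cSUP_iff[OF _ bdd_smooth[of y], of "smooth_norm y - e"] unfolding smooth_norm_def by force
  then show thesis using that by blast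
qed

lemma smooth_lower: "norm y \<le> smooth_norm y"
proof -
  obtain f where f: "norm f \<le> 1" "blinfun_apply f y = norm y" by (rule norming_functional)
  have "norm y \<le> blinfun_apply f y + \<theta> * h f" using f theta h_range[of f] by simp
  also have "\<dots> \<le> smooth_norm y" by (rule smooth_ge) (use f in simp)
  finally show ?thesis .
qed

lemma smooth_upper: "smooth_norm y \<le> norm y + \<theta> * S"
  by (rule smooth_leI) (rule smooth_term_le)

lemma smooth_convex:
  assumes "a \<ge> 0" "b \<ge> 0" "a + b = 1"
  shows "smooth_norm (a *\<^sub>R x + b *\<^sub>R y) \<le> a * smooth_norm x + b * smooth_norm y"
proof (rule smooth_leI)
  fix f assume f: "f \<in> ball_dual"
  have "a * (blinfun_apply f x + \<theta> * h f) + b * (blinfun_apply f y + \<theta> * h f) \<le> a * smooth_norm x + b * smooth_norm y"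
    using assms smooth_ge[OF f] by (intro add_mono mult_left_mono) auto
  moreover have "a * (\<theta> * h f) + b * (\<theta> * h f) = \<theta> * h f" using assms(3) by (metis distrib_right mult_1)
  ultimately show "blinfun_apply f (a *\<^sub>R x + b *\<^sub>R y) + \<theta> * h f \<le> a * smooth_norm x + b * smooth_norm y"
    by (simp add: blinfun.bilinear_simps distrib_left)
qed

lemma smooth_lipschitz: "smooth_norm x \<le> smooth_norm y + norm (x - y)"
proof (rule smooth_leI)
  fix f assume f: "f \<in> ball_dual"
  show "blinfun_apply f x + \<theta> * h f \<le> smooth_norm y + norm (x - y)"
    using smooth_ge[OF f, of y] dual_ball_le[OF f, of "x - y"] by (simp add: blinfun.bilinear_simps)
qed

lemma inf_convolution_term_ge: "v \<in> K \<Longrightarrow> - R \<le> t * smooth_norm (y - v) - g v"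
  using g_range[of v] mult_nonneg_nonneg[of t "smooth_norm (y - v)"] t_pos order_trans[OF norm_ge_zero smooth_lower, of "y - v"]
  by linarith

lemma bdd_inf_convolution: "bdd_below ((\<lambda>v. t * smooth_norm (y - v) - g v) ` K)"
  using inf_convolution_term_ge by (intro bdd_belowI2) blast

lemma K_nonempty: "K \<noteq> {}" using AK[of 0] by auto

lemma inf_convolution_le: "v \<in> K \<Longrightarrow> inf_convolution y \<le> t * smooth_norm (y - v) - g v"
  unfolding inf_convolution_def by (rule cINF_lower[OF bdd_inf_convolution])

lemma inf_convolution_near:
  assumes "e > 0" obtains v where "v \<in> K" "t * smooth_norm (y - v) - g v < inf_convolution y + e"
proof -
  have "\<exists>v\<in>K. t * smooth_norm (y - v) - g v < inf_convolution y + e"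
    using assms cINF_less_iff[OF K_nonempty bdd_inf_convolution[of y], of "inf_convolution y + e"] unfolding inf_convolution_def by force
  then show thesis using that by blast
qed

lemma inf_convolution_convex:
  assumes ab: "a \<ge> 0" "b \<ge> 0" "a + b = 1"
  shows "inf_convolution (a *\<^sub>R x + b *\<^sub>R y) \<le> a * inf_convolution x + b * inf_convolution y"
proof (rule field_le_epsilon)
  fix e :: real assume e: "e > 0"
  obtain v where v: "v \<in> K" "t * smooth_norm (x - v) - g v < inf_convolution x + e" by (rule inf_convolution_near[OF e])
  obtain w where w: "w \<in> K" "t * smooth_norm (y - w) - g w < inf_convolution y + e" by (rule inf_convolution_near[OF e])
  define u where "u = a *\<^sub>R v + b *\<^sub>R w"
  have u: "u \<in> K" unfolding u_def using K_convex v w ab by (simp add: convex_def)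
  have "(a *\<^sub>R x + b *\<^sub>R y) - u = a *\<^sub>R (x - v) + b *\<^sub>R (y - w)" unfolding u_def by (simp add: algebra_simps)
  then have "t * smooth_norm ((a *\<^sub>R x + b *\<^sub>R y) - u) \<le> t * (a * smooth_norm (x - v) + b * smooth_norm (y - w))"
    using smooth_convex[OF ab, of "x - v" "y - w"] t_pos by simp
  moreover have "a * g v + b * g w \<le> g u" unfolding u_def by (rule g_concave[OF v(1) w(1) ab])
  moreover have "a * (t * smooth_norm (x - v) - g v) + b * (t * smooth_norm (y - w) - g w) \<le> a * (inf_convolution x + e) + b * (inf_convolution y + e)"
    using v w ab by (intro add_mono mult_left_mono) auto
  moreover have "a * e + b * e = e" using ab(3) by (metis distrib_right mult_1)
  ultimately show "inf_convolution (a *\<^sub>R x + b *\<^sub>R y) \<le> a * inf_convolution x + b * inf_convolution y + e"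
    using inf_convolution_le[OF u, of "a *\<^sub>R x + b *\<^sub>R y"] by (simp add: algebra_simps)
qed

lemma inf_convolution_lipschitz: "inf_convolution x \<le> inf_convolution y + t * norm (x - y)"
proof (rule field_le_epsilon)
  fix e :: real assume e: "e > 0"
  obtain v where v: "v \<in> K" "t * smooth_norm (y - v) - g v < inf_convolution y + e" by (rule inf_convolution_near[OF e])
  have "t * smooth_norm (x - v) \<le> t * (smooth_norm (y - v) + norm (x - y))"
    using smooth_lipschitz[of "x - v" "y - v"] t_pos by simp
  then show "inf_convolution x \<le> inf_convolution y + t * norm (x - y) + e"
    using inf_convolution_le[OF v(1), of x] v(2) by (simp add: distrib_left)
qed

text \<open>The functionals that compete in the supremum at the moved point are compared with finitely many centres \<open>f0\<close>. If
\<open>f\<close> is close to its centre in the seminorm, the perturbation \<open>\<mu> * (A x - z)\<close> changes its value by \<open>O(\<mu> * \<eta>)\<close>. If it is far, it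
loses \<open>\<theta> * \<gamma>\<close> through \<open>h\<close>, at least the \<open>2 * \<mu> * M\<close> that it can win.\<close>

lemma smooth_norm_smooth:
  assumes l: "0 < \<mu>" "\<mu> \<le> 1" "2 * \<mu> * M \<le> \<theta> * \<gamma>"
  obtains G \<tau> where "finite G" "\<tau> > 0"
    "\<And>x. norm x \<le> 1 \<Longrightarrow> A x \<in> weak_nbhd (\<lambda>y f. blinfun_apply f y) G \<tau> z \<Longrightarrow>
       smooth_norm (y + \<mu> *\<^sub>R (A x - z)) \<le> smooth_norm y + 6 * \<mu> * \<eta>"
proof -
  define \<kappa> where "\<kappa> = \<mu> * \<eta> / \<theta>"
  define \<tau>' where "\<tau>' = \<mu> * \<eta> / 3"
  have k: "\<kappa> > 0" "\<theta> * \<kappa> = \<mu> * \<eta>" "\<tau>' > 0" "3 * \<tau>' = \<mu> * \<eta>"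
    unfolding \<kappa>_def \<tau>'_def using l eta theta by auto
  have "\<exists>G \<tau>. finite G \<and> \<tau> > 0 \<and>
        (\<forall>f'\<in>cball 0 1. f' \<in> weak_nbhd blinfun_apply G \<tau> f \<longrightarrow>
           h f' \<le> h f + \<kappa> \<and> ((\<exists>x. norm x \<le> 1 \<and> blinfun_apply (f' - f) (A x) > 4 * \<eta>) \<longrightarrow> h f' \<le> h f - \<gamma> + \<kappa>))"
    if "f \<in> ball_dual" for f by (rule h_drop[OF that k(1)])
  then obtain G T where GT: "\<And>f. f \<in> ball_dual \<Longrightarrow> finite (G f) \<and> T f > 0 \<and>
        (\<forall>f'\<in>cball 0 1. f' \<in> weak_nbhd blinfun_apply (G f) (T f) f \<longrightarrow>
           h f' \<le> h f + \<kappa> \<and> ((\<exists>x. norm x \<le> 1 \<and> blinfun_apply (f' - f) (A x) > 4 * \<eta>) \<longrightarrow> h f' \<le> h f - \<gamma> + \<kappa>))"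
    by metis
  obtain Z where Z: "finite Z" "Z \<subseteq> ball_dual"
    "\<And>f. f \<in> ball_dual \<Longrightarrow> \<exists>f0\<in>Z. f \<in> weak_nbhd blinfun_apply (G f0 \<union> {y, z}) (min (T f0) \<tau>') f0"
    using weakly_compact_dual_ball[unfolded weakly_compact_set_def, rule_format, of "\<lambda>f. G f \<union> {y, z}" "\<lambda>f. min (T f) \<tau>'"] GT k(3)
    by auto
  show thesis
  proof (rule that[OF Z(1) k(3)])
    fix x assume x: "norm x \<le> 1" "A x \<in> weak_nbhd (\<lambda>y f. blinfun_apply f y) Z \<tau>' z"
    define w where "w = A x - z"
    show "smooth_norm (y + \<mu> *\<^sub>R (A x - z)) \<le> smooth_norm y + 6 * \<mu> * \<eta>"
    proof (rule smooth_leI)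
      fix f assume f: "f \<in> ball_dual"
      obtain f0 where f0: "f0 \<in> Z" "f \<in> weak_nbhd blinfun_apply (G f0 \<union> {y, z}) (min (T f0) \<tau>') f0" using Z(3)[OF f] by blast
      have f0b: "f0 \<in> ball_dual" using f0 Z by blast
      have near: "\<bar>blinfun_apply f y - blinfun_apply f0 y\<bar> < \<tau>'" "\<bar>blinfun_apply f z - blinfun_apply f0 z\<bar> < \<tau>'"
        using weak_nbhd_D[OF f0(2), of y] weak_nbhd_D[OF f0(2), of z] by auto
      have "f \<in> weak_nbhd blinfun_apply (G f0) (T f0) f0" using f0(2) by (auto intro: weak_nbhd_mono)
      then have drop: "h f \<le> h f0 + \<kappa>"
        "(\<exists>x. norm x \<le> 1 \<and> blinfun_apply (f - f0) (A x) > 4 * \<eta>) \<Longrightarrow> h f \<le> h f0 - \<gamma> + \<kappa>"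
        using GT[OF f0b] f by blast+
      have wz: "\<bar>blinfun_apply f0 (A x) - blinfun_apply f0 z\<bar> < \<tau>'" using weak_nbhd_D[OF x(2) f0(1)] by simp
      define d where "d = blinfun_apply f (A x) - blinfun_apply f0 (A x)"
      have fw: "blinfun_apply f w \<le> d + 2 * \<tau>'"
        unfolding w_def d_def blinfun.diff_right using near(2) wz by linarith
      then have "\<mu> * blinfun_apply f w \<le> \<mu> * (d + 2 * \<tau>')" using l(1) by (intro mult_left_mono) auto
      also have "\<dots> \<le> \<mu> * d + 2 * \<tau>'" using l(2) k(3) by (simp add: distrib_left)
      finally have 1: "blinfun_apply f (y + \<mu> *\<^sub>R w) \<le> blinfun_apply f0 y + \<mu> * d + \<mu> * \<eta>"
        using near(1) k(4) by (simp add: blinfun.bilinear_simps)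
      have "\<mu> * d + \<theta> * h f \<le> \<theta> * h f0 + 5 * (\<mu> * \<eta>)"
      proof (cases "d > 4 * \<eta>")
        case True
        then have "h f \<le> h f0 - \<gamma> + \<kappa>" using drop(2) x(1) unfolding d_def by (auto simp: blinfun.bilinear_simps)
        then have "\<theta> * h f \<le> \<theta> * (h f0 - \<gamma> + \<kappa>)" using theta by (intro mult_left_mono) auto
        then have a: "\<theta> * h f \<le> \<theta> * h f0 - \<theta> * \<gamma> + \<mu> * \<eta>" using k(2) by (simp add: algebra_simps)
        have "d \<le> 2 * M"
        proof -
          have "norm (A x) \<le> M" using M[of x] mult_left_mono[OF x(1), of M] M_pos by linarith
          then show ?thesis
            unfolding d_def using dual_ball_le[OF f, of "A x"] dual_ball_le[of "- f0" "A x"] f0b by (simp add: blinfun.bilinear_simps)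
        qed
        then have "\<mu> * d \<le> \<mu> * (2 * M)" using l(1) by (intro mult_left_mono) auto
        moreover have "\<mu> * \<eta> > 0" using l(1) eta by simp
        moreover have "\<mu> * (2 * M) = 2 * \<mu> * M" by simp
        ultimately show ?thesis using a l(3) by linarith
      next
        case False
        then have "\<mu> * d \<le> \<mu> * (4 * \<eta>)" using l(1) by (intro mult_left_mono) auto
        moreover have "\<theta> * h f \<le> \<theta> * (h f0 + \<kappa>)" using theta drop(1) by (intro mult_left_mono) auto
        ultimately show ?thesis using k(2) by (simp add: algebra_simps)
      qed
      then show "blinfun_apply f (y + \<mu> *\<^sub>R (A x - z)) + \<theta> * h f \<le> smooth_norm y + 6 * \<mu> * \<eta>"
        using 1 smooth_ge[OF f0b, of y] unfolding w_def by (simp add: algebra_simps)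
    qed
  qed
qed

lemma inf_convolution_smooth:
  assumes l: "0 < \<mu>" "\<mu> \<le> 1" "2 * \<mu> * M \<le> \<theta> * \<gamma>"
  obtains G \<tau> where "finite G" "\<tau> > 0"
    "\<And>x. norm x \<le> 1 \<Longrightarrow> A x \<in> weak_nbhd (\<lambda>y f. blinfun_apply f y) G \<tau> z \<Longrightarrow>
       inf_convolution (y + \<mu> *\<^sub>R (A x - z)) \<le> inf_convolution y + \<mu> * \<delta> / 4"
proof -
  have "\<mu> * \<delta> / 8 > 0" using l(1) delta by simp
  then obtain v where v: "v \<in> K" "t * smooth_norm (y - v) - g v < inf_convolution y + \<mu> * \<delta> / 8" by (rule inf_convolution_near)
  obtain G \<tau> where G: "finite G" "\<tau> > 0"
    "\<And>x. norm x \<le> 1 \<Longrightarrow> A x \<in> weak_nbhd (\<lambda>y f. blinfun_apply f y) G \<tau> z \<Longrightarrow>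
       smooth_norm ((y - v) + \<mu> *\<^sub>R (A x - z)) \<le> smooth_norm (y - v) + 6 * \<mu> * \<eta>"
    by (rule smooth_norm_smooth[OF l, of z "y - v"]) blast
  show thesis
  proof (rule that[OF G(1,2)])
    fix x assume x: "norm x \<le> 1" "A x \<in> weak_nbhd (\<lambda>y f. blinfun_apply f y) G \<tau> z"
    have "t * smooth_norm ((y - v) + \<mu> *\<^sub>R (A x - z)) \<le> t * (smooth_norm (y - v) + 6 * \<mu> * \<eta>)"
      using G(3)[OF x] t_pos by simp
    moreover have "t * (6 * \<mu> * \<eta>) \<le> \<mu> * \<delta> / 8"
      using mult_left_mono[OF t_eta, of "\<mu> / 8"] l(1) by (simp add: algebra_simps)
    moreover have "inf_convolution (y + \<mu> *\<^sub>R (A x - z)) \<le> t * smooth_norm ((y - v) + \<mu> *\<^sub>R (A x - z)) - g v"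
      using inf_convolution_le[OF v(1), of "y + \<mu> *\<^sub>R (A x - z)"] by (simp add: algebra_simps)
    ultimately show "inf_convolution (y + \<mu> *\<^sub>R (A x - z)) \<le> inf_convolution y + \<mu> * \<delta> / 4"
      using v(2) by (simp add: distrib_left)
  qed
qed

text \<open>If \<open>v\<close> is near-optimal for \<open>y\<close>, then \<open>v\<close> is close to \<open>y\<close> and the corresponding centre \<open>v0\<close> is close to \<open>z\<close>. Thus \<open>v\<close> is far
from \<open>v0\<close> when \<open>y\<close> is far from \<open>z\<close>, and the drop of \<open>g\<close> from \<open>v0\<close> to \<open>v\<close> is passed on. The functionals \<open>F v0\<close> make the first
term weakly lower semicontinuous.\<close>

lemma inf_convolution_drop:
  assumes z: "z \<in> K"
  obtains G \<tau> where "finite G" "\<tau> > 0"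
    "\<And>y. y \<in> K \<Longrightarrow> y \<in> weak_nbhd (\<lambda>y f. blinfun_apply f y) G \<tau> z \<Longrightarrow> norm (y - z) > 8 * \<epsilon> \<Longrightarrow>
       inf_convolution z + 3 * \<delta> / 4 \<le> inf_convolution y"
proof -
  define \<kappa> where "\<kappa> = min (\<delta> / 4) 1"
  define \<nu> where "\<nu> = min (\<kappa> / (8 * t)) (\<epsilon> / 6)"
  have k: "\<kappa> > 0" "\<kappa> \<le> \<delta> / 4" "\<kappa> \<le> 1" unfolding \<kappa>_def using delta by auto
  have n: "\<nu> > 0" "\<nu> \<le> \<epsilon> / 6" "3 * t * \<nu> \<le> \<kappa> / 2"
  proof -
    show "\<nu> > 0" "\<nu> \<le> \<epsilon> / 6" unfolding \<nu>_def using k eps t_pos by auto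
    have "\<nu> \<le> \<kappa> / (8 * t)" unfolding \<nu>_def by simp
    then have "8 * t * \<nu> \<le> \<kappa>" using t_pos by (simp add: field_simps)
    moreover have "t * \<nu> > 0" using t_pos \<open>\<nu> > 0\<close> by simp
    ultimately show "3 * t * \<nu> \<le> \<kappa> / 2" by linarith
  qed
  have "\<exists>G \<tau> f. finite G \<and> \<tau> > 0 \<and>
        (\<forall>v'\<in>K. v' \<in> weak_nbhd (\<lambda>y f. blinfun_apply f y) G \<tau> v \<longrightarrow>
           g v' \<le> g v + \<kappa> / 4 \<and> (norm (v' - v) > 4 * \<epsilon> \<longrightarrow> g v' \<le> g v - \<delta> + \<kappa> / 4)) \<and>
        f \<in> ball_dual \<and> smooth_norm (z - v) - \<nu> < blinfun_apply f (z - v) + \<theta> * h f" if v: "v \<in> K" for v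
  proof -
    obtain f where "f \<in> ball_dual \<and> smooth_norm (z - v) - \<nu> < blinfun_apply f (z - v) + \<theta> * h f"
      using smooth_near[OF n(1), of "z - v"] by blast
    moreover have "\<kappa> / 4 > 0" using k(1) by simp
    ultimately show ?thesis using g_drop[OF v, of "\<kappa> / 4"] by blast
  qed
  then obtain G T F where GT: "\<And>v. v \<in> K \<Longrightarrow> finite (G v) \<and> T v > 0 \<and>
        (\<forall>v'\<in>K. v' \<in> weak_nbhd (\<lambda>y f. blinfun_apply f y) (G v) (T v) v \<longrightarrow>
           g v' \<le> g v + \<kappa> / 4 \<and> (norm (v' - v) > 4 * \<epsilon> \<longrightarrow> g v' \<le> g v - \<delta> + \<kappa> / 4)) \<and>
        F v \<in> ball_dual \<and> smooth_norm (z - v) - \<nu> < blinfun_apply (F v) (z - v) + \<theta> * h (F v)" by metis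
  obtain Z where Z: "finite Z" "Z \<subseteq> K"
    "\<And>v. v \<in> K \<Longrightarrow> \<exists>v0\<in>Z. v \<in> weak_nbhd (\<lambda>y f. blinfun_apply f y) (G v0 \<union> {F v0}) (min (T v0) \<nu>) v0"
    using K_compact[unfolded weakly_compact_set_def, rule_format, of "\<lambda>v. G v \<union> {F v}" "\<lambda>v. min (T v) \<nu>"] GT n(1)
    by auto
  show thesis
  proof (rule that[of "F ` Z" \<nu>])
    fix y assume y: "y \<in> K" "y \<in> weak_nbhd (\<lambda>y f. blinfun_apply f y) (F ` Z) \<nu> z" and far: "norm (y - z) > 8 * \<epsilon>"
    have "\<kappa> / 4 > 0" using k(1) by simp
    then obtain v where v: "v \<in> K" "t * smooth_norm (y - v) - g v < inf_convolution y + \<kappa> / 4" by (rule inf_convolution_near)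
    obtain v0 where v0: "v0 \<in> Z" "v \<in> weak_nbhd (\<lambda>y f. blinfun_apply f y) (G v0 \<union> {F v0}) (min (T v0) \<nu>) v0"
      using Z(3)[OF v(1)] by blast
    have v0K: "v0 \<in> K" using v0 Z by blast
    have Fb: "F v0 \<in> ball_dual" "smooth_norm (z - v0) - \<nu> < blinfun_apply (F v0) (z - v0) + \<theta> * h (F v0)"
      using GT[OF v0K] by blast+
    have "v \<in> weak_nbhd (\<lambda>y f. blinfun_apply f y) (G v0) (T v0) v0" using v0(2) by (auto intro: weak_nbhd_mono)
    then have drop: "norm (v - v0) > 4 * \<epsilon> \<Longrightarrow> g v \<le> g v0 - \<delta> + \<kappa> / 4" using GT[OF v0K] v(1) by blast
    have nr: "\<bar>blinfun_apply (F v0) v - blinfun_apply (F v0) v0\<bar> < \<nu>" "\<bar>blinfun_apply (F v0) y - blinfun_apply (F v0) z\<bar> < \<nu>"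
      using weak_nbhd_D[OF v0(2), of "F v0"] weak_nbhd_D[OF y(2), of "F v0"] v0(1) by auto
    have sm: "smooth_norm (z - v0) \<le> smooth_norm (y - v) + 3 * \<nu>"
      using smooth_ge[OF Fb(1), of "y - v"] Fb(2) nr unfolding blinfun.diff_right by linarith
    \<comment> \<open>Comparison with the trivial decomposition \<open>v = y\<close> shows that near-optimal points are close to \<open>y\<close>.\<close>
    have "inf_convolution y \<le> t * smooth_norm (y - y) - g y" by (rule inf_convolution_le[OF y(1)])
    also have "\<dots> \<le> t * (\<epsilon> / 4)"
    proof -
      have "smooth_norm 0 \<le> \<epsilon> / 4" using smooth_upper[of 0] theta_S by simp
      then have "t * smooth_norm 0 \<le> t * (\<epsilon> / 4)" using t_pos by (intro mult_left_mono) auto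
      then show ?thesis using g_range[OF y(1)] by simp
    qed
    finally have "t * smooth_norm (y - v) \<le> t * (\<epsilon> / 4) + (R + 1)" using v(2) g_range[OF v(1)] k(3) by linarith
    then have "t * smooth_norm (y - v) \<le> t * (\<epsilon> / 2)" using t_R by linarith
    then have yv: "smooth_norm (y - v) \<le> \<epsilon> / 2" using t_pos by simp
    have "norm (y - v) \<le> \<epsilon> / 2" using yv smooth_lower[of "y - v"] by linarith
    moreover have "norm (z - v0) \<le> \<epsilon>" using sm yv n(2) smooth_lower[of "z - v0"] by linarith
    moreover have "norm (y - z) \<le> norm (y - v) + norm (v - v0) + norm (z - v0)"
    proof -
      have "y - z = (y - v) + (v - v0) - (z - v0)" by simp
      then show ?thesis by (metis add_right_mono norm_triangle_ineq norm_triangle_ineq4 order_trans)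
    qed
    ultimately have "norm (v - v0) > 4 * \<epsilon>" using far eps by linarith
    then have gv: "g v \<le> g v0 - \<delta> + \<kappa> / 4" by (rule drop)
    have "t * smooth_norm (z - v0) \<le> t * (smooth_norm (y - v) + 3 * \<nu>)" using sm t_pos by simp
    then have "t * smooth_norm (z - v0) \<le> t * smooth_norm (y - v) + \<kappa> / 2" using n(3) by (simp add: algebra_simps)
    then show "inf_convolution z + 3 * \<delta> / 4 \<le> inf_convolution y"
      using inf_convolution_le[OF v0K, of z] gv v(2) k(2) by linarith
  qed (use Z(1) n(1) in auto)
qed

text \<open>Let \<open>z\<close> be a weak cluster point of the sequence \<open>A (u n)\<close>, and move from \<open>A x\<close> towards \<open>y = A (u n)\<close> by a small fraction \<open>\<mu>\<close>.
By smoothness the value there is almost the one of moving towards \<open>z\<close>, and the value at \<open>z\<close> is smaller than the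
value at \<open>y\<close> by at least \<open>3 * \<delta> / 4\<close>. Convexity carries the gain, of order \<open>\<mu> * \<delta>\<close>, on to the midpoint.\<close>

theorem inf_convolution_midpoint_gain:
  obtains \<beta> where "\<beta> > 0"
    "\<And>x u. norm x \<le> 1 \<Longrightarrow> (\<And>n::nat. norm (u n) \<le> 1) \<Longrightarrow> (\<And>m n. m \<noteq> n \<Longrightarrow> norm (A (u m) - A (u n)) \<ge> 32 * \<epsilon>) \<Longrightarrow>
       \<exists>n. inf_convolution ((1/2) *\<^sub>R (A x + A (u n))) \<le> inf_convolution (A x) / 2 + inf_convolution (A (u n)) / 2 - \<beta>"
proof -
  define \<mu> where "\<mu> = min (1/2) (\<theta> * \<gamma> / (2 * M))"
  have l: "0 < \<mu>" "\<mu> \<le> 1/2" "2 * \<mu> * M \<le> \<theta> * \<gamma>"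
  proof -
    show "0 < \<mu>" "\<mu> \<le> 1/2" unfolding \<mu>_def using theta gamma M_pos by auto
    have "\<mu> \<le> \<theta> * \<gamma> / (2 * M)" unfolding \<mu>_def by simp
    then show "2 * \<mu> * M \<le> \<theta> * \<gamma>" using M_pos by (simp add: field_simps)
  qed
  show thesis
  proof (rule that[of "\<mu> * \<delta> / 4"])
    show "\<mu> * \<delta> / 4 > 0" using l delta by simp
    fix x :: 'a and u :: "nat \<Rightarrow> 'a"
    assume x: "norm x \<le> 1" and u: "\<And>n. norm (u n) \<le> 1" and sep: "\<And>m n. m \<noteq> n \<Longrightarrow> norm (A (u m) - A (u n)) \<ge> 32 * \<epsilon>"
    obtain z where z: "z \<in> K" "\<And>G \<tau>. finite G \<Longrightarrow> \<tau> > 0 \<Longrightarrow> infinite {n. A (u n) \<in> weak_nbhd (\<lambda>y f. blinfun_apply f y) G \<tau> z}"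
      by (rule weak_cluster_point[OF K_compact, of "\<lambda>n. A (u n)"]) (use AK[OF u] in auto)
    define q where "q = (1 - \<mu>) *\<^sub>R A x + \<mu> *\<^sub>R z"
    have "\<mu> \<le> 1" using l by simp
    obtain G1 \<tau>1 where 1: "finite G1" "\<tau>1 > 0"
      "\<And>x. norm x \<le> 1 \<Longrightarrow> A x \<in> weak_nbhd (\<lambda>y f. blinfun_apply f y) G1 \<tau>1 z \<Longrightarrow>
         inf_convolution (q + \<mu> *\<^sub>R (A x - z)) \<le> inf_convolution q + \<mu> * \<delta> / 4"
      by (rule inf_convolution_smooth[OF l(1) \<open>\<mu> \<le> 1\<close> l(3), of z q]) blast
    obtain G2 \<tau>2 where 2: "finite G2" "\<tau>2 > 0"
      "\<And>y. y \<in> K \<Longrightarrow> y \<in> weak_nbhd (\<lambda>y f. blinfun_apply f y) G2 \<tau>2 z \<Longrightarrow> norm (y - z) > 8 * \<epsilon> \<Longrightarrow>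
         inf_convolution z + 3 * \<delta> / 4 \<le> inf_convolution y"
      by (rule inf_convolution_drop[OF z(1)]) blast
    define N where "N = {n. A (u n) \<in> weak_nbhd (\<lambda>y f. blinfun_apply f y) (G1 \<union> G2) (min \<tau>1 \<tau>2) z}"
    have "infinite N" unfolding N_def by (rule z(2)) (use 1 2 in auto)
    moreover have "{n. norm (A (u n) - z) \<le> 8 * \<epsilon>} \<subseteq> {SOME n. norm (A (u n) - z) \<le> 8 * \<epsilon>}"
    proof -
      have "m = n" if "norm (A (u m) - z) \<le> 8 * \<epsilon>" "norm (A (u n) - z) \<le> 8 * \<epsilon>" for m n
      proof (rule ccontr)
        assume "m \<noteq> n"
        have "norm (A (u m) - A (u n)) \<le> norm (A (u m) - z) + norm (A (u n) - z)"
          using norm_triangle_ineq4[of "A (u m) - z" "A (u n) - z"] by simp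
        then show False using sep[OF \<open>m \<noteq> n\<close>] that eps by linarith
      qed
      then show ?thesis by (auto intro: someI2)
    qed
    then have "finite {n. norm (A (u n) - z) \<le> 8 * \<epsilon>}" by (rule finite_subset) simp
    ultimately obtain n where n: "n \<in> N" "norm (A (u n) - z) > 8 * \<epsilon>"
      by (metis (mono_tags, lifting) finite_subset mem_Collect_eq not_le subsetI)
    define y where "y = A (u n)"
    have nb: "y \<in> weak_nbhd (\<lambda>y f. blinfun_apply f y) G1 \<tau>1 z" "y \<in> weak_nbhd (\<lambda>y f. blinfun_apply f y) G2 \<tau>2 z"
      using n(1) unfolding N_def y_def by (auto intro: weak_nbhd_mono)
    have d: "inf_convolution z \<le> inf_convolution y - 3 * \<delta> / 4"
      using 2(3)[OF AK[OF u[of n]]] nb(2) n(2) unfolding y_def by simp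
    define p where "p = (1 - \<mu>) *\<^sub>R A x + \<mu> *\<^sub>R y"
    have "q + \<mu> *\<^sub>R (y - z) = p" unfolding q_def p_def by (simp add: algebra_simps)
    then have "inf_convolution p \<le> inf_convolution q + \<mu> * \<delta> / 4" using 1(3)[OF u[of n]] nb(1) unfolding y_def by simp
    also have "inf_convolution q \<le> (1 - \<mu>) * inf_convolution (A x) + \<mu> * inf_convolution z"
      unfolding q_def by (rule inf_convolution_convex) (use l in auto)
    also have "\<mu> * inf_convolution z \<le> \<mu> * (inf_convolution y - 3 * \<delta> / 4)" using d l by (intro mult_left_mono) auto
    finally have p: "inf_convolution p \<le> (1 - \<mu>) * inf_convolution (A x) + \<mu> * inf_convolution y - \<mu> * \<delta> / 2"
      by (simp add: algebra_simps)
    \<comment> \<open>The midpoint is a convex combination of \<open>p\<close> and \<open>y\<close> with weight \<open>\<alpha>\<close> on \<open>p\<close>.\<close>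
    define \<alpha> where "\<alpha> = 1 / (2 * (1 - \<mu>))"
    have a: "\<alpha> * (1 - \<mu>) = 1 / 2" "\<alpha> \<ge> 1/2" "\<alpha> \<le> 1" unfolding \<alpha>_def using l by (auto simp: field_simps)
    then have a': "\<alpha> * \<mu> = \<alpha> - 1 / 2" by (simp add: algebra_simps)
    have "\<alpha> *\<^sub>R p + (1 - \<alpha>) *\<^sub>R y = (\<alpha> * (1 - \<mu>)) *\<^sub>R A x + (\<alpha> * \<mu> + (1 - \<alpha>)) *\<^sub>R y"
      unfolding p_def by (simp add: algebra_simps)
    also have "\<dots> = (1/2) *\<^sub>R (A x + y)" unfolding a(1) a' by (simp add: scaleR_add_right)
    finally have mid: "\<alpha> *\<^sub>R p + (1 - \<alpha>) *\<^sub>R y = (1/2) *\<^sub>R (A x + y)" .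
    have "inf_convolution ((1/2) *\<^sub>R (A x + y)) \<le> \<alpha> * inf_convolution p + (1 - \<alpha>) * inf_convolution y"
      unfolding mid[symmetric] by (rule inf_convolution_convex) (use a in auto)
    also have "\<alpha> * inf_convolution p \<le> \<alpha> * ((1 - \<mu>) * inf_convolution (A x) + \<mu> * inf_convolution y - \<mu> * \<delta> / 2)"
      using p a by (intro mult_left_mono) auto
    also have "\<dots> = (\<alpha> * (1 - \<mu>)) * inf_convolution (A x) + (\<alpha> * \<mu>) * inf_convolution y - \<alpha> * (\<mu> * \<delta> / 2)"
      by (simp add: algebra_simps)
    also have "\<dots> = inf_convolution (A x) / 2 + (\<alpha> - 1 / 2) * inf_convolution y - \<alpha> * (\<mu> * \<delta> / 2)" unfolding a(1) a' by simp
    finally have "inf_convolution ((1/2) *\<^sub>R (A x + y)) \<le> inf_convolution (A x) / 2 + inf_convolution y / 2 - \<alpha> * (\<mu> * \<delta> / 2)"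
      by (simp add: algebra_simps)
    moreover have "1 / 2 * (\<mu> * \<delta> / 2) \<le> \<alpha> * (\<mu> * \<delta> / 2)" using a l delta by (intro mult_right_mono) auto
    ultimately have "inf_convolution ((1/2) *\<^sub>R (A x + y)) \<le> inf_convolution (A x) / 2 + inf_convolution y / 2 - \<mu> * \<delta> / 4" by linarith
    then show "\<exists>n. inf_convolution ((1/2) *\<^sub>R (A x + A (u n))) \<le> inf_convolution (A x) / 2 + inf_convolution (A (u n)) / 2 - \<mu> * \<delta> / 4"
      unfolding y_def by blast
  qed
qed

end

section \<open>From convex functions to a norm with property \<open>(\<beta>)\<close>\<close>

lemma ex_midpoint_gain_function:
  fixes A :: "'a::real_normed_vector \<Rightarrow> 'b::real_normed_vector"
  assumes A: "weakly_compact_operator A" and nf: "\<not> tree_factors_through A" and e: "e > 0"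
  shows "\<exists>F L \<beta>. L \<ge> 0 \<and> \<beta> > 0 \<and>
    (\<forall>x y a b. a \<ge> 0 \<longrightarrow> b \<ge> 0 \<longrightarrow> a + b = 1 \<longrightarrow> F (a *\<^sub>R x + b *\<^sub>R y) \<le> a * F x + b * F y) \<and>
    (\<forall>x y. F x \<le> F y + L * norm (x - y)) \<and>
    (\<forall>x u. norm x \<le> 1 \<longrightarrow> (\<forall>n::nat. norm (u n) \<le> 1) \<longrightarrow> (\<forall>m n. m \<noteq> n \<longrightarrow> norm (A (u m) - A (u n)) \<ge> e) \<longrightarrow>
       (\<exists>n. F ((1/2) *\<^sub>R (A x + A (u n))) \<le> F (A x) / 2 + F (A (u n)) / 2 - \<beta>))"
proof -
  have bl: "bounded_linear A" using A unfolding weakly_compact_operator_def by blast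
  obtain M where M: "M > 0" "\<And>x. norm (A x) \<le> M * norm x"
    using bounded_linear.pos_bounded[OF bl] by (metis mult.commute)
  let ?K = "closure (A ` cball 0 1)"
  interpret D1: dual_pairing "\<lambda>y f. blinfun_apply f y" ?K "cball 0 1 :: ('b \<Rightarrow>\<^sub>L real) set" M
    by (rule dual_pairing_closure_image_ball[OF A M])
  interpret D2: dual_pairing blinfun_apply "cball 0 1 :: ('b \<Rightarrow>\<^sub>L real) set" "A ` cball 0 1" M
    by (rule dual_pairing_dual_ball[OF bl M])
  have fin1: "\<exists>n. D1.derivation r n = {}" if r: "r > 0" for r
  proof (rule ccontr)
    assume "\<nexists>n. D1.derivation r n = {}"
    then have ne: "D1.derivation r n \<noteq> {}" for n by blast
    have k: "r/8/8 > 0" using r by simp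
    obtain base z b where "D1.separated_tree (r/8) (r/8/8) base z b"
      by (rule D1.ex_separated_tree[OF r k ne])
    then show False using tree_factors_through_of_range_tree[OF A M, of "r/8"] nf r by simp
  qed
  have fin2: "\<exists>n. D2.derivation r n = {}" if r: "r > 0" for r
  proof (rule ccontr)
    assume "\<nexists>n. D2.derivation r n = {}"
    then have ne: "D2.derivation r n \<noteq> {}" for n by blast
    have k: "r/8/4 > 0" using r by simp
    obtain base z b where "D2.separated_tree (r/8) (r/8/4) base z b"
      by (rule D2.ex_separated_tree[OF r k ne])
    then show False using tree_factors_through_of_dual_tree[OF bl M, of "r/8"] nf r by simp
  qed
  define \<epsilon> where "\<epsilon> = e / 32"
  have eps: "\<epsilon> > 0" unfolding \<epsilon>_def using e by simp
  obtain n1 where n1: "D1.derivation \<epsilon> n1 = {}" using fin1[OF eps] by blast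
  interpret E1: dual_pairing_finite "\<lambda>y f. blinfun_apply f y" ?K "cball 0 1 :: ('b \<Rightarrow>\<^sub>L real) set" M \<epsilon> n1
    by unfold_locales (rule eps, rule n1)
  define \<delta> where "\<delta> = \<epsilon> / (4 * M)"
  define t where "t = 4 * (real n1 + 1) / \<epsilon>"
  define \<eta> where "\<eta> = \<delta> / (48 * t)"
  have pos: "\<delta> > 0" "t > 0" "\<eta> > 0" unfolding \<delta>_def t_def \<eta>_def using eps M(1) by auto
  obtain n2 where n2: "D2.derivation \<eta> n2 = {}" using fin2[OF pos(3)] by blast
  interpret E2: dual_pairing_finite blinfun_apply "cball 0 1 :: ('b \<Rightarrow>\<^sub>L real) set" "A ` cball 0 1" M \<eta> n2
    by unfold_locales (rule pos(3), rule n2)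
  define \<gamma> where "\<gamma> = \<eta> / (4 * M)"
  define \<theta> where "\<theta> = \<epsilon> / (4 * (real n2 + 1))"
  interpret R: renorming_data A ?K M "D1.envelope \<epsilon>" "real n1" \<epsilon> \<delta> t "D2.envelope \<eta>" "real n2" \<eta> \<gamma> \<theta>
  proof (rule renorming_data.intro)
    show "bounded_linear A" by (rule bl)
    show "M > 0" "norm (A x) \<le> M * norm x" for x by (rule M)+
    show "convex ?K" by (rule D1.convex_K)
    show "weakly_compact_set (\<lambda>y f. blinfun_apply f y) ?K" by (rule D1.compact_K)
    show "A x \<in> ?K" if "norm x \<le> 1" for x using that closure_subset by force
    show "0 \<le> D1.envelope \<epsilon> v \<and> D1.envelope \<epsilon> v \<le> real n1" if "v \<in> ?K" for v
      using E1.envelope_nonneg[OF that] E1.envelope_le[OF that] by blast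
    show "a * D1.envelope \<epsilon> v + b * D1.envelope \<epsilon> w \<le> D1.envelope \<epsilon> (a *\<^sub>R v + b *\<^sub>R w)"
      if "v \<in> ?K" "w \<in> ?K" "a \<ge> 0" "b \<ge> 0" "a + b = 1" for v w a b by (rule E1.envelope_concave[OF that])
    show "\<exists>G \<tau>. finite G \<and> \<tau> > 0 \<and> (\<forall>v'\<in>?K. v' \<in> weak_nbhd (\<lambda>y f. blinfun_apply f y) G \<tau> v \<longrightarrow>
           D1.envelope \<epsilon> v' \<le> D1.envelope \<epsilon> v + \<kappa> \<and> (norm (v' - v) > 4 * \<epsilon> \<longrightarrow> D1.envelope \<epsilon> v' \<le> D1.envelope \<epsilon> v - \<delta> + \<kappa>))"
      if v: "v \<in> ?K" and k: "\<kappa> > 0" for v \<kappa>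
    proof -
      obtain G \<tau> where G: "finite G" "\<tau> > 0"
        "\<And>v'. v' \<in> ?K \<Longrightarrow> v' \<in> D1.nbhd G \<tau> v \<Longrightarrow> D1.envelope \<epsilon> v' \<le> D1.envelope \<epsilon> v + \<kappa>"
        "\<And>v'. v' \<in> ?K \<Longrightarrow> v' \<in> D1.nbhd G \<tau> v \<Longrightarrow> D1.far (4 * \<epsilon>) (v' - v) \<Longrightarrow> D1.envelope \<epsilon> v' \<le> D1.envelope \<epsilon> v - \<epsilon> / (4 * M) + \<kappa>"
        by (rule E1.envelope_drop[OF v k]) blast
      have far: "D1.far (4 * \<epsilon>) w" if "norm w > 4 * \<epsilon>" for w
        using that norming_functional[of w] unfolding D1.far_def by (metis mem_cball_0)
      show ?thesis using G far unfolding \<delta>_def by (intro exI[of _ G] exI[of _ \<tau>]) auto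
    qed
    show "0 \<le> D2.envelope \<eta> f \<and> D2.envelope \<eta> f \<le> real n2" if "f \<in> cball 0 1" for f
      using E2.envelope_nonneg[OF that] E2.envelope_le[OF that] by blast
    show "\<exists>G \<tau>. finite G \<and> \<tau> > 0 \<and> (\<forall>f'\<in>cball 0 1. f' \<in> weak_nbhd blinfun_apply G \<tau> f \<longrightarrow>
           D2.envelope \<eta> f' \<le> D2.envelope \<eta> f + \<kappa> \<and>
           ((\<exists>x. norm x \<le> 1 \<and> blinfun_apply (f' - f) (A x) > 4 * \<eta>) \<longrightarrow> D2.envelope \<eta> f' \<le> D2.envelope \<eta> f - \<gamma> + \<kappa>))"
      if f: "f \<in> cball 0 1" and k: "\<kappa> > 0" for f \<kappa>
    proof -
      obtain G \<tau> where G: "finite G" "\<tau> > 0"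
        "\<And>v'. v' \<in> cball 0 1 \<Longrightarrow> v' \<in> D2.nbhd G \<tau> f \<Longrightarrow> D2.envelope \<eta> v' \<le> D2.envelope \<eta> f + \<kappa>"
        "\<And>v'. v' \<in> cball 0 1 \<Longrightarrow> v' \<in> D2.nbhd G \<tau> f \<Longrightarrow> D2.far (4 * \<eta>) (v' - f) \<Longrightarrow> D2.envelope \<eta> v' \<le> D2.envelope \<eta> f - \<eta> / (4 * M) + \<kappa>"
        by (rule E2.envelope_drop[OF f k]) blast
      have far: "D2.far (4 * \<eta>) w" if "\<exists>x. norm x \<le> 1 \<and> blinfun_apply w (A x) > 4 * \<eta>" for w
        using that unfolding D2.far_def by auto
      show ?thesis using G(1,2) G(3) G(4)[OF _ _ far] unfolding \<gamma>_def
        by (intro exI[of _ G] exI[of _ \<tau>]) blast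
    qed
    show "\<epsilon> > 0" "\<delta> > 0" "t > 0" "\<eta> > 0" by (rule eps pos)+
    show "\<gamma> > 0" "\<theta> > 0" unfolding \<gamma>_def \<theta>_def using pos eps M(1) by auto
    have "4 * (real n2 + 1) \<noteq> 0" by simp
    then have "\<theta> * (4 * (real n2 + 1)) = \<epsilon>" using \<theta>_def by (subst (asm) nonzero_eq_divide_eq) auto
    then have "\<theta> * real n2 + \<theta> = \<epsilon> / 4" by (simp add: algebra_simps)
    then show "\<theta> * real n2 \<le> \<epsilon> / 4" using \<open>\<theta> > 0\<close> by linarith
    show "real n1 + 1 \<le> t * \<epsilon> / 4" unfolding t_def using eps by simp
    show "48 * t * \<eta> \<le> \<delta>" unfolding \<eta>_def using pos by simp
  qed
  obtain \<beta> where b: "\<beta> > 0"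
    "\<And>x u. norm x \<le> 1 \<Longrightarrow> (\<And>n::nat. norm (u n) \<le> 1) \<Longrightarrow> (\<And>m n. m \<noteq> n \<Longrightarrow> norm (A (u m) - A (u n)) \<ge> 32 * \<epsilon>) \<Longrightarrow>
       \<exists>n. R.inf_convolution ((1/2) *\<^sub>R (A x + A (u n))) \<le> R.inf_convolution (A x) / 2 + R.inf_convolution (A (u n)) / 2 - \<beta>"
    by (rule R.inf_convolution_midpoint_gain) blast
  have e32: "32 * \<epsilon> = e" unfolding \<epsilon>_def by simp
  show ?thesis
    by (intro exI[of _ R.inf_convolution] exI[of _ t] exI[of _ \<beta>] conjI allI impI)
      (use pos b R.inf_convolution_convex R.inf_convolution_lipschitz in \<open>auto simp: e32\<close>)
qed

text \<open>The norm is the Minkowski functional of the sublevel set \<open>G \<le> 1\<close>.\<close>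

lemma minkowski_norm:
  fixes G :: "'a::real_normed_vector \<Rightarrow> real"
  assumes conv: "\<And>x y a b. a \<ge> 0 \<Longrightarrow> b \<ge> 0 \<Longrightarrow> a + b = 1 \<Longrightarrow> G (a *\<^sub>R x + b *\<^sub>R y) \<le> a * G x + b * G y"
    and even: "\<And>x. G (- x) = G x" and zero: "G 0 = 0" and lower: "\<And>x. norm x \<le> G x"
    and lip: "\<And>x y. G x \<le> G y + L * norm (x - y)" and L: "L > 0"
  obtains N where "is_norm N" "\<And>x. norm x \<le> N x" "\<And>x. N x \<le> L * norm x" "\<And>x. N x \<le> 1 \<longleftrightarrow> G x \<le> 1"
proof -
  define S where "S x = {s. s > 0 \<and> G ((1/s) *\<^sub>R x) \<le> 1}" for x
  define N where "N x = Inf (S x)" for x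
  have shrink: "G (c *\<^sub>R x) \<le> c * G x" if "0 \<le> c" "c \<le> 1" for c x
    using conv[of c "1 - c" x 0] that zero by simp
  have G_le: "G x \<le> L * norm x" for x using lip[of x 0] zero by simp
  have low: "norm x \<le> s" if "s \<in> S x" for s x
  proof -
    have s: "s > 0" "G ((1/s) *\<^sub>R x) \<le> 1" using that unfolding S_def by auto
    have "norm ((1/s) *\<^sub>R x) \<le> 1" using lower[of "(1/s) *\<^sub>R x"] s(2) by linarith
    then show ?thesis using s(1) by simp
  qed
  have bdd: "bdd_below (S x)" for x using low by (auto simp: bdd_below_def)
  have up: "s \<in> S x" if "s > 0" "L * norm x \<le> s" for s x
  proof -
    have "G ((1/s) *\<^sub>R x) \<le> L * norm x / s" using G_le[of "(1/s) *\<^sub>R x"] that(1) by simp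
    also have "\<dots> \<le> 1" using that by simp
    finally show ?thesis using that(1) unfolding S_def by simp
  qed
  have ne: "S x \<noteq> {}" for x
  proof -
    have "L * norm x \<ge> 0" using L by simp
    then show ?thesis using up[of "L * norm x + 1" x] by auto
  qed
  have N_le: "N x \<le> s" if "s \<in> S x" for s x unfolding N_def by (rule cInf_lower[OF that bdd])
  have N_less: "s \<in> S x" if "N x < s" for s x
  proof -
    obtain r where r: "r \<in> S x" "r < s" using cInf_lessD[OF ne \<open>N x < s\<close>[unfolded N_def]] by blast
    have "(1/s) *\<^sub>R x = (r / s) *\<^sub>R ((1/r) *\<^sub>R x)" using r unfolding S_def by simp
    also have "G \<dots> \<le> (r / s) * G ((1/r) *\<^sub>R x)" by (rule shrink) (use r in \<open>auto simp: S_def\<close>)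
    also have "\<dots> \<le> 1 * 1" using r unfolding S_def
      by (intro mult_mono') (auto intro: order_trans[OF norm_ge_zero lower])
    finally show ?thesis using r unfolding S_def by simp
  qed
  have N_lower: "norm x \<le> N x" for x unfolding N_def by (rule cInf_greatest[OF ne low])
  have N_upper: "N x \<le> L * norm x" for x
  proof (rule field_le_epsilon)
    fix e :: real assume "e > 0"
    then show "N x \<le> L * norm x + e" using L by (intro N_le up) (auto intro: add_nonneg_pos)
  qed
  have N_scale_le: "N (c *\<^sub>R x) \<le> c * N x" if c: "c > 0" for c x
  proof -
    have "N (c *\<^sub>R x) / c \<le> N x"
      unfolding N_def[of x]
    proof (rule cInf_greatest[OF ne])
      fix s assume "s \<in> S x"
      then have "c * s \<in> S (c *\<^sub>R x)" unfolding S_def using c by simp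
      then show "N (c *\<^sub>R x) / c \<le> s" using N_le[of "c * s" "c *\<^sub>R x"] c by (simp add: field_simps)
    qed
    then show ?thesis using c by (simp add: field_simps)
  qed
  have N_scale_pos: "N (c *\<^sub>R x) = c * N x" if c: "c > 0" for c x
  proof (rule antisym[OF N_scale_le[OF c]])
    have "N ((1/c) *\<^sub>R (c *\<^sub>R x)) \<le> (1/c) * N (c *\<^sub>R x)" by (rule N_scale_le) (use c in simp)
    then show "c * N x \<le> N (c *\<^sub>R x)" using c by (simp add: field_simps)
  qed
  have N_minus: "N (- x) = N x" for x unfolding N_def S_def by (simp add: even)
  have N0: "N 0 = 0" using N_upper[of 0] N_lower[of 0] by simp
  have N_scale: "N (c *\<^sub>R x) = \<bar>c\<bar> * N x" for c x
    using N_scale_pos[of c x] N_scale_pos[of "- c" x] N_minus[of "c *\<^sub>R x"] N0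
    by (cases c "0::real" rule: linorder_cases) auto
  have N_tri: "N (x + y) \<le> N x + N y" for x y
  proof (rule field_le_epsilon)
    fix e :: real assume e: "e > 0"
    define s r where "s = N x + e / 2" and "r = N y + e / 2"
    have s: "s \<in> S x" and r: "r \<in> S y" unfolding s_def r_def by (rule N_less, use e in simp)+
    have p: "s > 0" "r > 0" using s r unfolding S_def by auto
    have "(1/(s + r)) *\<^sub>R (x + y) = (s/(s+r)) *\<^sub>R ((1/s) *\<^sub>R x) + (r/(s+r)) *\<^sub>R ((1/r) *\<^sub>R y)"
      using p by (simp add: scaleR_add_right)
    also have "G \<dots> \<le> (s/(s+r)) * G ((1/s) *\<^sub>R x) + (r/(s+r)) * G ((1/r) *\<^sub>R y)"
      by (rule conv) (use p in \<open>auto simp flip: add_divide_distrib\<close>)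
    also have "\<dots> \<le> (s/(s+r)) * 1 + (r/(s+r)) * 1"
      using s r p unfolding S_def by (intro add_mono mult_left_mono) auto
    also have "\<dots> = 1" using p by (simp flip: add_divide_distrib)
    finally have "s + r \<in> S (x + y)" using p unfolding S_def by simp
    then show "N (x + y) \<le> N x + N y + e" using N_le unfolding s_def r_def by fastforce
  qed
  have N1: "N x \<le> 1 \<longleftrightarrow> G x \<le> 1" for x
  proof
    assume "G x \<le> 1" then show "N x \<le> 1" by (intro N_le) (simp add: S_def)
  next
    assume N: "N x \<le> 1"
    show "G x \<le> 1"
    proof (rule field_le_epsilon)
      fix e :: real assume e: "e > 0"
      define d where "d = e / L"
      have d: "d > 0" "L * d = e" unfolding d_def using e L by auto
      have nx: "norm x \<le> 1" using N N_lower[of x] by linarith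
      have "1 + d \<in> S x" by (rule N_less) (use N d in simp)
      then have G1: "G ((1/(1+d)) *\<^sub>R x) \<le> 1" unfolding S_def by simp
      have "x - (1/(1+d)) *\<^sub>R x = (1 - 1/(1+d)) *\<^sub>R x" by (simp add: scaleR_diff_left)
      also have "norm \<dots> = (1 - 1/(1+d)) * norm x" using d by simp
      also have "\<dots> \<le> d * 1" using d nx by (intro mult_mono) (auto simp: field_simps)
      finally have "L * norm (x - (1/(1+d)) *\<^sub>R x) \<le> L * d" using L by simp
      then show "G x \<le> 1 + e" using lip[of x "(1/(1+d)) *\<^sub>R x"] G1 d by linarith
    qed
  qed
  show thesis
  proof (rule that[of N, OF _ N_lower N_upper N1])
    have "N x = 0 \<longleftrightarrow> x = 0" for x using N_lower[of x] N0 by auto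
    moreover have "0 \<le> N x" for x using order_trans[OF norm_ge_zero N_lower] .
    ultimately show "is_norm N" unfolding is_norm_def using N_scale N_tri by simp
  qed
qed

text \<open>The symmetrization \<open>F y + F (- y) - 2 * F 0\<close> is even, vanishes at 0 and keeps the gain, because \<open>F (- y)\<close> is
convex. The denominator makes the composition with \<open>A\<close> a 1-Lipschitz function.\<close>

lemma symmetrized_gain:
  fixes A :: "'a::real_normed_vector \<Rightarrow> 'b::real_normed_vector"
  assumes bl: "bounded_linear A" and M: "M > 0" "\<And>x. norm (A x) \<le> M * norm x" and L: "L \<ge> 0"
    and conv: "\<And>x y a b. a \<ge> 0 \<Longrightarrow> b \<ge> 0 \<Longrightarrow> a + b = 1 \<Longrightarrow> F (a *\<^sub>R x + b *\<^sub>R y) \<le> a * F x + b * F y"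
    and lip: "\<And>x y. F x \<le> F y + L * norm (x - y)"
    and T: "\<And>x. T x = (F (A x) + F (- A x) - 2 * F 0) / (2 * L * M + 1)"
  shows "a \<ge> 0 \<Longrightarrow> b \<ge> 0 \<Longrightarrow> a + b = 1 \<Longrightarrow> T (a *\<^sub>R x + b *\<^sub>R y) \<le> a * T x + b * T y"
    "T (- x) = T x" "T 0 = 0" "0 \<le> T x" "T x \<le> T y + norm (x - y)"
    "F ((1/2) *\<^sub>R (A x + A y)) \<le> F (A x) / 2 + F (A y) / 2 - \<beta> \<Longrightarrow>
       T ((1/2) *\<^sub>R (x + y)) \<le> T x / 2 + T y / 2 - \<beta> / (2 * L * M + 1)"
proof -
  interpret A: bounded_linear A by fact
  define c where "c = 2 * L * M + 1"
  have c: "c > 0" unfolding c_def using L M by (simp add: add_nonneg_pos)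
  have T': "c * T x = F (A x) + F (- A x) - 2 * F 0" for x unfolding T c_def[symmetric] using c by simp
  show "T (a *\<^sub>R x + b *\<^sub>R y) \<le> a * T x + b * T y" if ab: "a \<ge> 0" "b \<ge> 0" "a + b = 1" for a b
  proof -
    have eq: "A (a *\<^sub>R x + b *\<^sub>R y) = a *\<^sub>R A x + b *\<^sub>R A y" "- A (a *\<^sub>R x + b *\<^sub>R y) = a *\<^sub>R (- A x) + b *\<^sub>R (- A y)"
      by (simp_all add: A.add A.scaleR)
    have "c * T (a *\<^sub>R x + b *\<^sub>R y) \<le> (a * F (A x) + b * F (A y)) + (a * F (- A x) + b * F (- A y)) - 2 * F 0"
      unfolding T' unfolding eq(2) unfolding eq(1) using conv[OF ab, of "A x" "A y"] conv[OF ab, of "- A x" "- A y"] by linarith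
    also have "2 * F 0 = a * (2 * F 0) + b * (2 * F 0)" using ab(3) by (metis distrib_right mult_1)
    finally have "c * T (a *\<^sub>R x + b *\<^sub>R y) \<le> a * (c * T x) + b * (c * T y)" unfolding T' by (simp add: algebra_simps)
    also have "\<dots> = c * (a * T x + b * T y)" by (simp add: algebra_simps)
    finally show ?thesis using c by simp
  qed
  show "T (- x) = T x" "T 0 = 0" unfolding T by (simp_all add: A.neg add.commute A.zero)
  have "F 0 \<le> 1/2 * F (A x) + 1/2 * F (- A x)" using conv[of "1/2" "1/2" "A x" "- A x"] by simp
  then have "0 \<le> c * T x" unfolding T' by simp
  then show "0 \<le> T x" using c by (simp add: zero_le_mult_iff)
  have "norm (A x - A y) \<le> M * norm (x - y)" using M(2)[of "x - y"] by (simp add: A.diff)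
  then have LM: "L * norm (A x - A y) \<le> L * (M * norm (x - y))" using L by (rule mult_left_mono)
  have "c * T x \<le> c * T y + 2 * (L * norm (A x - A y))"
    unfolding T' using lip[of "A x" "A y"] lip[of "- A x" "- A y"] norm_minus_commute[of "A x" "A y"] by simp
  also have "\<dots> \<le> c * T y + c * norm (x - y)"
  proof -
    have "c * norm (x - y) = 2 * (L * (M * norm (x - y))) + norm (x - y)" unfolding c_def by (simp add: algebra_simps)
    then show ?thesis using LM norm_ge_zero[of "x - y"] by linarith
  qed
  finally have "c * T x \<le> c * (T y + norm (x - y))" by (simp add: distrib_left)
  then show "T x \<le> T y + norm (x - y)" using c by simp
  assume g: "F ((1/2) *\<^sub>R (A x + A y)) \<le> F (A x) / 2 + F (A y) / 2 - \<beta>"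
  have "F (- ((1/2) *\<^sub>R (A x + A y))) \<le> 1/2 * F (- A x) + 1/2 * F (- A y)"
    using conv[of "1/2" "1/2" "- A x" "- A y"] by (simp add: scaleR_add_right)
  moreover have "A ((1/2) *\<^sub>R (x + y)) = (1/2) *\<^sub>R (A x + A y)" by (simp add: A.add A.scaleR)
  ultimately have "c * T ((1/2) *\<^sub>R (x + y)) \<le> (c * T x) / 2 + (c * T y) / 2 - \<beta>"
    using g unfolding T' by (simp add: add_divide_distrib diff_divide_distrib)
  then have "T ((1/2) *\<^sub>R (x + y)) \<le> ((c * T x) / 2 + (c * T y) / 2 - \<beta>) / c"
    using c by (simp add: pos_le_divide_eq mult.commute)
  also have "\<dots> = T x / 2 + T y / 2 - \<beta> / c" using c by (simp add: field_simps)
  finally show "T ((1/2) *\<^sub>R (x + y)) \<le> T x / 2 + T y / 2 - \<beta> / (2 * L * M + 1)" unfolding c_def .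
qed

text \<open>In the sum each \<open>T k\<close> keeps its own gain, since the other summands and the norm are convex. As the sum is Lipschitz, a
gain at a midpoint allows that midpoint to be stretched by a factor \<open>1 + \<delta>\<close> within the new unit ball.\<close>

lemma beta_norm_of_functions:
  fixes A :: "'a::real_normed_vector \<Rightarrow> 'b::real_normed_vector" and T :: "nat \<Rightarrow> 'a \<Rightarrow> real"
  assumes conv: "\<And>k x y a b. a \<ge> 0 \<Longrightarrow> b \<ge> 0 \<Longrightarrow> a + b = 1 \<Longrightarrow> T k (a *\<^sub>R x + b *\<^sub>R y) \<le> a * T k x + b * T k y"
    and even: "\<And>k x. T k (- x) = T k x" and zero: "\<And>k. T k 0 = 0" and nonneg: "\<And>k x. 0 \<le> T k x"
    and lip: "\<And>k x y. T k x \<le> T k y + norm (x - y)"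
    and pos: "\<And>k. d k > 0"
    and gain: "\<And>k x u. norm x \<le> 1 \<Longrightarrow> (\<And>n::nat. norm (u n) \<le> 1) \<Longrightarrow>
       (\<And>m n. m \<noteq> n \<Longrightarrow> norm (A (u m) - A (u n)) \<ge> 1 / real (Suc k)) \<Longrightarrow>
       \<exists>n. T k ((1/2) *\<^sub>R (x + u n)) \<le> T k x / 2 + T k (u n) / 2 - d k"
  shows "admits_equivalent_norm_beta A"
proof -
  define H where "H k x = (1/2) ^ k * T k x" for k x
  define G where "G x = norm x + (\<Sum>k. H k x)" for x
  have H_lip: "H k x \<le> H k y + (1/2) ^ k * norm (x - y)" for k x y
    unfolding H_def using mult_left_mono[OF lip[of k x y], of "(1/2) ^ k"] by (simp add: distrib_left)
  have geo: "summable (\<lambda>k. (1/2::real) ^ k * c)" "(\<Sum>k. (1/2::real) ^ k * c) = 2 * c" for c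
    by (simp_all add: summable_mult2 summable_geometric suminf_mult2[symmetric] suminf_geometric)
  have H_nonneg: "0 \<le> H k x" for k x unfolding H_def using nonneg by simp
  have H_le: "H k x \<le> (1/2) ^ k * norm x" for k x using H_lip[of k x 0] zero[of k] unfolding H_def by simp
  have sH: "summable (\<lambda>k. H k x)" for x
    by (rule summable_comparison_test_ev[OF _ geo(1)[of "norm x"]]) (use H_le H_nonneg in auto)
  have G_conv: "G (a *\<^sub>R x + b *\<^sub>R y) \<le> a * G x + b * G y" if ab: "a \<ge> 0" "b \<ge> 0" "a + b = 1" for a b x y
  proof -
    have "norm (a *\<^sub>R x + b *\<^sub>R y) \<le> a * norm x + b * norm y" using norm_triangle_ineq[of "a *\<^sub>R x" "b *\<^sub>R y"] ab by simp
    moreover have "(\<Sum>k. H k (a *\<^sub>R x + b *\<^sub>R y)) \<le> (\<Sum>k. a * H k x + b * H k y)"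
    proof (rule suminf_le[OF _ sH])
      show "summable (\<lambda>k. a * H k x + b * H k y)" by (intro summable_add summable_mult sH)
      show "H k (a *\<^sub>R x + b *\<^sub>R y) \<le> a * H k x + b * H k y" for k
        unfolding H_def using mult_left_mono[OF conv[OF ab, of k x y], of "(1/2) ^ k"] by (simp add: algebra_simps)
    qed
    moreover have "(\<Sum>k. a * H k x + b * H k y) = a * (\<Sum>k. H k x) + b * (\<Sum>k. H k y)"
      by (simp add: suminf_add[symmetric] suminf_mult summable_mult sH)
    ultimately show ?thesis unfolding G_def by (simp add: algebra_simps)
  qed
  have G_even: "G (- x) = G x" for x unfolding G_def H_def even by simp
  have G0: "G 0 = 0" unfolding G_def H_def zero by simp
  have G_lower: "norm x \<le> G x" for x unfolding G_def using suminf_nonneg[OF sH H_nonneg, of x] by simp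
  have G_lip: "G x \<le> G y + 3 * norm (x - y)" for x y
  proof -
    have "(\<Sum>k. H k x) \<le> (\<Sum>k. H k y + (1/2) ^ k * norm (x - y))"
      by (rule suminf_le[OF H_lip sH]) (intro summable_add sH geo)
    also have "\<dots> = (\<Sum>k. H k y) + 2 * norm (x - y)" by (simp only: suminf_add[OF sH geo(1), symmetric] geo(2))
    finally show ?thesis unfolding G_def using norm_triangle_ineq2[of x y] by simp
  qed
  obtain N where N: "is_norm N" "\<And>x. norm x \<le> N x" "\<And>x. N x \<le> 3 * norm x" "\<And>x. N x \<le> 1 \<longleftrightarrow> G x \<le> 1"
    by (rule minkowski_norm[of G 3]) (use G_conv G_even G0 G_lower G_lip in auto)
  have eqN: "equivalent_norm N" unfolding equivalent_norm_def
    using N by (intro conjI exI[of _ 1] exI[of _ 3]) auto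
  have eqM: "equivalent_norm (norm :: 'b \<Rightarrow> real)"
    unfolding equivalent_norm_def is_norm_def by (intro conjI exI[of _ 1]) (auto simp: norm_triangle_ineq)
  have "property_beta N norm A"
    unfolding property_beta_def
  proof (intro allI impI)
    fix \<epsilon> :: real assume e: "\<epsilon> > 0"
    obtain k where k: "1 / real (Suc k) < \<epsilon>" using nat_approx_posE[OF e] by blast
    define \<delta> where "\<delta> = (1/2) ^ k * d k / 3"
    have d: "\<delta> > 0" "3 * \<delta> = (1/2) ^ k * d k" unfolding \<delta>_def using pos[of k] by auto
    define \<beta> where "\<beta> = 1 - 1 / (1 + \<delta>)"
    have b: "\<beta> > 0" "1 - \<beta> = 1 / (1 + \<delta>)" unfolding \<beta>_def using d by auto
    show "\<exists>\<beta>>0. \<forall>x (u :: nat \<Rightarrow> 'a). N x \<le> 1 \<longrightarrow> (\<forall>n. N (u n) \<le> 1) \<longrightarrow>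
        (INF (m, n)\<in>{(m, n). m \<noteq> n}. norm (A (u m) - A (u n))) \<ge> \<epsilon> \<longrightarrow> (\<exists>n. N (x + u n) \<le> 2 * (1 - \<beta>))"
    proof (rule exI[of _ \<beta>], intro conjI allI impI)
      show "\<beta> > 0" by (rule b(1))
    next
      fix x :: 'a and u :: "nat \<Rightarrow> 'a"
      assume x: "N x \<le> 1" and u: "\<forall>n. N (u n) \<le> 1"
        and sep: "(INF (m, n)\<in>{(m, n). m \<noteq> n}. norm (A (u m) - A (u n))) \<ge> \<epsilon>"
      have sep': "norm (A (u m) - A (u n)) \<ge> \<epsilon>" if "m \<noteq> n" for m n
      proof -
        have "(INF (m, n)\<in>{(m, n). m \<noteq> n}. norm (A (u m) - A (u n))) \<le> (case (m, n) of (m, n) \<Rightarrow> norm (A (u m) - A (u n)))"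
          by (rule cINF_lower) (use that in \<open>auto intro!: bdd_belowI2[of _ 0]\<close>)
        then show ?thesis using sep by simp
      qed
      have nx: "norm x \<le> 1" using x N(2)[of x] by linarith
      have nu: "norm (u n) \<le> 1" for n using u N(2)[of "u n"] order_trans by blast
      obtain n where n: "T k ((1/2) *\<^sub>R (x + u n)) \<le> T k x / 2 + T k (u n) / 2 - d k"
        using gain[of x u k, OF nx nu] sep' k by (meson less_imp_le order_trans)
      define m where "m = (1/2) *\<^sub>R (x + u n)"
      have mid: "m = (1/2) *\<^sub>R x + (1/2) *\<^sub>R u n" unfolding m_def by (simp add: scaleR_add_right)
      have nm: "norm m \<le> norm x / 2 + norm (u n) / 2"
        unfolding mid using norm_triangle_ineq[of "(1/2) *\<^sub>R x" "(1/2) *\<^sub>R u n"] by simp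
      have "(\<lambda>j. if j = k then 3 * \<delta> else 0) sums (3 * \<delta>)" using sums_single[of k "\<lambda>_. 3 * \<delta>"] by simp
      then have sd: "summable (\<lambda>j. if j = k then 3 * \<delta> else 0)" "(\<Sum>j. if j = k then 3 * \<delta> else 0) = 3 * \<delta>"
        using sums_iff by blast+
      have sh: "summable (\<lambda>j. H j x / 2 + H j (u n) / 2)" by (intro summable_add summable_divide sH)
      have "(\<Sum>j. H j m) \<le> (\<Sum>j. (H j x / 2 + H j (u n) / 2) - (if j = k then 3 * \<delta> else 0))"
      proof (rule suminf_le[OF _ sH])
        fix j
        show "H j m \<le> (H j x / 2 + H j (u n) / 2) - (if j = k then 3 * \<delta> else 0)"
        proof (cases "j = k")
          case True
          have "(1/2) ^ k * T k m \<le> (1/2) ^ k * (T k x / 2 + T k (u n) / 2 - d k)"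
            using n unfolding m_def by (intro mult_left_mono) auto
          then show ?thesis using True d(2) unfolding H_def by (simp add: algebra_simps)
        next
          case False
          have "T j m \<le> 1/2 * T j x + 1/2 * T j (u n)" unfolding mid by (rule conv) auto
          from mult_left_mono[OF this, of "(1/2) ^ j"] show ?thesis using False unfolding H_def by (simp add: algebra_simps)
        qed
      qed (intro summable_diff sh sd)
      also have "\<dots> = (\<Sum>j. H j x / 2 + H j (u n) / 2) - 3 * \<delta>"
        using suminf_diff[OF sh sd(1)] sd(2) by simp
      also have "(\<Sum>j. H j x / 2 + H j (u n) / 2) = (\<Sum>j. H j x) / 2 + (\<Sum>j. H j (u n)) / 2"
        using suminf_add[OF summable_divide[OF sH] summable_divide[OF sH], of x 2 "u n" 2]
        by (simp add: suminf_divide sH)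
      finally have sm: "(\<Sum>j. H j m) \<le> (\<Sum>j. H j x) / 2 + (\<Sum>j. H j (u n)) / 2 - 3 * \<delta>" .
      define s where "s v = (\<Sum>j. H j v)" for v
      have "G m \<le> G x / 2 + G (u n) / 2 - 3 * \<delta>"
        using nm sm unfolding G_def s_def[symmetric] by argo
      then have Gm: "G m \<le> 1 - 3 * \<delta>" using x u N(4)[of x] N(4)[of "u n"] by fastforce
      have "norm m \<le> 1" using nm nx nu[of n] by linarith
      then have "norm ((1 + \<delta>) *\<^sub>R m - m) \<le> \<delta>" using d(1) by (simp add: algebra_simps mult_left_le)
      then have "G ((1 + \<delta>) *\<^sub>R m) \<le> 1" using G_lip[of "(1 + \<delta>) *\<^sub>R m" m] Gm by linarith
      then have "N ((1 + \<delta>) *\<^sub>R m) \<le> 1" using N(4) by blast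
      moreover have "N ((1 + \<delta>) *\<^sub>R m) = (1 + \<delta>) / 2 * N (x + u n)"
      proof -
        have "(1 + \<delta>) *\<^sub>R m = ((1 + \<delta>) / 2) *\<^sub>R (x + u n)" unfolding m_def by simp
        then show ?thesis using N(1) d(1) unfolding is_norm_def by simp
      qed
      ultimately have "N (x + u n) \<le> 2 * (1 / (1 + \<delta>))" using d(1) by (simp add: field_simps)
      then show "\<exists>n. N (x + u n) \<le> 2 * (1 - \<beta>)" unfolding b(2) by blast
    qed
  qed
  then show ?thesis unfolding admits_equivalent_norm_beta_def using eqN eqM by blast
qed

theorem beta_renormable_if_not_tree_factor:
  fixes A :: "'a::real_normed_vector \<Rightarrow> 'b::real_normed_vector"
  assumes A: "weakly_compact_operator A" and nf: "\<not> tree_factors_through A"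
  shows "admits_equivalent_norm_beta A"
proof -
  have bl: "bounded_linear A" using A unfolding weakly_compact_operator_def by blast
  obtain M where M: "M > 0" "\<And>x. norm (A x) \<le> M * norm x"
    using bounded_linear.pos_bounded[OF bl] by (metis mult.commute)
  define P where "P k F L \<beta> \<longleftrightarrow> L \<ge> 0 \<and> \<beta> > 0 \<and>
    (\<forall>x y a b. a \<ge> 0 \<longrightarrow> b \<ge> 0 \<longrightarrow> a + b = 1 \<longrightarrow> F (a *\<^sub>R x + b *\<^sub>R y) \<le> a * F x + b * F y) \<and>
    (\<forall>x y. F x \<le> F y + L * norm (x - y)) \<and>
    (\<forall>x u. norm x \<le> 1 \<longrightarrow> (\<forall>n::nat. norm (u n) \<le> 1) \<longrightarrow> (\<forall>m n. m \<noteq> n \<longrightarrow> norm (A (u m) - A (u n)) \<ge> 1 / real (Suc k)) \<longrightarrow>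
       (\<exists>n. F ((1/2) *\<^sub>R (A x + A (u n))) \<le> F (A x) / 2 + F (A (u n)) / 2 - \<beta>))" for k and F :: "'b \<Rightarrow> real" and L \<beta>
  have "\<forall>k. \<exists>F L \<beta>. P k F L \<beta>" unfolding P_def by (intro allI ex_midpoint_gain_function[OF A nf]) simp
  then obtain F L \<beta> where P: "\<And>k. P k (F k) (L k) (\<beta> k)" by metis
  have L: "L k \<ge> 0" and b: "\<beta> k > 0" and lip: "F k x \<le> F k y + L k * norm (x - y)" for k x y
    using P[of k] unfolding P_def by blast+
  have conv: "a \<ge> 0 \<Longrightarrow> b \<ge> 0 \<Longrightarrow> a + b = 1 \<Longrightarrow> F k (a *\<^sub>R x + b *\<^sub>R y) \<le> a * F k x + b * F k y" for k x y a b
    using P[of k] unfolding P_def by blast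
  have gain: "norm x \<le> 1 \<Longrightarrow> (\<And>n::nat. norm (u n) \<le> 1) \<Longrightarrow>
      (\<And>m n. m \<noteq> n \<Longrightarrow> norm (A (u m) - A (u n)) \<ge> 1 / real (Suc k)) \<Longrightarrow>
      \<exists>n. F k ((1/2) *\<^sub>R (A x + A (u n))) \<le> F k (A x) / 2 + F k (A (u n)) / 2 - \<beta> k" for k x u
    using P[of k] unfolding P_def by blast
  define T where "T k x = (F k (A x) + F k (- A x) - 2 * F k 0) / (2 * L k * M + 1)" for k x
  note sym = symmetrized_gain[OF bl M L conv lip T_def]
  show ?thesis
  proof (rule beta_norm_of_functions[of T "\<lambda>k. \<beta> k / (2 * L k * M + 1)"])
    show "\<beta> k / (2 * L k * M + 1) > 0" for k using b[of k] L[of k] M(1) by (simp add: add_nonneg_pos)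
    fix k and x :: 'a and u :: "nat \<Rightarrow> 'a"
    assume "norm x \<le> 1" "\<And>n. norm (u n) \<le> 1" "\<And>m n. m \<noteq> n \<Longrightarrow> norm (A (u m) - A (u n)) \<ge> 1 / real (Suc k)"
    then obtain n where "F k ((1/2) *\<^sub>R (A x + A (u n))) \<le> F k (A x) / 2 + F k (A (u n)) / 2 - \<beta> k"
      using gain[of x u k] by blast
    then show "\<exists>n. T k ((1/2) *\<^sub>R (x + u n)) \<le> T k x / 2 + T k (u n) / 2 - \<beta> k / (2 * L k * M + 1)"
      using sym(6) by blast
  qed (rule sym; assumption)+
qed

section \<open>The tree excludes property \<open>(\<beta>)\<close>\<close>

lemma tree_dist_split:
  assumes "s = [] \<or> t = [] \<or> hd s \<noteq> hd t"
  shows "tree_dist (u @ s) (u @ t) = real (length s) + real (length t)"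
proof -
  have "longest_common_prefix s t = []" using assms by (cases s; cases t) auto
  moreover have "longest_common_prefix (u @ s) (u @ t) = u @ longest_common_prefix s t" by (induction u) auto
  ultimately show ?thesis unfolding tree_dist_def by simp
qed

lemma split_at_branching:
  obtains u s' t' where "s = u @ s'" "t = u @ t'" "s' = [] \<or> t' = [] \<or> hd s' \<noteq> hd t'"
proof -
  have "\<exists>u s' t'. s = u @ s' \<and> t = u @ t' \<and> (s' = [] \<or> t' = [] \<or> hd s' \<noteq> hd t')"
  proof (induction s t rule: longest_common_prefix.induct)
    case (1 x xs y ys)
    show ?case
    proof (cases "x = y")
      case True
      then obtain u s' t' where "xs = u @ s'" "ys = u @ t'" "s' = [] \<or> t' = [] \<or> hd s' \<noteq> hd t'" using 1 by blast
      then show ?thesis using True by (intro exI[of _ "x # u"] exI[of _ s'] exI[of _ t']) simp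
    qed (rule exI[of _ "[]"], simp)
  qed (rule exI[of _ "[]"], simp)+
  then show thesis using that by blast
qed

text \<open>An embedding of the tree into its even levels: each term \<open>m\<close> is followed by a second term that depends on the vertex
reached so far and on \<open>m\<close>.\<close>

definition step_twice :: "(nat list \<Rightarrow> nat \<Rightarrow> nat) \<Rightarrow> nat list \<Rightarrow> nat list \<Rightarrow> nat list" where
  "step_twice \<nu> = foldl (\<lambda>u m. u @ [m, \<nu> u m])"

lemma step_twice_snoc: "step_twice \<nu> u (s @ [m]) = step_twice \<nu> u s @ [m, \<nu> (step_twice \<nu> u s) m]"
  unfolding step_twice_def by simp

lemma step_twice_append: "step_twice \<nu> u (s @ t) = step_twice \<nu> (step_twice \<nu> u s) t"
  unfolding step_twice_def by simp

lemma step_twice_extends: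
  obtains s' where "step_twice \<nu> u s = u @ s'" "length s' = 2 * length s" "s \<noteq> [] \<longrightarrow> hd s' = hd s" "s' = [] \<longleftrightarrow> s = []"
proof -
  have "\<exists>s'. step_twice \<nu> u s = u @ s' \<and> length s' = 2 * length s \<and> (s \<noteq> [] \<longrightarrow> hd s' = hd s)"
  proof (induction s arbitrary: u)
    case Nil
    then show ?case by (simp add: step_twice_def)
  next
    case (Cons m s)
    obtain s' where "step_twice \<nu> (u @ [m, \<nu> u m]) s = (u @ [m, \<nu> u m]) @ s'" "length s' = 2 * length s" using Cons.IH by blast
    then show ?case by (intro exI[of _ "m # \<nu> u m # s'"]) (simp add: step_twice_def)
  qed
  then show thesis using that by fastforce
qed

text \<open>The embedding doubles distances since two branches still part at the freely chosen term \<open>m\<close>.\<close>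

lemma tree_dist_step_twice: "tree_dist (step_twice \<nu> [] s) (step_twice \<nu> [] t) = 2 * tree_dist s t"
proof -
  obtain u s' t' where d: "s = u @ s'" "t = u @ t'" "s' = [] \<or> t' = [] \<or> hd s' \<noteq> hd t'" by (rule split_at_branching)
  define w where "w = step_twice \<nu> [] u"
  obtain s'' where s: "step_twice \<nu> w s' = w @ s''" "length s'' = 2 * length s'" "s' \<noteq> [] \<longrightarrow> hd s'' = hd s'" "s'' = [] \<longleftrightarrow> s' = []"
    by (rule step_twice_extends[of \<nu> w s'])
  obtain t'' where t: "step_twice \<nu> w t' = w @ t''" "length t'' = 2 * length t'" "t' \<noteq> [] \<longrightarrow> hd t'' = hd t'" "t'' = [] \<longleftrightarrow> t' = []"
    by (rule step_twice_extends[of \<nu> w t'])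
  have "tree_dist (w @ s'') (w @ t'') = real (length s'') + real (length t'')"
    by (rule tree_dist_split) (use s t d(3) in metis)
  moreover have "tree_dist s t = real (length s') + real (length t')" unfolding d(1,2) by (rule tree_dist_split[OF d(3)])
  ultimately show ?thesis using s(1,2) t(1,2) unfolding d(1,2) step_twice_append w_def[symmetric] by simp
qed

lemma tree_dist_edge: "tree_dist (s @ [n]) s = 1"
  using tree_dist_split[of "[n]" "[]" s] by simp

lemma tree_dist_siblings: "m \<noteq> n \<Longrightarrow> tree_dist (s @ [m]) (s @ [n]) = 2"
  using tree_dist_split[of "[m]" "[n]" s] by simp

text \<open>With \<open>x\<close> the normalized first edge and \<open>u n\<close> the normalized second edges above it, property \<open>(\<beta>)\<close> picks a
second term \<open>\<nu> s m\<close> for which the two edges together have length at most \<open>2 * L * (1 - \<beta>)\<close>.\<close>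

lemma beta_shrinks_edges:
  assumes N: "is_norm N" and Mn: "is_norm M" and A: "linear A" and L: "L > 0" "L \<le> L0" and c: "c > 0"
    and edge: "\<And>s n. N (\<psi> (s @ [n]) - \<psi> s) \<le> L"
    and sep: "\<And>s t. M (A (\<psi> s) - A (\<psi> t)) \<ge> c * tree_dist s t"
    and beta: "\<And>x (u :: nat \<Rightarrow> 'a::real_vector). N x \<le> 1 \<Longrightarrow> (\<And>n. N (u n) \<le> 1) \<Longrightarrow>
        (\<And>m n. m \<noteq> n \<Longrightarrow> M (A (u m) - A (u n)) \<ge> 2 * c / L0) \<Longrightarrow> \<exists>n. N (x + u n) \<le> 2 * (1 - \<beta>)"
  shows "\<exists>\<psi>'. (\<forall>s n. N (\<psi>' (s @ [n]) - \<psi>' s) \<le> L * (1 - \<beta>)) \<and> (\<forall>s t. M (A (\<psi>' s) - A (\<psi>' t)) \<ge> c * tree_dist s t)"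
proof -
  have Ns: "N (a *\<^sub>R x) = \<bar>a\<bar> * N x" for a x using N unfolding is_norm_def by blast
  have Ms: "M (a *\<^sub>R x) = \<bar>a\<bar> * M x" for a x using Mn unfolding is_norm_def by blast
  have "\<exists>n. N (\<psi> (s @ [m, n]) - \<psi> s) \<le> 2 * (L * (1 - \<beta>))" for s m
  proof -
    define x where "x = (1/L) *\<^sub>R (\<psi> (s @ [m]) - \<psi> s)"
    define u where "u n = (1/L) *\<^sub>R (\<psi> (s @ [m, n]) - \<psi> (s @ [m]))" for n
    have "\<exists>n. N (x + u n) \<le> 2 * (1 - \<beta>)"
    proof (rule beta)
      show "N x \<le> 1" unfolding x_def Ns using edge[of s m] L(1) by simp
      show "N (u n) \<le> 1" for n unfolding u_def Ns using edge[of "s @ [m]" n] L(1) by simp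
      fix i j :: nat assume ij: "i \<noteq> j"
      have "A (u i) - A (u j) = (1/L) *\<^sub>R (A (\<psi> ((s @ [m]) @ [i])) - A (\<psi> ((s @ [m]) @ [j])))"
        unfolding u_def by (simp add: linear_scale[OF A] linear_diff[OF A] algebra_simps)
      then have "M (A (u i) - A (u j)) = (1/L) * M (A (\<psi> ((s @ [m]) @ [i])) - A (\<psi> ((s @ [m]) @ [j])))"
        unfolding Ms using L(1) Ms by simp
      moreover have "M (A (\<psi> ((s @ [m]) @ [i])) - A (\<psi> ((s @ [m]) @ [j]))) \<ge> c * 2"
        using sep[of "(s @ [m]) @ [i]" "(s @ [m]) @ [j]"] unfolding tree_dist_siblings[OF ij] .
      ultimately have "M (A (u i) - A (u j)) \<ge> 2 * c / L" using L(1) by (simp add: field_simps)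
      moreover have "2 * c / L0 \<le> 2 * c / L" using L c by (intro divide_left_mono) auto
      ultimately show "M (A (u i) - A (u j)) \<ge> 2 * c / L0" by linarith
    qed
    then obtain n where n: "N (x + u n) \<le> 2 * (1 - \<beta>)" by blast
    have "x + u n = (1/L) *\<^sub>R (\<psi> (s @ [m, n]) - \<psi> s)" unfolding x_def u_def by (simp add: algebra_simps)
    then have "(1/L) * N (\<psi> (s @ [m, n]) - \<psi> s) \<le> 2 * (1 - \<beta>)" using n Ns L(1) by simp
    then have "N (\<psi> (s @ [m, n]) - \<psi> s) \<le> 2 * (1 - \<beta>) * L" using L(1) by (simp add: divide_le_eq)
    then show ?thesis by (intro exI[of _ n]) (simp add: mult_ac)
  qed
  then obtain \<nu> where nu: "\<And>s m. N (\<psi> (s @ [m, \<nu> s m]) - \<psi> s) \<le> 2 * (L * (1 - \<beta>))" by metis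
  define \<psi>' where "\<psi>' s = (1/2) *\<^sub>R \<psi> (step_twice \<nu> [] s)" for s
  show ?thesis
  proof (intro exI[of _ \<psi>'] conjI allI)
    fix s n
    have "\<psi>' (s @ [n]) - \<psi>' s = (1/2) *\<^sub>R (\<psi> (step_twice \<nu> [] s @ [n, \<nu> (step_twice \<nu> [] s) n]) - \<psi> (step_twice \<nu> [] s))"
      unfolding \<psi>'_def step_twice_snoc by (simp add: scaleR_diff_right)
    then have "N (\<psi>' (s @ [n]) - \<psi>' s) = 1/2 * N (\<psi> (step_twice \<nu> [] s @ [n, \<nu> (step_twice \<nu> [] s) n]) - \<psi> (step_twice \<nu> [] s))"
      using Ns by simp
    then show "N (\<psi>' (s @ [n]) - \<psi>' s) \<le> L * (1 - \<beta>)" using nu[of "step_twice \<nu> [] s" n] by simp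
  next
    fix s t
    have "A (\<psi>' s) - A (\<psi>' t) = (1/2) *\<^sub>R (A (\<psi> (step_twice \<nu> [] s)) - A (\<psi> (step_twice \<nu> [] t)))"
      unfolding \<psi>'_def by (simp add: linear_scale[OF A] scaleR_diff_right)
    then have "M (A (\<psi>' s) - A (\<psi>' t)) = 1/2 * M (A (\<psi> (step_twice \<nu> [] s)) - A (\<psi> (step_twice \<nu> [] t)))"
      using Ms by simp
    then show "M (A (\<psi>' s) - A (\<psi>' t)) \<ge> c * tree_dist s t"
      using sep[of "step_twice \<nu> [] s" "step_twice \<nu> [] t"] unfolding tree_dist_step_twice by simp
  qed
qed

theorem not_beta_renormable_if_tree_factor:
  fixes A :: "'a::real_normed_vector \<Rightarrow> 'b::real_normed_vector"
  assumes A: "bounded_linear A" and T: "tree_factors_through A"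
  shows "\<not> admits_equivalent_norm_beta A"
proof
  assume "admits_equivalent_norm_beta A"
  then obtain N M where NM: "equivalent_norm N" "equivalent_norm M" "property_beta N M A"
    unfolding admits_equivalent_norm_beta_def by blast
  obtain a1 b1 where N: "is_norm N" "a1 > 0" "b1 > 0" "\<And>x. a1 * norm x \<le> N x" "\<And>x. N x \<le> b1 * norm x"
    using NM(1) unfolding equivalent_norm_def by blast
  obtain a2 b2 where M: "is_norm M" "a2 > 0" "b2 > 0" "\<And>x. a2 * norm x \<le> M x" "\<And>x. M x \<le> b2 * norm x"
    using NM(2) unfolding equivalent_norm_def by blast
  obtain C where C: "C > 0" "\<And>x. norm (A x) \<le> C * norm x"
    using bounded_linear.pos_bounded[OF A] by (metis mult.commute)
  have lin: "linear A" by (rule bounded_linear.linear[OF A])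
  obtain \<phi> D where D: "D > 0" and low: "\<And>s t. tree_dist s t / D \<le> norm (A (\<phi> s) - A (\<phi> t))"
    and up: "\<And>s t. norm (\<phi> s - \<phi> t) \<le> tree_dist s t"
    using T unfolding tree_factors_through_def by auto
  define c where "c = a2 / D"
  have c: "c > 0" unfolding c_def using M(2) D by simp
  \<comment> \<open>\<open>L\<close> bounds the edges of some embedding that satisfies the fixed lower bound.\<close>
  define valid where "valid L \<longleftrightarrow> (\<exists>\<psi>. (\<forall>s n. N (\<psi> (s @ [n]) - \<psi> s) \<le> L) \<and> (\<forall>s t. M (A (\<psi> s) - A (\<psi> t)) \<ge> c * tree_dist s t))" for L
  have v0: "valid b1"
    unfolding valid_def
  proof (intro exI[of _ \<phi>] conjI allI)
    show "N (\<phi> (s @ [n]) - \<phi> s) \<le> b1" for s n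
      using N(5)[of "\<phi> (s @ [n]) - \<phi> s"] mult_left_mono[OF up[of "s @ [n]" s], of b1] N(3) unfolding tree_dist_edge by linarith
    show "c * tree_dist s t \<le> M (A (\<phi> s) - A (\<phi> t))" for s t
      using M(4)[of "A (\<phi> s) - A (\<phi> t)"] mult_left_mono[OF low[of s t], of a2] M(2) unfolding c_def by simp
  qed
  \<comment> \<open>Two adjacent vertices have images at distance at least \<open>c\<close>, so no valid edge bound is below \<open>c1\<close>.\<close>
  define c1 where "c1 = c * a1 / (b2 * C)"
  have c1: "c1 > 0" unfolding c1_def using c N M C by simp
  have vlow: "c1 \<le> L" if "valid L" for L
  proof -
    obtain \<psi> where \<psi>: "\<And>s n. N (\<psi> (s @ [n]) - \<psi> s) \<le> L" "\<And>s t. M (A (\<psi> s) - A (\<psi> t)) \<ge> c * tree_dist s t"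
      using \<open>valid L\<close> unfolding valid_def by blast
    define w where "w = \<psi> ([] @ [0]) - \<psi> []"
    have "c \<le> M (A w)" using \<psi>(2)[of "[] @ [0]" "[]"] unfolding tree_dist_edge w_def linear_diff[OF lin] by simp
    also have "\<dots> \<le> b2 * norm (A w)" by (rule M(5))
    also have "\<dots> \<le> b2 * (C * norm w)" using M(3) by (intro mult_left_mono C) auto
    finally have "c * a1 \<le> b2 * (C * norm w) * a1" using N(2) by (intro mult_right_mono) auto
    also have "\<dots> = (b2 * C) * (a1 * norm w)" by simp
    also have "\<dots> \<le> (b2 * C) * L" using N(4)[of w] \<psi>(1)[of "[]" 0] M(3) C(1) unfolding w_def by (intro mult_left_mono) auto
    finally show ?thesis unfolding c1_def using M(3) C(1) by (simp add: divide_le_eq mult.commute)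
  qed
  have "2 * c / b1 > 0" using c N(3) by simp
  then obtain \<beta> where b: "\<beta> > 0" and beta: "\<And>x (u :: nat \<Rightarrow> 'a). N x \<le> 1 \<Longrightarrow> (\<forall>n. N (u n) \<le> 1) \<Longrightarrow>
        (INF (m, n)\<in>{(m, n). m \<noteq> n}. M (A (u m) - A (u n))) \<ge> 2 * c / b1 \<Longrightarrow> \<exists>n. N (x + u n) \<le> 2 * (1 - \<beta>)"
    using NM(3) unfolding property_beta_def by blast
  have step: "valid (L * (1 - \<beta>))" if L: "valid L" "L \<le> b1" for L
  proof -
    obtain \<psi> where \<psi>: "\<And>s n. N (\<psi> (s @ [n]) - \<psi> s) \<le> L" "\<And>s t. M (A (\<psi> s) - A (\<psi> t)) \<ge> c * tree_dist s t"
      using L(1) unfolding valid_def by blast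
    have "L > 0" using vlow[OF L(1)] c1 by linarith
    show ?thesis
      unfolding valid_def
    proof (rule beta_shrinks_edges[OF N(1) M(1) lin \<open>L > 0\<close> L(2) c \<psi>])
      fix x and u :: "nat \<Rightarrow> 'a"
      assume "N x \<le> 1" "\<And>n. N (u n) \<le> 1" and sep: "\<And>m n. m \<noteq> n \<Longrightarrow> 2 * c / b1 \<le> M (A (u m) - A (u n))"
      moreover have "(INF (m, n)\<in>{(m, n). m \<noteq> n}. M (A (u m) - A (u n))) \<ge> 2 * c / b1"
      proof (rule cINF_greatest)
        have "(0 :: nat, 1 :: nat) \<in> {(m, n). m \<noteq> n}" by simp
        then show "{(m :: nat, n :: nat). m \<noteq> n} \<noteq> {}" by blast
      qed (use sep in auto)
      ultimately show "\<exists>n. N (x + u n) \<le> 2 * (1 - \<beta>)" by (intro beta) auto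
    qed
  qed
  have pow: "valid (b1 * (1 - \<beta>) ^ k) \<and> b1 * (1 - \<beta>) ^ k \<le> b1" for k
  proof (induction k)
    case (Suc k)
    then have v: "valid (b1 * (1 - \<beta>) ^ k * (1 - \<beta>))" by (intro step) auto
    have "b1 * (1 - \<beta>) ^ k \<ge> 0" using vlow[of "b1 * (1 - \<beta>) ^ k"] Suc c1 by linarith
    then have "b1 * (1 - \<beta>) ^ k * (1 - \<beta>) \<le> b1 * (1 - \<beta>) ^ k * 1" using b by (intro mult_left_mono) auto
    then show ?case using v Suc by (simp add: mult_ac)
  qed (use v0 in simp)
  obtain k where k: "(1 - \<beta>) ^ k < c1 / b1"
    using real_arch_pow_inv[of "c1 / b1" "1 - \<beta>"] c1 N(3) b by auto
  then have "b1 * (1 - \<beta>) ^ k < c1" using N(3) by (simp add: field_simps)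
  then show False using vlow pow[of k] by fastforce
qed

section \<open>The dichotomy\<close>

theorem theorem1p4:
  fixes A :: "'a::banach \<Rightarrow> 'b::banach"
  assumes "weakly_compact_operator A"
  shows "(tree_factors_through A \<or> admits_equivalent_norm_beta A) \<and>
         \<not> (tree_factors_through A \<and> admits_equivalent_norm_beta A)"
proof -
  have "bounded_linear A" using assms unfolding weakly_compact_operator_def by blast
  then show ?thesis
    using beta_renormable_if_not_tree_factor[OF assms] not_beta_renormable_if_tree_factor by blast
qed

end
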